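(* Let $u \in C_b(\Omega) \cap H^1_{\mathrm{loc}}(\Omega)$ and $\chi \in C_b(\Omega) \cap H^1(\Omega)$ with $0 \le \chi \le 1$. Suppose that $\mathcal A u \in H^{-1}(\Omega)$ and $\limsup_{x\to z} (\chi\,\mathrm{Re}\,u)(x) \le 0$ for quasi every $z \in \Gamma$. Then $(\chi\,\mathrm{Re}\,u)^+ \in H^1_0(\Omega)$.
   Context: Setting: $d \ge 2$, $\Omega \subset \mathbb R^d$ is open and bounded with boundary $\Gamma = \partial\Omega$; functions are complex-valued unless said otherwise. For $k,l \in \{1,\ldots,d\}$, $a_{kl} \colon \Omega \to \mathbb R$ is bounded and measurable, and there is $\mu \in (0,1]$ with $\mathrm{Re} \sum_{k,l=1}^d a_{kl}(x)\,\xi_k\,\overline{\xi_l} \ge \mu|\xi|^2$ for all $x \in \Omega$, $\xi \in \mathbb C^d$. Further $b_k, c_0 \colon \Omega \to \mathbb C$ and $c_k \colon \Omega \to \mathbb R$ ($k=1,\ldots,d$) are bounded and measurable. $\mathcal D'(\Omega)$ is the antidual of $\mathcal D(\Omega) = C_c^\infty(\Omega)$. Define $\mathcal A \colon H^1_{\mathrm{loc}}(\Omega) \to \mathcal D'(\Omega)$ by $$\langle \mathcal A u, v\rangle = \sum_{k,l=1}^d \int_\Omega a_{kl}(\partial_l u)\overline{\partial_k v} + \sum_{k=1}^d \int_\Omega b_k u\,\overline{\partial_k v} + \sum_{k=1}^d \int_\Omega c_k(\partial_k u)\overline v + \int_\Omega c_0 u \overline v$$ for $v \in C_c^\infty(\Omega)$.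 Standing assumption: $0$ is not a Dirichlet eigenvalue, i.e. if $u \in H^1_0(\Omega)$ and $\mathcal A u = 0$, then $u = 0$. $C_b(\Omega)$ is the space of bounded continuous functions on $\Omega$. $H^{-1}(\Omega)$ is the antidual of $H^1_0(\Omega)$, identified with the set of all $F \in \mathcal D'(\Omega)$ for which there is $c>0$ with $|\langle F,v\rangle| \le c\|v\|_{H^1(\Omega)}$ for all $v \in C_c^\infty(\Omega)$. For real-valued $f$, $f^+ = \max(f,0)$. Capacity: $\mathrm{cap}(E) = \inf\{\|w\|_{H^1(\mathbb R^d)}^2 : w \in H^1(\mathbb R^d),\ w \ge 1 \text{ a.e. on a neighbourhood of } E\}$ is the standard $H^1$-capacity. A set $P$ is polar if $\mathrm{cap}\,P = 0$. A property holds for quasi every $z \in \Gamma$ if there is a polar set $P \subset \Gamma$ such that it holds for all $z \in \Gamma \setminus P$. Limits $x \to z$ are taken with $x \in \Omega$. *)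

theory Defs
  imports "HOL-Analysis.Analysis"
begin

text \<open>Functions on an open set \<open>\<Omega>\<close> are represented by total functions on \<^typ>\<open>real ^ 'n\<close> whose
  values outside \<open>\<Omega>\<close> are irrelevant; only test functions are functions on the whole space (extended
  by zero). Elements of Lebesgue and Sobolev spaces are represented by arbitrary representatives:
  membership in \<open>L1loc\<close>, \<open>L2\<close>, \<open>L2loc\<close>, \<open>H1\<close>, \<open>H1loc\<close> and \<open>H10\<close> is invariant under changes on null
  sets.\<close>

definition partial :: "'n \<Rightarrow> (real ^ 'n \<Rightarrow> complex) \<Rightarrow> real ^ 'n \<Rightarrow> complex" where
  "partial k f x = frechet_derivative f (at x) (axis k 1)"

text \<open>The derivative belonging to a list of coordinate directions.\<close>

definition partials :: "'n list \<Rightarrow> (real ^ 'n \<Rightarrow> complex) \<Rightarrow> real ^ 'n \<Rightarrow> complex" where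
  "partials ks f = foldr partial ks f"

definition supp :: "(real ^ 'n \<Rightarrow> complex) \<Rightarrow> (real ^ 'n) set" where
  "supp f = closure {x. f x \<noteq> 0}"

definition test_functions :: "(real ^ 'n) set \<Rightarrow> (real ^ 'n \<Rightarrow> complex) set" where
  "test_functions \<Omega> =
    {\<phi>. (\<forall>ks x. partials ks \<phi> differentiable (at x)) \<and> compact (supp \<phi>) \<and> supp \<phi> \<subseteq> \<Omega>}"

text \<open>The antidual of the test functions: antilinear functionals which are continuous for the usual
  inductive limit topology. Only the values on test functions matter.\<close>

definition distributions :: "(real ^ 'n) set \<Rightarrow> ((real ^ 'n \<Rightarrow> complex) \<Rightarrow> complex) set" where
  "distributions \<Omega> = {F.
    (\<forall>\<phi>\<in>test_functions \<Omega>. \<forall>\<psi>\<in>test_functions \<Omega>. F (\<lambda>x. \<phi> x + \<psi> x) = F \<phi> + F \<psi>) \<and>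
    (\<forall>\<phi>\<in>test_functions \<Omega>. \<forall>\<alpha>. F (\<lambda>x. \<alpha> * \<phi> x) = cnj \<alpha> * F \<phi>) \<and>
    (\<forall>K. compact K \<and> K \<subseteq> \<Omega> \<longrightarrow> (\<exists>C N. \<forall>\<phi>\<in>test_functions \<Omega>. supp \<phi> \<subseteq> K \<longrightarrow>
       norm (F \<phi>) \<le> C * (\<Sum>ks | length ks \<le> N. SUP x. norm (partials ks \<phi> x))))}"

definition L1loc :: "(real ^ 'n) set \<Rightarrow> (real ^ 'n \<Rightarrow> complex) set" where
  "L1loc \<Omega> = {u. \<forall>K. compact K \<and> K \<subseteq> \<Omega> \<longrightarrow> integrable (lebesgue_on K) u}"

definition L2 :: "(real ^ 'n) set \<Rightarrow> (real ^ 'n \<Rightarrow> complex) set" where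
  "L2 \<Omega> = {u \<in> borel_measurable (lebesgue_on \<Omega>).
             integrable (lebesgue_on \<Omega>) (\<lambda>x. (norm (u x))\<^sup>2)}"

definition L2loc :: "(real ^ 'n) set \<Rightarrow> (real ^ 'n \<Rightarrow> complex) set" where
  "L2loc \<Omega> = {u. \<forall>K. compact K \<and> K \<subseteq> \<Omega> \<longrightarrow> u \<in> L2 K}"

definition is_weak_partial ::
  "(real ^ 'n) set \<Rightarrow> 'n \<Rightarrow> (real ^ 'n \<Rightarrow> complex) \<Rightarrow> (real ^ 'n \<Rightarrow> complex) \<Rightarrow> bool" where
  "is_weak_partial \<Omega> k u g \<longleftrightarrow> u \<in> L1loc \<Omega> \<and> g \<in> L1loc \<Omega> \<and>
    (\<forall>\<phi>\<in>test_functions \<Omega>.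
       (LINT x|lebesgue_on \<Omega>. u x * partial k \<phi> x) = - (LINT x|lebesgue_on \<Omega>. g x * \<phi> x))"

text \<open>For open \<open>\<Omega>\<close> the weak derivative, if it exists, is unique up to null sets; this selects one
  representative.\<close>

definition weak_partial ::
  "(real ^ 'n) set \<Rightarrow> 'n \<Rightarrow> (real ^ 'n \<Rightarrow> complex) \<Rightarrow> real ^ 'n \<Rightarrow> complex" where
  "weak_partial \<Omega> k u = (SOME g. is_weak_partial \<Omega> k u g)"

definition H1 :: "(real ^ 'n) set \<Rightarrow> (real ^ 'n \<Rightarrow> complex) set" where
  "H1 \<Omega> = {u \<in> L2 \<Omega>. \<forall>k. \<exists>g\<in>L2 \<Omega>. is_weak_partial \<Omega> k u g}"

definition H1loc :: "(real ^ 'n) set \<Rightarrow> (real ^ 'n \<Rightarrow> complex) set" where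
  "H1loc \<Omega> = {u \<in> L2loc \<Omega>. \<forall>k. \<exists>g\<in>L2loc \<Omega>. is_weak_partial \<Omega> k u g}"

definition H1_norm :: "(real ^ 'n) set \<Rightarrow> (real ^ 'n \<Rightarrow> complex) \<Rightarrow> real" where
  "H1_norm \<Omega> u = sqrt ((LINT x|lebesgue_on \<Omega>. (norm (u x))\<^sup>2) +
     (\<Sum>k\<in>UNIV. LINT x|lebesgue_on \<Omega>. (norm (weak_partial \<Omega> k u x))\<^sup>2))"

text \<open>The closure of the test functions in \<open>H1 \<Omega>\<close>.\<close>

definition H10 :: "(real ^ 'n) set \<Rightarrow> (real ^ 'n \<Rightarrow> complex) set" where
  "H10 \<Omega> = {u \<in> H1 \<Omega>. \<forall>\<epsilon>>0. \<exists>\<phi>\<in>test_functions \<Omega>. H1_norm \<Omega> (\<lambda>x. u x - \<phi> x) < \<epsilon>}"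

definition Hminus1 :: "(real ^ 'n) set \<Rightarrow> ((real ^ 'n \<Rightarrow> complex) \<Rightarrow> complex) set" where
  "Hminus1 \<Omega> = {F \<in> distributions \<Omega>.
     \<exists>c>0. \<forall>v\<in>test_functions \<Omega>. norm (F v) \<le> c * H1_norm \<Omega> v}"

definition Cb :: "(real ^ 'n) set \<Rightarrow> (real ^ 'n \<Rightarrow> complex) set" where
  "Cb \<Omega> = {u. continuous_on \<Omega> u \<and> bounded (u ` \<Omega>)}"

definition bdd_measurable :: "(real ^ 'n) set \<Rightarrow> (real ^ 'n \<Rightarrow> 'b::real_normed_vector) \<Rightarrow> bool" where
  "bdd_measurable \<Omega> f \<longleftrightarrow> f \<in> borel_measurable (lebesgue_on \<Omega>) \<and> bounded (f ` \<Omega>)"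

text \<open>The value at the test function \<open>v\<close> of the distribution which the operator with coefficients
  \<open>a\<close>, \<open>b\<close>, \<open>c\<close>, \<open>c0\<close> assigns to \<open>u\<close>.\<close>

definition elliptic_op ::
  "(real ^ 'n) set \<Rightarrow> ('n \<Rightarrow> 'n \<Rightarrow> real ^ 'n \<Rightarrow> real) \<Rightarrow> ('n \<Rightarrow> real ^ 'n \<Rightarrow> complex) \<Rightarrow>
   ('n \<Rightarrow> real ^ 'n \<Rightarrow> real) \<Rightarrow> (real ^ 'n \<Rightarrow> complex) \<Rightarrow>
   (real ^ 'n \<Rightarrow> complex) \<Rightarrow> (real ^ 'n \<Rightarrow> complex) \<Rightarrow> complex" where
  "elliptic_op \<Omega> a b c c0 u v =
     (\<Sum>k\<in>UNIV. \<Sum>l\<in>UNIV. LINT x|lebesgue_on \<Omega>.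
        complex_of_real (a k l x) * weak_partial \<Omega> l u x * cnj (partial k v x)) +
     (\<Sum>k\<in>UNIV. LINT x|lebesgue_on \<Omega>. b k x * u x * cnj (partial k v x)) +
     (\<Sum>k\<in>UNIV. LINT x|lebesgue_on \<Omega>.
        complex_of_real (c k x) * weak_partial \<Omega> k u x * cnj (v x)) +
     (LINT x|lebesgue_on \<Omega>. c0 x * u x * cnj (v x))"

text \<open>Extended-real valued, so that the infimum of the empty set is infinite.\<close>

definition cap :: "(real ^ 'n) set \<Rightarrow> ereal" where
  "cap E = Inf {ereal ((H1_norm UNIV (\<lambda>x. complex_of_real (w x)))\<^sup>2) | w :: real ^ 'n \<Rightarrow> real.
     (\<lambda>x. complex_of_real (w x)) \<in> H1 UNIV \<and>
     (\<exists>U. open U \<and> E \<subseteq> U \<and> (AE x in lebesgue_on U. 1 \<le> w x))}"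

definition polar :: "(real ^ 'n) set \<Rightarrow> bool" where
  "polar P \<longleftrightarrow> cap P = 0"

definition quasi_everywhere :: "(real ^ 'n) set \<Rightarrow> (real ^ 'n \<Rightarrow> bool) \<Rightarrow> bool" where
  "quasi_everywhere \<Gamma> Q \<longleftrightarrow> (\<exists>P\<subseteq>\<Gamma>. polar P \<and> (\<forall>z\<in>\<Gamma> - P. Q z))"

end

theory Submission
  imports Defs
begin

text \<open>Put \<open>w = chi * Re u\<close> and let \<open>M\<close> bound \<open>|u|\<close>. Polarity provides nonnegative \<open>\<eta>\<close> of arbitrarily small \<open>H\<^sup>1\<close>
  norm with \<open>\<eta> \<ge> 1\<close> near the exceptional set, so that the truncation \<open>\<psi> = (w - \<epsilon> - M * \<eta>)\<^sup>+\<close> vanishes almost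
  everywhere near the boundary. Testing the equation with \<open>chi * \<psi>\<close> bounds the \<open>L\<^sup>2\<close> norm of
  \<open>chi * grad (Re u)\<close> over the set where \<open>\<psi> > 0\<close>, uniformly in \<open>\<epsilon>\<close> and \<open>\<eta>\<close>; the coefficients \<open>a\<close> and \<open>c\<close>
  being real, the imaginary part of \<open>u\<close> enters only through bounded terms of order zero. By Fatou's lemma
  the gradient of \<open>w\<^sup>+\<close> is square integrable, and dominated convergence shows \<open>\<psi> \<rightarrow> w\<^sup>+\<close> in \<open>H\<^sup>1\<close> as \<open>\<epsilon>\<close> and the norm of
  \<open>\<eta>\<close> tend to zero. Since the \<open>\<psi>\<close> have compact support, mollification approximates them by test functions.\<close>

section \<open>Smooth functions\<close>

definition smooth :: "(real ^ 'n \<Rightarrow> complex) \<Rightarrow> bool" where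
  "smooth f \<longleftrightarrow> (\<forall>ks x. partials ks f differentiable (at x))"

lemma test_functions_iff:
  "\<phi> \<in> test_functions \<Omega> \<longleftrightarrow> smooth \<phi> \<and> compact (supp \<phi>) \<and> supp \<phi> \<subseteq> \<Omega>"
  by (simp add: test_functions_def smooth_def)

lemma smooth_coinduct:
  assumes "f \<in> X"
    and "\<And>f x. f \<in> X \<Longrightarrow> f differentiable (at x)"
    and "\<And>f k. f \<in> X \<Longrightarrow> partial k f \<in> X"
  shows "smooth f"
proof -
  have "partials ks f \<in> X" for ks
    by (induction ks) (use assms in \<open>auto simp: partials_def\<close>)
  with assms(2) show ?thesis by (auto simp: smooth_def)
qed

lemma smooth_differentiable: "smooth f \<Longrightarrow> f differentiable (at x)"
  unfolding smooth_def by (metis foldr.simps(1) id_apply partials_def)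

lemma smooth_partial: "smooth f \<Longrightarrow> smooth (partial k f)"
proof -
  assume "smooth f"
  then have "partials (ks @ [k]) f differentiable (at x)" for ks x
    unfolding smooth_def by blast
  then show ?thesis by (simp add: smooth_def partials_def)
qed

lemmas has_frechet_derivative = frechet_derivative_works[THEN iffD1]

lemma partial_eqI:
  assumes "(f has_derivative D) (at x)" shows "partial k f x = D (axis k 1)"
  using frechet_derivative_at[OF assms] by (simp add: partial_def)

lemma has_derivative_partial:
  fixes f :: "real ^ 'n \<Rightarrow> complex"
  assumes "f differentiable (at x)"
  shows "(f has_derivative (\<lambda>h. \<Sum>k\<in>UNIV. (h $ k) *\<^sub>R partial k f x)) (at x)"
proof -
  let ?D = "frechet_derivative f (at x)"
  have D: "(f has_derivative ?D) (at x)"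
    by (rule has_frechet_derivative[OF assms])
  then interpret linear ?D by (auto dest: has_derivative_linear)
  have "?D h = (\<Sum>k\<in>UNIV. (h $ k) *\<^sub>R partial k f x)" for h
  proof -
    have "h = (\<Sum>k\<in>UNIV. (h $ k) *\<^sub>R axis k 1)"
      by (simp add: vec_eq_iff axis_def if_distrib cong: if_cong)
    then have "?D h = ?D (\<Sum>k\<in>UNIV. (h $ k) *\<^sub>R axis k 1)" by simp
    also have "\<dots> = (\<Sum>k\<in>UNIV. (h $ k) *\<^sub>R partial k f x)"
      by (simp add: sum scale partial_def)
    finally show ?thesis .
  qed
  then have "?D = (\<lambda>h. \<Sum>k\<in>UNIV. (h $ k) *\<^sub>R partial k f x)" by auto
  with D show ?thesis by simp
qed

lemma partial_add:
  assumes "f differentiable (at x)" "g differentiable (at x)"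
  shows "partial k (\<lambda>x. f x + g x) x = partial k f x + partial k g x"
  using partial_eqI[OF has_derivative_add[OF assms[THEN has_frechet_derivative]]]
  by (simp add: partial_def)

lemma partial_mult:
  assumes "f differentiable (at x)" "g differentiable (at x)"
  shows "partial k (\<lambda>x. f x * g x) x = f x * partial k g x + partial k f x * g x"
  using partial_eqI[OF has_derivative_mult[OF assms[THEN has_frechet_derivative]]]
  by (simp add: partial_def)

lemma partial_Re:
  assumes "f differentiable (at x)"
  shows "partial k (\<lambda>x. complex_of_real (Re (f x))) x = Re (partial k f x)"
proof -
  have "bounded_linear (\<lambda>z. complex_of_real (Re z))"
    by (intro bounded_linear_compose[OF bounded_linear_of_real bounded_linear_Re])
  from bounded_linear.has_derivative[OF this has_frechet_derivative[OF assms]]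
  show ?thesis by (subst partial_eqI) (auto simp: partial_def)
qed

text \<open>An algebra generated by differentiable functions whose partial derivatives lie again in the
  algebra consists of smooth functions; this avoids the Leibniz rule for higher derivatives.\<close>

inductive_set alg_closure :: "(real ^ 'n \<Rightarrow> complex) set \<Rightarrow> (real ^ 'n \<Rightarrow> complex) set" for S where
  base: "f \<in> S \<Longrightarrow> f \<in> alg_closure S"
| add: "f \<in> alg_closure S \<Longrightarrow> g \<in> alg_closure S \<Longrightarrow> (\<lambda>x. f x + g x) \<in> alg_closure S"
| mult: "f \<in> alg_closure S \<Longrightarrow> g \<in> alg_closure S \<Longrightarrow> (\<lambda>x. f x * g x) \<in> alg_closure S"

lemma smooth_alg_closure:
  assumes S: "\<And>f x. f \<in> S \<Longrightarrow> f differentiable (at x)" "\<And>f k. f \<in> S \<Longrightarrow> partial k f \<in> alg_closure S"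
    and f: "f \<in> alg_closure S"
  shows "smooth f"
proof (rule smooth_coinduct[OF f])
  have *: "(\<forall>x. f differentiable (at x)) \<and> (\<forall>k. partial k f \<in> alg_closure S)"
    if "f \<in> alg_closure S" for f
    using that
  proof induction
    case (add f g)
    have "partial k (\<lambda>x. f x + g x) = (\<lambda>x. partial k f x + partial k g x)" for k
      using add partial_add by blast
    with add show ?case by (auto intro: differentiable_add alg_closure.add)
  next
    case (mult f g)
    have "partial k (\<lambda>x. f x * g x) = (\<lambda>x. f x * partial k g x + partial k f x * g x)" for k
      using mult partial_mult by blast
    with mult show ?case
      by (auto intro!: differentiable_mult alg_closure.add alg_closure.mult)
  qed (use S in auto)
  show "f differentiable (at x)" if "f \<in> alg_closure S" for f x using * that by blast
  show "partial k f \<in> alg_closure S" if "f \<in> alg_closure S" for f k using * that by blast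
qed

lemma smooth_mult:
  assumes "smooth f" "smooth g" shows "smooth (\<lambda>x. f x * g x)"
proof (rule smooth_alg_closure[of "{f. smooth f}"])
  show "(\<lambda>x. f x * g x) \<in> alg_closure {f. smooth f}"
    using assms by (intro alg_closure.mult alg_closure.base) auto
qed (auto intro: smooth_differentiable smooth_partial alg_closure.base)

lemma partial_const: "partial k (\<lambda>x. c) = (\<lambda>x. 0)"
  by (auto simp: partial_eqI[OF has_derivative_const])

lemma smooth_const: "smooth (\<lambda>x. c)"
  by (rule smooth_coinduct[of _ "{\<lambda>x. c |c. True}"]) (auto simp: partial_const)

lemma smooth_Re: "smooth f \<Longrightarrow> smooth (\<lambda>x. complex_of_real (Re (f x)))"
proof (rule smooth_coinduct[of _ "{\<lambda>x. complex_of_real (Re (f x)) | f. smooth f}"], goal_cases)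
  case (2 f x)
  then obtain g where g: "f = (\<lambda>x. complex_of_real (Re (g x)))" "smooth g" by auto
  have "bounded_linear (\<lambda>z. complex_of_real (Re z))"
    by (intro bounded_linear_compose[OF bounded_linear_of_real bounded_linear_Re])
  from bounded_linear.has_derivative[OF this has_frechet_derivative[OF smooth_differentiable[OF g(2)]]]
  show ?case unfolding g(1) differentiable_def by blast
next
  case (3 f k)
  then obtain g where g: "f = (\<lambda>x. complex_of_real (Re (g x)))" "smooth g" by auto
  have "partial k f = (\<lambda>x. complex_of_real (Re (partial k g x)))"
    using g by (auto simp: partial_Re smooth_differentiable)
  with g smooth_partial show ?case by blast
qed auto

lemma partial_reflect:
  assumes "smooth f"
  shows "partial k (\<lambda>y. f (x - y)) = (\<lambda>y. - partial k f (x - y))"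
proof
  fix y
  have d: "((\<lambda>y. x - y) has_derivative (\<lambda>h. - h)) (at y)"
    by (auto intro!: derivative_eq_intros)
  have "((\<lambda>y. f (x - y)) has_derivative (\<lambda>h. frechet_derivative f (at (x - y)) (- h))) (at y)"
    using diff_chain_at[OF d has_frechet_derivative[OF smooth_differentiable[OF assms]]]
    by (simp add: o_def)
  then have "partial k (\<lambda>y. f (x - y)) y = frechet_derivative f (at (x - y)) (- axis k 1)"
    by (rule partial_eqI)
  also have "\<dots> = - partial k f (x - y)"
    by (simp add: partial_def linear_neg[OF linear_frechet_derivative[OF smooth_differentiable[OF assms]]])
  finally show "partial k (\<lambda>y. f (x - y)) y = - partial k f (x - y)" .
qed

lemma smooth_reflect:
  assumes "smooth f" shows "smooth (\<lambda>y. f (x - y))"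
proof (rule smooth_coinduct[of _ "{\<lambda>y. f (x - y) | f. smooth f}"], goal_cases)
  case (2 g y)
  then obtain f where f: "g = (\<lambda>y. f (x - y))" "smooth f" by auto
  have "(\<lambda>y. x - y) differentiable (at y)" by (intro derivative_intros)
  then show ?case
    unfolding f(1) by (rule differentiable_compose[OF smooth_differentiable[OF f(2)]])
next
  case (3 g k)
  then obtain f where f: "g = (\<lambda>y. f (x - y))" "smooth f" by auto
  have "partial k g = (\<lambda>y. (\<lambda>z. (-1) * partial k f z) (x - y))"
    using f by (auto simp: partial_reflect)
  moreover have "smooth (\<lambda>z. (-1) * partial k f z)"
    using f by (intro smooth_mult smooth_const smooth_partial)
  ultimately show ?case
    by (intro CollectI exI[of _ "\<lambda>z. (-1) * partial k f z"] conjI)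
qed (use assms in auto)

section \<open>A mollifier\<close>

definition flat :: "nat \<Rightarrow> real \<Rightarrow> real" where
  "flat m t = (if t > 0 then exp (- 1 / t) / t ^ m else 0)"

lemma flat_nonneg: "0 \<le> flat m t" by (simp add: flat_def)

lemma flat_tendsto: "((\<lambda>t. flat m t) \<longlongrightarrow> 0) (at 0)"
proof -
  have "((\<lambda>t. flat m t) \<longlongrightarrow> 0) (at_right 0)"
  proof (rule Lim_transform_eventually)
    have "((\<lambda>x::real. (x ^ m / exp x)) \<longlongrightarrow> 0) at_top" by (rule tendsto_power_div_exp_0)
    from filterlim_compose[OF this filterlim_inverse_at_top_right]
    show "((\<lambda>t::real. inverse t ^ m / exp (inverse t)) \<longlongrightarrow> 0) (at_right 0)" .
    show "\<forall>\<^sub>F t::real in at_right 0. inverse t ^ m / exp (inverse t) = flat m t"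
      unfolding eventually_at_filter
      by (rule always_eventually) (auto simp: flat_def exp_minus field_simps)
  qed
  moreover have "((\<lambda>t. flat m t) \<longlongrightarrow> 0) (at_left 0)"
    by (rule Lim_transform_eventually[OF tendsto_const])
       (auto simp: eventually_at_filter flat_def)
  ultimately show ?thesis by (simp add: filterlim_split_at)
qed

lemma flat_deriv:
  "(flat m has_real_derivative (flat (m + 2) t - m * flat (m + 1) t)) (at t)"
proof (cases t "0::real" rule: linorder_cases)
  case greater
  have "((\<lambda>t. exp (- 1 / t) / t ^ m) has_real_derivative
      (flat (m + 2) t - m * flat (m + 1) t)) (at t)"
    using greater
    by (auto intro!: derivative_eq_intros simp: flat_def field_simps power2_eq_square)
       (cases m; simp add: field_simps)
  then show ?thesis
    by (rule has_field_derivative_transform_within[where d = t]) (use greater in \<open>auto simp: dist_real_def flat_def\<close>)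
next
  case less
  have "((\<lambda>t::real. 0) has_real_derivative (flat (m + 2) t - m * flat (m + 1) t)) (at t)"
    using less by (auto simp: flat_def)
  then show ?thesis
    by (rule has_field_derivative_transform_within[where d = "- t"]) (use less in \<open>auto simp: dist_real_def flat_def\<close>)
next
  case equal
  have "((\<lambda>h. (flat m (0 + h) - flat m 0) / h) \<longlongrightarrow> 0) (at 0)"
    by (rule Lim_transform_eventually[OF flat_tendsto[of "m + 1"]])
       (auto simp: eventually_at_filter flat_def)
  then show ?thesis using equal by (simp add: DERIV_def) (simp add: flat_def)
qed

definition bump :: "real \<Rightarrow> real ^ 'n \<Rightarrow> real" where
  "bump c x = flat 0 (1 - c * (x \<bullet> x))"

lemma smooth_bump: "smooth (\<lambda>x :: real ^ 'n. complex_of_real (bump c x))"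
proof -
  define F where "F m x = complex_of_real (flat m (1 - c * (x \<bullet> x)))" for m and x :: "real ^ 'n"
  define S where "S = {\<lambda>x :: real ^ 'n. a | a. True} \<union> {\<lambda>x. complex_of_real (x $ k) | k. True} \<union> range F"
  have dF: "(F m has_derivative (\<lambda>h. complex_of_real
     ((flat (m + 2) (1 - c * (x \<bullet> x)) - m * flat (m + 1) (1 - c * (x \<bullet> x))) * (- c * (2 * (x \<bullet> h)))))) (at x)"
    for m x
  proof -
    have "((\<lambda>x. 1 - c * (x \<bullet> x)) has_derivative (\<lambda>h. - c * (2 * (x \<bullet> h)))) (at x)"
      by (auto intro!: derivative_eq_intros simp: inner_commute)
    from DERIV_compose_FDERIV[OF flat_deriv this] show ?thesis
      unfolding F_def by (intro has_derivative_of_real) (simp add: mult.commute)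
  qed
  have pF: "partial k (F m) = (\<lambda>x. (F (m + 2) x + (- of_nat m) * F (m + 1) x) * ((- 2 * c) * complex_of_real (x $ k)))"
    for m k
    by (rule ext, subst partial_eqI[OF dF]) (simp add: F_def inner_axis algebra_simps)
  have dx: "((\<lambda>x. complex_of_real (x $ k)) has_derivative (\<lambda>h. complex_of_real (h $ k))) (at x)"
    for k and x :: "real ^ 'n"
    by (intro has_derivative_of_real bounded_linear_imp_has_derivative bounded_linear_vec_nth)
  have px: "partial j (\<lambda>x :: real ^ 'n. complex_of_real (x $ k)) = (\<lambda>x. complex_of_real (axis j 1 $ k))" for j k
    by (rule ext, subst partial_eqI[OF dx]) simp
  have "F 0 \<in> alg_closure S" by (intro alg_closure.base) (auto simp: S_def)
  moreover have "f differentiable (at x)" if "f \<in> S" for f x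
    using that differentiableI[OF dF] differentiableI[OF dx] by (auto simp: S_def)
  moreover have "partial k f \<in> alg_closure S" if fS: "f \<in> S" for f k
  proof -
    have c: "(\<lambda>x. a) \<in> alg_closure S" for a by (intro alg_closure.base) (auto simp: S_def)
    have x: "(\<lambda>x. complex_of_real (x $ k)) \<in> alg_closure S" for k by (intro alg_closure.base) (auto simp: S_def)
    have F: "F m \<in> alg_closure S" for m by (intro alg_closure.base) (auto simp: S_def)
    have pF': "partial k (F m) \<in> alg_closure S" for m
      unfolding pF by (intro alg_closure.add alg_closure.mult c x F)
    consider a where "f = (\<lambda>x. a)" | j where "f = (\<lambda>x. complex_of_real (x $ j))" | m where "f = F m"
      using fS by (auto simp: S_def)
    then show ?thesis by cases (simp_all only: partial_const px c pF')
  qed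
  ultimately have "smooth (F 0)" by (rule smooth_alg_closure[rotated 2]) 
  then show ?thesis by (simp add: F_def[abs_def] bump_def)
qed

section \<open>Square integrable functions\<close>

definition sqint :: "'a measure \<Rightarrow> ('a \<Rightarrow> complex) \<Rightarrow> bool" where
  "sqint M f \<longleftrightarrow> f \<in> borel_measurable M \<and> integrable M (\<lambda>x. (norm (f x))\<^sup>2)"

definition sqnorm :: "'a measure \<Rightarrow> ('a \<Rightarrow> complex) \<Rightarrow> real" where
  "sqnorm M f = (LINT x|M. (norm (f x))\<^sup>2)"

definition sqlim :: "'a measure \<Rightarrow> (nat \<Rightarrow> 'a \<Rightarrow> complex) \<Rightarrow> ('a \<Rightarrow> complex) \<Rightarrow> bool" where
  "sqlim M F f \<longleftrightarrow> (\<forall>n. sqint M (F n)) \<and> sqint M f \<and> (\<lambda>n. sqnorm M (\<lambda>x. F n x - f x)) \<longlonglongrightarrow> 0"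

lemma L2_iff: "f \<in> L2 \<Omega> \<longleftrightarrow> sqint (lebesgue_on \<Omega>) f"
  by (simp add: L2_def sqint_def)

lemma sqint_measurable: "sqint M f \<Longrightarrow> f \<in> borel_measurable M"
  by (simp add: sqint_def)

lemma sqnorm_nonneg: "0 \<le> sqnorm M f"
  by (simp add: sqnorm_def)

lemma sqint_bound:
  assumes "f \<in> borel_measurable M" "integrable M g" "AE x in M. (norm (f x))\<^sup>2 \<le> g x"
  shows "sqint M f"
  unfolding sqint_def using assms
  by (auto intro!: Bochner_Integration.integrable_bound[OF assms(2)])

lemma norm_add_sq_le: "(norm (x + y))\<^sup>2 \<le> 2 * (norm x)\<^sup>2 + 2 * (norm y :: real)\<^sup>2"
proof -
  have "(norm (x + y))\<^sup>2 \<le> (norm x + norm y)\<^sup>2"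
    by (intro power_mono norm_triangle_ineq) auto
  also have "\<dots> \<le> 2 * (norm x)\<^sup>2 + 2 * (norm y)\<^sup>2"
    using zero_le_power2[of "norm x - norm y"] by (simp add: power2_eq_square algebra_simps)
  finally show ?thesis .
qed

lemma sqint_add:
  assumes "sqint M f" "sqint M g" shows "sqint M (\<lambda>x. f x + g x)"
  by (rule sqint_bound[where g = "\<lambda>x. 2 * (norm (f x))\<^sup>2 + 2 * (norm (g x))\<^sup>2"])
     (use assms norm_add_sq_le in \<open>auto simp: sqint_def\<close>)

lemma sqint_bmult:
  assumes f: "sqint M f" and g: "g \<in> borel_measurable M" "AE x in M. norm (g x) \<le> B"
  shows "sqint M (\<lambda>x. g x * f x)"
proof (rule sqint_bound[where g = "\<lambda>x. B\<^sup>2 * (norm (f x))\<^sup>2"])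
  show "AE x in M. (norm (g x * f x))\<^sup>2 \<le> B\<^sup>2 * (norm (f x))\<^sup>2"
    using g(2) by eventually_elim (auto simp: norm_mult power_mult_distrib intro!: mult_right_mono power_mono)
qed (use f g in \<open>auto simp: sqint_def\<close>)

lemma sqint_cmult: "sqint M f \<Longrightarrow> sqint M (\<lambda>x. c * f x)"
  by (rule sqint_bmult) auto

lemma sqint_diff:
  assumes "sqint M f" "sqint M g" shows "sqint M (\<lambda>x. f x - g x)"
  using sqint_add[OF assms(1) sqint_cmult[OF assms(2), of "-1"]] by simp

lemma sqint_cnj: "sqint M f \<Longrightarrow> sqint M (\<lambda>x. cnj (f x))"
  by (auto simp: sqint_def intro!: measurable_compose[OF _ borel_measurable_continuous_onI, of _ _ cnj] continuous_intros)

lemma sqint_Re: "sqint M f \<Longrightarrow> sqint M (\<lambda>x. complex_of_real (Re (f x)))"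
  by (rule sqint_bound[where g = "\<lambda>x. (norm (f x))\<^sup>2"])
     (auto simp: sqint_def cmod_power2)

lemma sqint_cong_AE:
  assumes "sqint M f" "AE x in M. f x = g x" "g \<in> borel_measurable M"
  shows "sqint M g"
  by (rule sqint_bound[where g = "\<lambda>x. (norm (f x))\<^sup>2"]) (use assms in \<open>auto simp: sqint_def\<close>)

lemma sqnorm_cong_AE:
  assumes "AE x in M. f x = g x" "f \<in> borel_measurable M" "g \<in> borel_measurable M"
  shows "sqnorm M f = sqnorm M g"
  unfolding sqnorm_def by (rule integral_cong_AE) (use assms in auto)

lemma sqint_mult_integrable:
  assumes "sqint M f" "sqint M g" shows "integrable M (\<lambda>x. f x * g x)"
proof (rule Bochner_Integration.integrable_bound)
  show "integrable M (\<lambda>x. (norm (f x))\<^sup>2 + (norm (g x))\<^sup>2)"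
    using assms by (auto simp: sqint_def)
  show "AE x in M. norm (f x * g x) \<le> norm ((norm (f x))\<^sup>2 + (norm (g x))\<^sup>2)"
  proof (rule AE_I2)
    fix x
    have "2 * (norm (f x) * norm (g x)) \<le> (norm (f x))\<^sup>2 + (norm (g x))\<^sup>2"
      using zero_le_power2[of "norm (f x) - norm (g x)"] by (simp add: power2_eq_square algebra_simps)
    moreover have "0 \<le> norm (f x) * norm (g x)" by simp
    ultimately show "norm (f x * g x) \<le> norm ((norm (f x))\<^sup>2 + (norm (g x))\<^sup>2)"
      unfolding norm_mult real_norm_def by linarith
  qed
qed (use assms in \<open>auto simp: sqint_def\<close>)

lemma sqint_mult_abs_integrable:
  assumes "sqint M f" "sqint M g" shows "integrable M (\<lambda>x. norm (f x) * norm (g x))"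
  using integrable_norm[OF sqint_mult_integrable[OF assms]] by (simp add: norm_mult)

lemma Cauchy_Schwarz_sqnorm:
  assumes "sqint M f" "sqint M g"
  shows "(LINT x|M. norm (f x) * norm (g x))\<^sup>2 \<le> sqnorm M f * sqnorm M g"
proof -
  define A B C where "A = sqnorm M f" and "B = sqnorm M g"
    and "C = (LINT x|M. norm (f x) * norm (g x))"
  note [simp] = sqint_mult_abs_integrable[OF assms]
  have q: "0 \<le> A * t\<^sup>2 + 2 * C * t + B" for t
  proof -
    have "0 \<le> (LINT x|M. (t * norm (f x) + norm (g x))\<^sup>2)" by simp
    also have "(\<lambda>x. (t * norm (f x) + norm (g x))\<^sup>2) =
        (\<lambda>x. t\<^sup>2 * (norm (f x))\<^sup>2 + (2 * t) * (norm (f x) * norm (g x)) + (norm (g x))\<^sup>2)"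
      by (auto simp: power2_eq_square algebra_simps)
    also have "(LINT x|M. \<dots> x) = A * t\<^sup>2 + 2 * C * t + B"
      using assms by (simp add: A_def B_def C_def sqnorm_def sqint_def)
    finally show ?thesis .
  qed
  have "C\<^sup>2 \<le> A * B"
  proof (cases "A = 0")
    case True
    have "C = 0"
    proof (rule ccontr)
      assume "C \<noteq> 0"
      with q[of "- (B + 1) / (2 * C)"] True show False by (simp add: field_simps)
    qed
    with True show ?thesis by simp
  next
    case False
    then have "A > 0" using sqnorm_nonneg[of M f] by (simp add: A_def)
    with q[of "- C / A"] show ?thesis by (simp add: field_simps power2_eq_square)
  qed
  then show ?thesis by (simp add: A_def B_def C_def)
qed

lemma norm_integral_mult_le:
  assumes "sqint M f" "sqint M g"
  shows "norm (LINT x|M. f x * g x) \<le> sqrt (sqnorm M f) * sqrt (sqnorm M g)"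
proof -
  have "norm (LINT x|M. f x * g x) \<le> (LINT x|M. norm (f x) * norm (g x))"
    using integral_norm_bound[of M "\<lambda>x. f x * g x"] by (simp add: norm_mult)
  also have "\<dots> \<le> sqrt (sqnorm M f * sqnorm M g)"
    by (rule real_le_rsqrt[OF Cauchy_Schwarz_sqnorm[OF assms]])
  finally show ?thesis by (simp add: real_sqrt_mult)
qed

lemma sqnorm_add_le:
  assumes "sqint M f" "sqint M g"
  shows "sqnorm M (\<lambda>x. f x + g x) \<le> 2 * sqnorm M f + 2 * sqnorm M g"
proof -
  have "sqnorm M (\<lambda>x. f x + g x) \<le> (LINT x|M. 2 * (norm (f x))\<^sup>2 + 2 * (norm (g x))\<^sup>2)"
    unfolding sqnorm_def
    by (rule integral_mono) (use assms sqint_add[OF assms] norm_add_sq_le in \<open>auto simp: sqint_def\<close>)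
  then show ?thesis using assms by (simp add: sqnorm_def sqint_def)
qed

lemma sqnorm_bmult_le:
  assumes f: "sqint M f" and g: "g \<in> borel_measurable M" "AE x in M. norm (g x) \<le> B"
  shows "sqnorm M (\<lambda>x. g x * f x) \<le> B\<^sup>2 * sqnorm M f"
proof -
  have "sqnorm M (\<lambda>x. g x * f x) \<le> (LINT x|M. B\<^sup>2 * (norm (f x))\<^sup>2)"
    unfolding sqnorm_def
  proof (rule integral_mono_AE)
    show "AE x in M. (norm (g x * f x))\<^sup>2 \<le> B\<^sup>2 * (norm (f x))\<^sup>2"
      using g(2) by eventually_elim (auto simp: norm_mult power_mult_distrib intro!: mult_right_mono power_mono)
  qed (use f sqint_bmult[OF f g] in \<open>auto simp: sqint_def\<close>)
  then show ?thesis by (simp add: sqnorm_def)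
qed

lemma sqnorm_diff_commute: "sqnorm M (\<lambda>x. f x - g x) = sqnorm M (\<lambda>x. g x - f x)"
  by (simp add: sqnorm_def norm_minus_commute)

lemma sqlim_const: "sqint M f \<Longrightarrow> sqlim M (\<lambda>_. f) f"
  by (simp add: sqlim_def sqnorm_def)

lemma sqlim_add:
  assumes "sqlim M F f" "sqlim M G g"
  shows "sqlim M (\<lambda>n x. F n x + G n x) (\<lambda>x. f x + g x)"
  unfolding sqlim_def
proof (intro conjI allI)
  show "(\<lambda>n. sqnorm M (\<lambda>x. (F n x + G n x) - (f x + g x))) \<longlonglongrightarrow> 0"
  proof (rule Lim_null_comparison)
    show "\<forall>\<^sub>F n in sequentially. norm (sqnorm M (\<lambda>x. (F n x + G n x) - (f x + g x)))
      \<le> 2 * sqnorm M (\<lambda>x. F n x - f x) + 2 * sqnorm M (\<lambda>x. G n x - g x)"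
    proof (rule always_eventually, rule allI)
      fix n
      have eq: "(\<lambda>x. (F n x + G n x) - (f x + g x)) = (\<lambda>x. (F n x - f x) + (G n x - g x))" by auto
      show "norm (sqnorm M (\<lambda>x. (F n x + G n x) - (f x + g x)))
      \<le> 2 * sqnorm M (\<lambda>x. F n x - f x) + 2 * sqnorm M (\<lambda>x. G n x - g x)"
        unfolding eq using assms
        by (simp add: sqnorm_nonneg) (intro sqnorm_add_le sqint_diff, auto simp: sqlim_def)
    qed
    show "(\<lambda>n. 2 * sqnorm M (\<lambda>x. F n x - f x) + 2 * sqnorm M (\<lambda>x. G n x - g x)) \<longlonglongrightarrow> 0"
      using assms by (auto simp: sqlim_def intro!: tendsto_eq_intros)
  qed
qed (use assms in \<open>auto simp: sqlim_def intro!: sqint_add\<close>)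

lemma sqlim_bmult:
  assumes "sqlim M F f" and g: "g \<in> borel_measurable M" "AE x in M. norm (g x) \<le> B"
  shows "sqlim M (\<lambda>n x. g x * F n x) (\<lambda>x. g x * f x)"
  unfolding sqlim_def
proof (intro conjI allI)
  show "(\<lambda>n. sqnorm M (\<lambda>x. g x * F n x - g x * f x)) \<longlonglongrightarrow> 0"
  proof (rule Lim_null_comparison)
    show "\<forall>\<^sub>F n in sequentially. norm (sqnorm M (\<lambda>x. g x * F n x - g x * f x))
      \<le> B\<^sup>2 * sqnorm M (\<lambda>x. F n x - f x)"
      unfolding right_diff_distrib[symmetric] using assms
      by (intro always_eventually allI)
         (simp add: sqnorm_nonneg, intro sqnorm_bmult_le sqint_diff, auto simp: sqlim_def)
    show "(\<lambda>n. B\<^sup>2 * sqnorm M (\<lambda>x. F n x - f x)) \<longlonglongrightarrow> 0"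
      using assms by (auto simp: sqlim_def intro!: tendsto_eq_intros)
  qed
qed (use assms in \<open>auto simp: sqlim_def intro!: sqint_bmult\<close>)

lemma sqlim_cnj: "sqlim M F f \<Longrightarrow> sqlim M (\<lambda>n x. cnj (F n x)) (\<lambda>x. cnj (f x))"
  by (simp add: sqlim_def sqint_cnj sqnorm_def flip: complex_cnj_diff)

lemma sqlim_Re:
  assumes "sqlim M F f"
  shows "sqlim M (\<lambda>n x. complex_of_real (Re (F n x))) (\<lambda>x. complex_of_real (Re (f x)))"
  unfolding sqlim_def
proof (intro conjI allI)
  show "(\<lambda>n. sqnorm M (\<lambda>x. complex_of_real (Re (F n x)) - complex_of_real (Re (f x)))) \<longlonglongrightarrow> 0"
  proof (rule Lim_null_comparison)
    show "\<forall>\<^sub>F n in sequentially. norm (sqnorm M (\<lambda>x. complex_of_real (Re (F n x)) - complex_of_real (Re (f x))))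
      \<le> sqnorm M (\<lambda>x. F n x - f x)"
    proof (rule always_eventually, rule allI)
      fix n
      have "sqint M (\<lambda>x. F n x - f x)" using assms by (auto simp: sqlim_def sqint_diff)
      then show "norm (sqnorm M (\<lambda>x. complex_of_real (Re (F n x)) - complex_of_real (Re (f x))))
      \<le> sqnorm M (\<lambda>x. F n x - f x)"
        using sqint_Re[of M "\<lambda>x. F n x - f x"]
        unfolding sqnorm_def sqint_def
        by (simp flip: of_real_diff) (rule integral_mono, auto simp: cmod_power2)
    qed
  qed (use assms in \<open>auto simp: sqlim_def\<close>)
qed (use assms in \<open>auto simp: sqlim_def intro!: sqint_Re\<close>)

lemma tendsto_integral_mult:
  assumes F: "sqlim M F f" and G: "sqlim M G g"
  shows "(\<lambda>n. LINT x|M. F n x * G n x) \<longlonglongrightarrow> (LINT x|M. f x * g x)"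
proof (rule LIM_zero_cancel, rule Lim_null_comparison)
  let ?a = "\<lambda>n. sqrt (sqnorm M (\<lambda>x. F n x - f x))" and ?b = "\<lambda>n. sqrt (sqnorm M (\<lambda>x. G n x - g x))"
  have i: "sqint M (F n)" "sqint M f" "sqint M (G n)" "sqint M g" for n
    using assms by (auto simp: sqlim_def)
  show "(\<lambda>n. ?a n * ?b n + ?a n * sqrt (sqnorm M g) + sqrt (sqnorm M f) * ?b n) \<longlonglongrightarrow> 0"
    using assms by (auto simp: sqlim_def intro!: tendsto_eq_intros)
  show "\<forall>\<^sub>F n in sequentially. norm ((LINT x|M. F n x * G n x) - (LINT x|M. f x * g x))
    \<le> ?a n * ?b n + ?a n * sqrt (sqnorm M g) + sqrt (sqnorm M f) * ?b n"
  proof (rule always_eventually, rule allI)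
    fix n
    note j = sqint_diff[OF i(1) i(2), of n] sqint_diff[OF i(3) i(4), of n]
    have "(LINT x|M. F n x * G n x) - (LINT x|M. f x * g x) = (LINT x|M. F n x * G n x - f x * g x)"
      by (rule Bochner_Integration.integral_diff[symmetric]) (intro sqint_mult_integrable i)+
    also have "(\<lambda>x. F n x * G n x - f x * g x) =
       (\<lambda>x. (F n x - f x) * (G n x - g x) + (F n x - f x) * g x + f x * (G n x - g x))"
      by (auto simp: algebra_simps)
    also have "(LINT x|M. \<dots> x) = (LINT x|M. (F n x - f x) * (G n x - g x)) +
       (LINT x|M. (F n x - f x) * g x) + (LINT x|M. f x * (G n x - g x))"
      by (simp add: sqint_mult_integrable i j)
    finally show "norm ((LINT x|M. F n x * G n x) - (LINT x|M. f x * g x))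
    \<le> ?a n * ?b n + ?a n * sqrt (sqnorm M g) + sqrt (sqnorm M f) * ?b n"
      using norm_integral_mult_le[OF j] norm_integral_mult_le[OF j(1) i(4)]
        norm_integral_mult_le[OF i(2) j(2)]
      by (smt (verit) norm_triangle_ineq)
  qed
qed

lemma sqlim_sqnorm:
  assumes "sqlim M F f" shows "(\<lambda>n. sqnorm M (F n)) \<longlonglongrightarrow> sqnorm M f"
proof -
  have eq: "complex_of_real (sqnorm M f) = (LINT x|M. f x * cnj (f x))" for f
    unfolding sqnorm_def complex_norm_square[symmetric] by (rule integral_complex_of_real[symmetric])
  have "(\<lambda>n. complex_of_real (sqnorm M (F n))) \<longlonglongrightarrow> complex_of_real (sqnorm M f)"
    unfolding eq by (rule tendsto_integral_mult[OF assms sqlim_cnj[OF assms]])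
  then show ?thesis by (simp add: tendsto_of_real_iff)
qed

lemma sqlim_AE_subseq:
  assumes "sqlim M F f"
  obtains r :: "nat \<Rightarrow> nat" where "strict_mono r" "AE x in M. (\<lambda>n. F (r n) x) \<longlonglongrightarrow> f x"
proof -
  have "integrable M (\<lambda>x. (norm (F n x - f x))\<^sup>2)" for n
    using assms sqint_diff by (auto simp: sqlim_def sqint_def)
  moreover have "(\<lambda>n. (LINT x|M. norm ((norm (F n x - f x))\<^sup>2))) \<longlonglongrightarrow> 0"
    using assms by (simp add: sqlim_def sqnorm_def)
  ultimately obtain r :: "nat \<Rightarrow> nat"
    where r: "strict_mono r" "AE x in M. (\<lambda>n. (norm (F (r n) x - f x))\<^sup>2) \<longlonglongrightarrow> 0"
    using tendsto_L1_AE_subseq[of M "\<lambda>n x. (norm (F n x - f x))\<^sup>2"] by blast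
  have "AE x in M. (\<lambda>n. F (r n) x) \<longlonglongrightarrow> f x"
    using r(2)
  proof eventually_elim
    case (elim x)
    from tendsto_real_sqrt[OF this] show ?case
      by (simp add: tendsto_norm_zero_iff LIM_zero_iff)
  qed
  with r(1) that show ?thesis by blast
qed

lemma sqlim_subseq: "sqlim M F f \<Longrightarrow> strict_mono r \<Longrightarrow> sqlim M (\<lambda>n. F (r n)) f"
  using LIMSEQ_subseq_LIMSEQ[of "\<lambda>n. sqnorm M (\<lambda>x. F n x - f x)"]
  by (auto simp: sqlim_def o_def)

lemma sqlim_dominated:
  assumes F: "\<And>n. F n \<in> borel_measurable M" and f: "f \<in> borel_measurable M"
    and g: "integrable M g" and b: "\<And>n. AE x in M. (norm (F n x))\<^sup>2 \<le> g x"
    and l: "AE x in M. (\<lambda>n. F n x) \<longlonglongrightarrow> f x"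
  shows "sqlim M F f"
proof -
  have Fi: "sqint M (F n)" for n using sqint_bound[OF F g b] .
  have bf: "AE x in M. (norm (f x))\<^sup>2 \<le> g x"
  proof -
    have "AE x in M. \<forall>n. (norm (F n x))\<^sup>2 \<le> g x" using b by (simp add: AE_all_countable)
    with l show ?thesis
    proof eventually_elim
      case (elim x)
      then have "(\<lambda>n. (norm (F n x))\<^sup>2) \<longlonglongrightarrow> (norm (f x))\<^sup>2" by (intro tendsto_intros)
      then show ?case by (rule LIMSEQ_le_const2) (use elim in auto)
    qed
  qed
  have fi: "sqint M f" using sqint_bound[OF f g bf] .
  have "(\<lambda>n. LINT x|M. (norm (F n x - f x))\<^sup>2) \<longlonglongrightarrow> (LINT x|M. 0)"
  proof (rule integral_dominated_convergence[where w = "\<lambda>x. 4 * g x"])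
    show "AE x in M. (\<lambda>n. (norm (F n x - f x))\<^sup>2) \<longlonglongrightarrow> 0"
      using l by eventually_elim (auto intro!: tendsto_eq_intros simp: LIM_zero)
    show "AE x in M. norm ((norm (F n x - f x))\<^sup>2) \<le> 4 * g x" for n
      using b[of n] bf
    proof eventually_elim
      case (elim x)
      then show ?case using norm_add_sq_le[of "F n x" "- f x"] by simp
    qed
  qed (use F f g in auto)
  with Fi fi show ?thesis by (simp add: sqlim_def sqnorm_def)
qed

section \<open>Test functions and convolution\<close>

lemma zero_off_supp: "x \<notin> supp f \<Longrightarrow> f x = 0"
  unfolding supp_def by (metis (mono_tags, lifting) closure_subset mem_Collect_eq subsetD)

lemma supp_subset: "closed K \<Longrightarrow> (\<And>x. x \<notin> K \<Longrightarrow> f x = 0) \<Longrightarrow> supp f \<subseteq> K"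
  unfolding supp_def by (rule closure_minimal) auto

lemma closed_supp: "closed (supp f)"
  by (simp add: supp_def)

lemma compact_supp:
  assumes "compact K" "\<And>x. x \<notin> K \<Longrightarrow> f x = 0"
  shows "compact (supp f)"
proof -
  have "supp f \<subseteq> K" using compact_imp_closed[OF assms(1)] assms(2) by (rule supp_subset)
  then have "K \<inter> supp f = supp f" by (rule Int_absorb1)
  with compact_Int_closed[OF assms(1) closed_supp[of f]] show ?thesis by simp
qed

lemma partial_zero_off_supp:
  assumes "x \<notin> supp f" shows "partial k f x = 0"
proof -
  have "((\<lambda>x. 0) has_derivative (\<lambda>h. 0)) (at x)" by simp
  then have "(f has_derivative (\<lambda>h. 0)) (at x)"
  proof (rule has_derivative_transform_within_open[of _ _ _ _ "- supp f"])
    show "open (- supp f)" by (rule open_Compl[OF closed_supp])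
    show "0 = f y" if "y \<in> - supp f" for y using that zero_off_supp[of y f] by simp
  qed (use assms in simp)
  then show ?thesis by (simp add: partial_eqI)
qed

lemma supp_partial: "supp (partial k f) \<subseteq> supp f"
  using closed_supp partial_zero_off_supp by (rule supp_subset)

lemma test_functions_smooth: "\<phi> \<in> test_functions \<Omega> \<Longrightarrow> smooth \<phi>"
  by (simp add: test_functions_iff)

lemma test_functions_partial:
  assumes "\<phi> \<in> test_functions \<Omega>" shows "partial k \<phi> \<in> test_functions \<Omega>"
  unfolding test_functions_iff
proof (intro conjI)
  show "compact (supp (partial k \<phi>))"
    by (rule compact_supp[of "supp \<phi>"]) (use assms in \<open>simp_all add: test_functions_iff partial_zero_off_supp\<close>)
  show "smooth (partial k \<phi>)" using assms by (simp add: test_functions_iff smooth_partial)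
  show "supp (partial k \<phi>) \<subseteq> \<Omega>"
    by (rule order_trans[OF supp_partial]) (use assms in \<open>simp add: test_functions_iff\<close>)
qed

lemma test_functions_mono: "\<Omega> \<subseteq> \<Omega>' \<Longrightarrow> \<phi> \<in> test_functions \<Omega> \<Longrightarrow> \<phi> \<in> test_functions \<Omega>'"
  by (auto simp: test_functions_iff)

lemma smooth_continuous: "smooth f \<Longrightarrow> continuous_on S f"
  by (intro continuous_at_imp_continuous_on ballI differentiable_imp_continuous_within smooth_differentiable)

lemma bounded_of_compact_supp:
  assumes "continuous_on UNIV f" "compact (supp f)"
  obtains B where "0 < B" "\<And>x. norm (f x) \<le> B"
proof -
  have "compact (f ` supp f)"
    by (rule compact_continuous_image[OF continuous_on_subset[OF assms(1)] assms(2)]) simp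
  then obtain B where B: "0 < B" "\<forall>y \<in> f ` supp f. norm y \<le> B"
    using bounded_pos compact_imp_bounded by blast
  have "norm (f x) \<le> B" for x
  proof (cases "x \<in> supp f")
    case True with B(2) show ?thesis by simp
  next
    case False with B(1) zero_off_supp[OF False] show ?thesis by simp
  qed
  with B(1) show ?thesis by (rule that)
qed

lemma test_functions_bounded:
  assumes "\<phi> \<in> test_functions \<Omega>"
  obtains B where "0 < B" "\<And>x. norm (\<phi> x) \<le> B"
  by (rule bounded_of_compact_supp[of \<phi>])
     (use assms in \<open>simp_all add: test_functions_iff smooth_continuous that\<close>)

lemma norm_sum_partials_le:
  fixes h :: "real ^ 'n"
  shows "norm (\<Sum>k\<in>UNIV. (h $ k) *\<^sub>R z k) \<le> (\<Sum>k\<in>UNIV. norm (z k)) * norm h"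
proof -
  have "norm (\<Sum>k\<in>UNIV. (h $ k) *\<^sub>R z k) \<le> (\<Sum>k\<in>UNIV. norm (z k) * norm h)"
    by (rule order_trans[OF norm_sum], rule sum_mono)
       (metis component_le_norm_cart mult.commute mult_right_mono norm_ge_zero norm_scaleR)
  then show ?thesis by (simp add: sum_distrib_right)
qed

lemma test_functions_Lipschitz:
  assumes "\<phi> \<in> test_functions \<Omega>"
  obtains C where "0 \<le> C" "\<And>x y. norm (\<phi> x - \<phi> y) \<le> C * norm (x - y)"
proof -
  have "\<exists>B. \<forall>x. norm (partial k \<phi> x) \<le> B" for k
    using test_functions_bounded[OF test_functions_partial[OF assms]] by metis
  then obtain B where B: "norm (partial k \<phi> x) \<le> B k" for k x by metis
  have "norm (\<phi> x - \<phi> y) \<le> (\<Sum>k\<in>UNIV. B k) * norm (x - y)" for x y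
  proof (rule differentiable_bound[OF convex_UNIV])
    fix x
    show "(\<phi> has_derivative (\<lambda>h. \<Sum>k\<in>UNIV. (h $ k) *\<^sub>R partial k \<phi> x)) (at x)"
      using assms by (auto intro!: has_derivative_partial smooth_differentiable simp: test_functions_iff)
    show "onorm (\<lambda>h. \<Sum>k\<in>UNIV. (h $ k) *\<^sub>R partial k \<phi> x) \<le> sum B UNIV"
    proof (rule onorm_bound)
      show "0 \<le> sum B UNIV" by (meson B norm_ge_zero order_trans sum_nonneg)
      show "norm (\<Sum>k\<in>UNIV. (h $ k) *\<^sub>R partial k \<phi> x) \<le> sum B UNIV * norm h" for h
        by (rule order_trans[OF norm_sum_partials_le]) (intro mult_right_mono sum_mono B norm_ge_zero)
    qed
  qed auto
  moreover have "0 \<le> sum B UNIV" by (meson B norm_ge_zero order_trans sum_nonneg)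
  ultimately show ?thesis using that by blast
qed

lemma test_functions_Taylor:
  assumes "\<phi> \<in> test_functions \<Omega>"
  obtains C where "0 \<le> C"
    "\<And>x h. norm (\<phi> (x + h) - \<phi> x - (\<Sum>k\<in>UNIV. (h $ k) *\<^sub>R partial k \<phi> x)) \<le> C * (norm h)\<^sup>2"
proof -
  have "\<exists>C\<ge>0. \<forall>x y. norm (partial k \<phi> x - partial k \<phi> y) \<le> C * norm (x - y)" for k
    using test_functions_Lipschitz[OF test_functions_partial[OF assms]] by metis
  then obtain C where C: "C k \<ge> 0" "norm (partial k \<phi> x - partial k \<phi> y) \<le> C k * norm (x - y)" for k x y by metis
  have "norm (\<phi> (x + h) - \<phi> x - (\<Sum>k\<in>UNIV. (h $ k) *\<^sub>R partial k \<phi> x)) \<le> sum C UNIV * (norm h)\<^sup>2" for x h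
  proof -
    let ?g = "\<lambda>z. \<phi> z - (\<Sum>k\<in>UNIV. (z $ k) *\<^sub>R partial k \<phi> x)"
    have "norm (?g (x + h) - ?g x) \<le> (sum C UNIV * norm h) * norm ((x + h) - x)"
    proof (rule differentiable_bound[OF convex_cball[of x "norm h"]])
      fix z assume z: "z \<in> cball x (norm h)"
      have "(\<phi> has_derivative (\<lambda>h. \<Sum>k\<in>UNIV. (h $ k) *\<^sub>R partial k \<phi> z)) (at z)"
        using assms by (auto intro!: has_derivative_partial smooth_differentiable simp: test_functions_iff)
      moreover have "((\<lambda>z. \<Sum>k\<in>UNIV. (z $ k) *\<^sub>R partial k \<phi> x) has_derivative
           (\<lambda>h. \<Sum>k\<in>UNIV. (h $ k) *\<^sub>R partial k \<phi> x)) (at z)"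
        by (intro has_derivative_sum has_derivative_scaleR_left bounded_linear_imp_has_derivative bounded_linear_vec_nth)
      ultimately have "(?g has_derivative (\<lambda>h. (\<Sum>k\<in>UNIV. (h $ k) *\<^sub>R partial k \<phi> z) - (\<Sum>k\<in>UNIV. (h $ k) *\<^sub>R partial k \<phi> x))) (at z)"
        by (rule has_derivative_diff)
      also have "(\<lambda>h. (\<Sum>k\<in>UNIV. (h $ k) *\<^sub>R partial k \<phi> z) - (\<Sum>k\<in>UNIV. (h $ k) *\<^sub>R partial k \<phi> x))
         = (\<lambda>h. \<Sum>k\<in>UNIV. (h $ k) *\<^sub>R (partial k \<phi> z - partial k \<phi> x))"
        by (simp add: sum_subtractf scaleR_diff_right)
      finally show "(?g has_derivative (\<lambda>h. \<Sum>k\<in>UNIV. (h $ k) *\<^sub>R (partial k \<phi> z - partial k \<phi> x)))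
         (at z within cball x (norm h))" by (rule has_derivative_at_withinI)
      show "onorm (\<lambda>h. \<Sum>k\<in>UNIV. (h $ k) *\<^sub>R (partial k \<phi> z - partial k \<phi> x)) \<le> sum C UNIV * norm h"
      proof (rule onorm_bound)
        show "0 \<le> sum C UNIV * norm h" by (simp add: C sum_nonneg)
        have "(\<Sum>k\<in>UNIV. norm (partial k \<phi> z - partial k \<phi> x)) \<le> sum C UNIV * norm h"
          unfolding sum_distrib_right
        proof (rule sum_mono)
          fix k
          have "norm (partial k \<phi> z - partial k \<phi> x) \<le> C k * norm (z - x)" by (rule C)
          also have "\<dots> \<le> C k * norm h"
            using z by (intro mult_left_mono C) (simp add: dist_norm norm_minus_commute)
          finally show "norm (partial k \<phi> z - partial k \<phi> x) \<le> C k * norm h" .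
        qed
        then show "norm (\<Sum>k\<in>UNIV. (v $ k) *\<^sub>R (partial k \<phi> z - partial k \<phi> x)) \<le> sum C UNIV * norm h * norm v" for v
          by (rule order_trans[OF norm_sum_partials_le mult_right_mono[OF _ norm_ge_zero]])
      qed
    qed (auto simp: dist_norm)
    also have "?g (x + h) - ?g x = \<phi> (x + h) - \<phi> x - (\<Sum>k\<in>UNIV. (h $ k) *\<^sub>R partial k \<phi> x)"
      by (simp add: scaleR_add_left sum.distrib)
    finally show ?thesis by (simp add: power2_eq_square mult.assoc)
  qed
  moreover have "0 \<le> sum C UNIV" by (simp add: C sum_nonneg)
  ultimately show ?thesis using that by blast
qed

lemma borel_measurable_lebesgue_continuous: "continuous_on UNIV f \<Longrightarrow> f \<in> borel_measurable lebesgue"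
  by (simp add: borel_measurable_continuous_onI measurable_completion)

lemma integrable_continuous_compact_supp:
  fixes f :: "real ^ 'n \<Rightarrow> complex"
  assumes "continuous_on UNIV f" "compact (supp f)"
  shows "integrable lborel f"
proof -
  have "integrable lborel (\<lambda>x. indicator (supp f) x *\<^sub>R f x)"
    by (rule borel_integrable_compact) (use assms continuous_on_subset in auto)
  also have "(\<lambda>x. indicator (supp f) x *\<^sub>R f x) = f"
    by (auto simp: indicator_def zero_off_supp)
  finally show ?thesis .
qed

lemma integrable_cball: "integrable lborel (\<lambda>x :: real ^ 'n. c * indicat_real (cball a r) x)"
proof -
  have "emeasure lborel (cball a r) < \<infinity>" by (rule emeasure_lborel_cball_finite)
  then show ?thesis by (intro integrable_mult_right integrable_real_indicator) auto
qed

lemma lborel_distr_reflect: "distr lborel borel (\<lambda>y :: real ^ 'n. x - y) = lborel"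
  using lborel_affine[of "-1" x] by (simp add: density_1)

lemma lborel_distr_diff: "distr lborel borel (\<lambda>x :: real ^ 'n. x - y) = lborel"
proof -
  have "(\<lambda>x. x - y) = (+) (- y)" by auto
  then show ?thesis by (simp only: lborel_distr_plus)
qed

lemma integral_partial_eq_0:
  fixes f :: "real ^ 'n \<Rightarrow> complex"
  assumes d: "\<And>x. f differentiable (at x)" and c: "continuous_on UNIV (partial k f)"
    and K: "compact (supp f)"
  shows "(LINT x|lebesgue. partial k f x) = 0"
proof -
  let ?e = "axis k 1 :: real ^ 'n"
  have cf: "continuous_on UNIV f"
    using d by (meson continuous_at_imp_continuous_on differentiable_imp_continuous_within)
  have fi: "integrable lborel f" by (rule integrable_continuous_compact_supp[OF cf K])
  have Kp: "compact (supp (partial k f))"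
    by (rule compact_supp[OF K]) (rule partial_zero_off_supp)
  obtain B where B: "0 < B" "\<And>x. norm (partial k f x) \<le> B"
    using bounded_of_compact_supp[OF c Kp] by metis
  obtain R where R: "supp f \<subseteq> cball 0 R"
    using compact_imp_bounded[OF K] unfolding bounded_iff by (auto simp: subset_iff)
  have line: "((\<lambda>t. f (x + t *\<^sub>R ?e)) has_vector_derivative partial k f (x + t *\<^sub>R ?e)) (at t)" for x t
  proof -
    have "((\<lambda>t. x + t *\<^sub>R ?e) has_derivative (\<lambda>h. h *\<^sub>R ?e)) (at t)"
      by (auto intro!: derivative_eq_intros)
    from diff_chain_at[OF this has_frechet_derivative[OF d]]
    have "((\<lambda>t. f (x + t *\<^sub>R ?e)) has_derivative (\<lambda>h. frechet_derivative f (at (x + t *\<^sub>R ?e)) (h *\<^sub>R ?e))) (at t)"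
      by (simp add: o_def)
    then show ?thesis
      unfolding has_vector_derivative_def partial_def
      by (simp add: linear_scale[OF linear_frechet_derivative[OF d]])
  qed
  define t where "t n = inverse (real (Suc n))" for n
  have t: "0 < t n" "t n \<le> 1" for n by (auto simp: t_def field_simps)
  have t0: "t \<longlonglongrightarrow> 0" unfolding t_def by (rule LIMSEQ_inverse_real_of_nat)
  define q where "q n x = (f (x + t n *\<^sub>R ?e) - f x) /\<^sub>R t n" for n x
  have q0: "(LINT x|lborel. q n x) = 0" for n
  proof -
    have eq: "(\<lambda>x. f (x + t n *\<^sub>R ?e)) = (\<lambda>x. f (((+) (t n *\<^sub>R ?e)) x))" by (simp add: add.commute)
    have m: "f \<in> borel_measurable borel" using cf by (rule borel_measurable_continuous_onI)
    have "integrable (distr lborel borel ((+) (t n *\<^sub>R ?e))) f" using fi by (simp add: lborel_distr_plus)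
    then have i: "integrable lborel (\<lambda>x. f (x + t n *\<^sub>R ?e))"
      unfolding eq using m by (subst (asm) integrable_distr_eq) auto
    have "(LINT x|lborel. f (x + t n *\<^sub>R ?e)) = (LINT x|distr lborel borel ((+) (t n *\<^sub>R ?e)). f x)"
      unfolding eq using m by (subst integral_distr) auto
    then show ?thesis using i fi by (simp add: q_def lborel_distr_plus)
  qed
  have "(\<lambda>n. LINT x|lborel. q n x) \<longlonglongrightarrow> (LINT x|lborel. partial k f x)"
  proof (rule integral_dominated_convergence[where w = "\<lambda>x. B * indicator (cball 0 (R + 1)) x"])
    show "partial k f \<in> borel_measurable lborel" using c by (simp add: borel_measurable_continuous_onI)
    show "q n \<in> borel_measurable lborel" for n
      unfolding q_def using cf
      by (auto intro!: borel_measurable_continuous_onI continuous_intros continuous_on_compose2[OF cf])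
    show "integrable lborel (\<lambda>x. B * indicat_real (cball (0 :: real ^ 'n) (R + 1)) x)"
      by (rule integrable_cball)
    show "AE x in lborel. (\<lambda>n. q n x) \<longlonglongrightarrow> partial k f x"
    proof (rule AE_I2)
      fix x
      have "((\<lambda>s. f (x + s *\<^sub>R ?e)) has_vector_derivative partial k f x) (at 0)" using line[of x 0] by simp
      then have lim: "((\<lambda>h. norm (f (x + (0 + h) *\<^sub>R ?e) - f (x + 0 *\<^sub>R ?e) - h *\<^sub>R partial k f x) / norm h) \<longlongrightarrow> 0) (at 0)"
        unfolding has_vector_derivative_def has_derivative_at by blast
      have "((\<lambda>s. norm ((f (x + s *\<^sub>R ?e) - f x) /\<^sub>R s - partial k f x)) \<longlongrightarrow> 0) (at 0)"
      proof (rule Lim_transform_eventually[OF lim], unfold eventually_at_filter, intro always_eventually allI impI)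
        fix h :: real assume "h \<noteq> 0"
        then have "(f (x + h *\<^sub>R ?e) - f x) /\<^sub>R h - partial k f x = (f (x + h *\<^sub>R ?e) - f x - h *\<^sub>R partial k f x) /\<^sub>R h"
          by (simp add: scaleR_diff_right)
        then show "norm (f (x + (0 + h) *\<^sub>R ?e) - f (x + 0 *\<^sub>R ?e) - h *\<^sub>R partial k f x) / norm h
            = norm ((f (x + h *\<^sub>R ?e) - f x) /\<^sub>R h - partial k f x)"
          by (simp add: divide_inverse_commute)
      qed
      then have "((\<lambda>s. (f (x + s *\<^sub>R ?e) - f x) /\<^sub>R s) \<longlongrightarrow> partial k f x) (at 0)"
        by (simp add: tendsto_norm_zero_iff LIM_zero_iff)
      moreover have "filterlim t (at 0) sequentially"
        using t0 t by (auto simp: filterlim_at intro!: always_eventually) (metis less_irrefl)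
      ultimately show "(\<lambda>n. q n x) \<longlonglongrightarrow> partial k f x"
        unfolding q_def by (rule filterlim_compose)
    qed
    show "AE x in lborel. norm (q n x) \<le> B * indicator (cball 0 (R + 1)) x" for n
    proof (rule AE_I2)
      fix x
      have "norm (f (x + t n *\<^sub>R ?e) - f (x + 0 *\<^sub>R ?e)) \<le> B * norm (t n - 0)"
      proof (rule differentiable_bound[OF convex_UNIV])
        fix s
        show "((\<lambda>s. f (x + s *\<^sub>R ?e)) has_derivative (\<lambda>h. h *\<^sub>R partial k f (x + s *\<^sub>R ?e))) (at s)"
          using line by (simp add: has_vector_derivative_def)
        show "onorm (\<lambda>h. h *\<^sub>R partial k f (x + s *\<^sub>R ?e)) \<le> B"
          by (rule onorm_bound) (use B in \<open>auto simp: mult.commute[of B] intro!: mult_left_mono\<close>)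
      qed auto
      moreover have "norm (q n x) = norm (f (x + t n *\<^sub>R ?e) - f x) / t n"
        unfolding q_def norm_scaleR using t[of n] by (simp add: divide_inverse_commute)
      ultimately have "norm (q n x) \<le> B" using t[of n] by (simp add: divide_le_eq)
      moreover have "q n x = 0" if "x \<notin> cball 0 (R + 1)"
      proof -
        have "norm x - norm (t n *\<^sub>R ?e) \<le> norm (x + t n *\<^sub>R ?e)" by (metis norm_diff_ineq)
        then have "x + t n *\<^sub>R ?e \<notin> cball 0 R" using t[of n] that by (auto simp: norm_axis_1)
        then have "f (x + t n *\<^sub>R ?e) = 0" "f x = 0" using R that by (auto intro!: zero_off_supp)
        then show ?thesis by (simp add: q_def)
      qed
      ultimately show "norm (q n x) \<le> B * indicator (cball 0 (R + 1)) x"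
        by (cases "x \<in> cball 0 (R + 1)") auto
    qed
  qed
  then have "(LINT x|lborel. partial k f x) = 0" by (simp add: q0 LIMSEQ_const_iff)
  then show ?thesis using c by (simp add: integral_completion borel_measurable_continuous_onI)
qed

definition conv :: "(real ^ 'n \<Rightarrow> complex) \<Rightarrow> (real ^ 'n \<Rightarrow> complex) \<Rightarrow> real ^ 'n \<Rightarrow> complex" where
  "conv v \<phi> x = (LINT y|lebesgue. v y * \<phi> (x - y))"

lemma conv_integrable:
  assumes v: "integrable lebesgue v" and p: "\<phi> \<in> test_functions \<Omega>"
  shows "integrable lebesgue (\<lambda>y. v y * \<phi> (x - y))"
proof -
  obtain B where B: "0 < B" "\<And>x. norm (\<phi> x) \<le> B" using test_functions_bounded[OF p] by metis
  have "(\<lambda>y. \<phi> (x - y)) \<in> borel_measurable lebesgue"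
    by (rule borel_measurable_lebesgue_continuous)
       (use p smooth_continuous smooth_reflect in \<open>auto simp: test_functions_iff\<close>)
  then have m: "(\<lambda>y. v y * \<phi> (x - y)) \<in> borel_measurable lebesgue"
    using v by simp
  show ?thesis
  proof (rule Bochner_Integration.integrable_bound[OF _ m])
    show "integrable lebesgue (\<lambda>y. B * norm (v y))" using v by simp
    show "AE y in lebesgue. norm (v y * \<phi> (x - y)) \<le> norm (B * norm (v y))"
    proof (rule AE_I2)
      fix y
      have "norm (v y) * norm (\<phi> (x - y)) \<le> norm (v y) * B" by (intro mult_left_mono B) simp
      with B show "norm (v y * \<phi> (x - y)) \<le> norm (B * norm (v y))"
        by (simp add: norm_mult abs_mult mult.commute)
    qed
  qed
qed

lemma conv_has_derivative:
  assumes v: "integrable lebesgue v" and p: "\<phi> \<in> test_functions \<Omega>"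
  shows "(conv v \<phi> has_derivative (\<lambda>h. \<Sum>k\<in>UNIV. (h $ k) *\<^sub>R conv v (partial k \<phi>) x)) (at x)"
proof -
  obtain C where C: "0 \<le> C"
    "\<And>x h. norm (\<phi> (x + h) - \<phi> x - (\<Sum>k\<in>UNIV. (h $ k) *\<^sub>R partial k \<phi> x)) \<le> C * (norm h)\<^sup>2"
    using test_functions_Taylor[OF p] by metis
  let ?D = "\<lambda>h. \<Sum>k\<in>UNIV. (h $ k) *\<^sub>R conv v (partial k \<phi>) x"
  define V where "V = (LINT y|lebesgue. norm (v y))"
  note i = conv_integrable[OF v p] conv_integrable[OF v test_functions_partial[OF p]]
  have bd: "norm (conv v \<phi> (x + h) - conv v \<phi> x - ?D h) \<le> (V * C) * (norm h)\<^sup>2" for h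
  proof -
    have "conv v \<phi> (x + h) - conv v \<phi> x - ?D h =
       (LINT y|lebesgue. v y * \<phi> (x + h - y) - v y * \<phi> (x - y) - (\<Sum>k\<in>UNIV. (h $ k) *\<^sub>R (v y * partial k \<phi> (x - y))))"
      unfolding conv_def by (simp add: i)
    also have "(\<lambda>y. v y * \<phi> (x + h - y) - v y * \<phi> (x - y) - (\<Sum>k\<in>UNIV. (h $ k) *\<^sub>R (v y * partial k \<phi> (x - y))))
       = (\<lambda>y. v y * (\<phi> ((x - y) + h) - \<phi> (x - y) - (\<Sum>k\<in>UNIV. (h $ k) *\<^sub>R partial k \<phi> (x - y))))" (is "?F = ?G")
      by (rule ext) (simp add: right_diff_distrib sum_distrib_left add_diff_eq diff_add_eq)
    also have "norm (LINT y|lebesgue. ?G y) \<le> (LINT y|lebesgue. norm (v y) * (C * (norm h)\<^sup>2))"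
    proof (rule Bochner_Integration.integral_norm_bound_integral)
      have "integrable lebesgue ?F" using i by simp
      with \<open>?F = ?G\<close> show "integrable lebesgue ?G" by simp
      show "integrable lebesgue (\<lambda>y. norm (v y) * (C * (norm h)\<^sup>2))" using v by simp
      show "norm (?G y) \<le> norm (v y) * (C * (norm h)\<^sup>2)" for y
        unfolding norm_mult by (intro mult_left_mono C) simp
    qed
    finally show ?thesis by (simp add: V_def)
  qed
  show ?thesis
    unfolding has_derivative_at
  proof
    show "bounded_linear ?D"
      by (intro bounded_linear_sum bounded_linear_scaleR_const bounded_linear_vec_nth)
    show "((\<lambda>h. norm (conv v \<phi> (x + h) - conv v \<phi> x - ?D h) / norm h) \<longlongrightarrow> 0) (at 0)"
    proof (rule Lim_null_comparison)
      show "((\<lambda>h. (V * C) * norm h) \<longlongrightarrow> 0) (at (0 :: real ^ 'n))"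
        by (auto intro!: tendsto_eq_intros)
      show "\<forall>\<^sub>F h in at 0. norm (norm (conv v \<phi> (x + h) - conv v \<phi> x - ?D h) / norm h) \<le> (V * C) * norm h"
        unfolding eventually_at_filter using bd
        by (intro always_eventually) (auto simp: field_simps power2_eq_square)
    qed
  qed
qed

lemma partial_conv:
  assumes v: "integrable lebesgue v" and p: "\<phi> \<in> test_functions \<Omega>"
  shows "partial k (conv v \<phi>) = conv v (partial k \<phi>)"
proof
  fix x
  have "partial k (conv v \<phi>) x = (\<Sum>j\<in>UNIV. (axis k 1 $ j) *\<^sub>R conv v (partial j \<phi>) x)"
    by (rule partial_eqI[OF conv_has_derivative[OF assms]])
  also have "\<dots> = (\<Sum>j\<in>UNIV. if j = k then conv v (partial j \<phi>) x else 0)"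
    by (rule sum.cong) (auto simp: axis_def)
  finally show "partial k (conv v \<phi>) x = conv v (partial k \<phi>) x" by simp
qed

lemma smooth_conv:
  assumes v: "integrable lebesgue v" and p: "\<phi> \<in> test_functions \<Omega>"
  shows "smooth (conv v \<phi>)"
proof (rule smooth_coinduct[of _ "{conv v \<phi> | \<phi>. \<phi> \<in> test_functions \<Omega>}"], goal_cases)
  case (2 f x)
  then show ?case using conv_has_derivative[OF v] differentiableI by blast
next
  case (3 f k)
  then show ?case using partial_conv[OF v] test_functions_partial by fastforce
qed (use p in auto)

lemma conv_eq_0:
  assumes "\<And>y. v y \<noteq> 0 \<Longrightarrow> \<phi> (x - y) = 0" shows "conv v \<phi> x = 0"
proof -
  have "(\<lambda>y. v y * \<phi> (x - y)) = (\<lambda>y. 0)"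
  proof
    show "v y * \<phi> (x - y) = 0" for y using assms[of y] by (cases "v y = 0") simp_all
  qed
  then show ?thesis by (simp add: conv_def)
qed

lemma bump_nonneg: "0 \<le> bump c x"
  by (simp add: bump_def flat_nonneg)

lemma bump_eq_0: "1 \<le> c * (x \<bullet> x) \<Longrightarrow> bump c x = 0"
  by (simp add: bump_def flat_def)

lemma continuous_bump: "continuous_on S (bump c)"
proof -
  have "continuous_on S (\<lambda>x. Re (complex_of_real (bump c x)))"
    by (intro continuous_on_Re smooth_continuous smooth_bump)
  then show ?thesis by simp
qed

definition mollifier :: "nat \<Rightarrow> real ^ 'n \<Rightarrow> real" where
  "mollifier n x = bump ((real (Suc n))\<^sup>2) x / (LINT y|lborel. bump ((real (Suc n))\<^sup>2) (y :: real ^ 'n))"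

lemma bump_outside:
  assumes "1 / real (Suc n) \<le> norm x" shows "bump ((real (Suc n))\<^sup>2) x = 0"
proof (rule bump_eq_0)
  have "1 \<le> real (Suc n) * norm x" using assms by (simp add: field_simps)
  then have "1 \<le> (real (Suc n) * norm x)\<^sup>2" by simp
  then show "1 \<le> (real (Suc n))\<^sup>2 * (x \<bullet> x)" by (simp add: power_mult_distrib power2_norm_eq_inner)
qed

lemma integrable_bump: "integrable lborel (bump ((real (Suc n))\<^sup>2) :: real ^ 'n \<Rightarrow> real)"
proof -
  have "integrable lborel (\<lambda>x :: real ^ 'n. complex_of_real (bump ((real (Suc n))\<^sup>2) x))"
    by (intro integrable_continuous_compact_supp smooth_continuous smooth_bump)
       (rule compact_supp[of "cball 0 (1 / real (Suc n))"], simp_all add: bump_outside del: of_nat_Suc)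
  from integrable_Re[OF this] show ?thesis by simp
qed

lemma integral_bump_pos: "0 < (LINT y|lborel. bump ((real (Suc n))\<^sup>2) (y :: real ^ 'n))" (is "0 < ?I")
proof (rule ccontr)
  assume "\<not> 0 < ?I"
  moreover have "0 \<le> ?I" by (intro integral_nonneg_AE AE_I2 bump_nonneg)
  ultimately have "?I = 0" by simp
  then have "AE y in lborel. bump ((real (Suc n))\<^sup>2) (y :: real ^ 'n) = 0"
    by (subst (asm) integral_nonneg_eq_0_iff_AE[OF integrable_bump]) (simp_all add: bump_nonneg)
  then have ae: "AE y in lebesgue. bump ((real (Suc n))\<^sup>2) (y :: real ^ 'n) = 0" by (rule AE_completion)
  let ?B = "ball (0 :: real ^ 'n) (1 / real (Suc n))"
  have nz: "bump ((real (Suc n))\<^sup>2) y \<noteq> 0" if "y \<in> ?B" for y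
  proof -
    have "real (Suc n) * norm y < 1" using that by (simp add: field_simps)
    then have "(real (Suc n) * norm y)\<^sup>2 < 1"
      by (metis abs_of_nonneg abs_square_less_1 mult_nonneg_nonneg norm_ge_zero of_nat_0_le_iff)
    then have "(real (Suc n))\<^sup>2 * (y \<bullet> y) < 1" by (simp add: power_mult_distrib power2_norm_eq_inner)
    then show ?thesis by (simp add: bump_def flat_def)
  qed
  have "AE y in lebesgue. y \<notin> ?B" using ae by eventually_elim (use nz in blast)
  then have "?B \<in> null_sets lebesgue" by (subst (asm) AE_iff_null_sets[symmetric]) auto
  then have "negligible ?B" by (simp add: negligible_iff_null_sets)
  then show False using open_not_negligible[of ?B] by simp
qed

lemma mollifier_nonneg: "0 \<le> mollifier n x"
  by (simp add: mollifier_def bump_nonneg integral_nonneg_AE)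

lemma mollifier_outside: "1 / real (Suc n) \<le> norm x \<Longrightarrow> mollifier n x = 0"
  unfolding mollifier_def by (simp add: bump_outside del: of_nat_Suc)

lemma integrable_mollifier: "integrable lborel (mollifier n :: real ^ 'n \<Rightarrow> real)"
  unfolding mollifier_def by (intro integrable_divide integrable_bump)

lemma integral_mollifier: "(LINT x|lborel. mollifier n (x :: real ^ 'n)) = 1"
  using integral_bump_pos[where ?'n = 'n, of n] by (simp add: mollifier_def del: of_nat_Suc)

lemma mollifier_test: "(\<lambda>x. complex_of_real (mollifier n x)) \<in> test_functions UNIV"
proof -
  have "smooth (\<lambda>x. complex_of_real (1 / (LINT y|lborel. bump ((real (Suc n))\<^sup>2) (y :: real ^ 'n)))
     * complex_of_real (bump ((real (Suc n))\<^sup>2) (x :: real ^ 'n)))"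
    by (intro smooth_mult smooth_const smooth_bump)
  then have "smooth (\<lambda>x :: real ^ 'n. complex_of_real (mollifier n x))" by (simp add: mollifier_def)
  moreover have "compact (supp (\<lambda>x :: real ^ 'n. complex_of_real (mollifier n x)))"
    by (rule compact_supp[of "cball 0 (1 / real (Suc n))"]) (simp_all add: mollifier_outside del: of_nat_Suc)
  ultimately show ?thesis by (simp add: test_functions_iff)
qed

lemma continuous_mollifier: "continuous_on S (mollifier n)"
  unfolding mollifier_def
  by (intro continuous_on_divide continuous_bump continuous_on_const ballI
        less_imp_neq[OF integral_bump_pos, symmetric])

section \<open>Continuity of translations in \<open>L\<^sup>2\<close>\<close>

lemma continuous_dense_sqnorm:
  fixes v :: "real ^ 'n \<Rightarrow> complex"
  assumes v: "sqint lborel v" and R: "\<And>x. x \<notin> cball 0 R \<Longrightarrow> v x = 0" and "0 < e"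
  obtains s where "continuous_on UNIV s" "\<And>x. x \<notin> cball 0 (R + 1) \<Longrightarrow> s x = 0"
    "sqnorm lborel (\<lambda>x. v x - s x) < e"
proof -
  have vm [measurable]: "v \<in> borel_measurable borel" using v by (simp add: sqint_def)
  define T where "T = (\<lambda>n x. if norm (v x) \<le> real n then v x else 0)"
  have Tm: "T n \<in> borel_measurable borel" for n unfolding T_def by measurable
  have "sqlim lborel T v"
  proof (rule sqlim_dominated[where g = "\<lambda>x. (norm (v x))\<^sup>2"])
    show "AE x in lborel. (\<lambda>n. T n x) \<longlonglongrightarrow> v x"
    proof (rule AE_I2)
      fix x
      obtain m where m: "norm (v x) \<le> real m" using real_arch_simple by blast
      have "eventually (\<lambda>n. T n x = v x) sequentially"
        unfolding eventually_sequentially by (rule exI[of _ m]) (use m in \<open>auto simp: T_def\<close>)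
      then show "(\<lambda>n. T n x) \<longlonglongrightarrow> v x" by (rule tendsto_eventually)
    qed
  qed (use v Tm in \<open>auto simp: sqint_def\<close>, auto simp: T_def)
  then have "(\<lambda>n. sqnorm lborel (\<lambda>x. T n x - v x)) \<longlonglongrightarrow> 0" and Ti: "\<And>n. sqint lborel (T n)"
    by (auto simp: sqlim_def)
  then obtain n where n: "sqnorm lborel (\<lambda>x. T n x - v x) < e / 4"
    using order_tendstoD(2)[of _ 0 sequentially "e / 4"] \<open>0 < e\<close>
    by (metis (no_types, lifting) eventually_sequentially order_refl zero_less_divide_iff zero_less_numeral)
  define B where "B = real n + 1"
  have B: "0 < B" by (simp add: B_def)
  have "T n \<in> borel_measurable lebesgue" by (intro measurable_completion) (simp add: Tm)
  then have "T n measurable_on UNIV"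
    by (simp add: measurable_on_iff_borel_measurable lebesgue_on_UNIV_eq)
  then obtain N g where N: "negligible N" and g: "\<And>m. continuous_on UNIV (g m)"
    and gl: "\<And>x. x \<notin> N \<Longrightarrow> (\<lambda>m. g m x) \<longlonglongrightarrow> T n x"
    by (auto simp: measurable_on_def)
  define cl where "cl z = complex_of_real (B / max B (norm z)) * z" for z
  define cut where "cut x = complex_of_real (max 0 (min 1 (R + 1 - norm x)))" for x :: "real ^ 'n"
  define S where "S m x = cut x * cl (g m x)" for m x
  have ccl: "continuous_on UNIV cl"
    unfolding cl_def using B by (intro continuous_intros) auto
  have clB: "norm (cl z) \<le> B" for z
    using B by (auto simp: cl_def norm_mult norm_divide max_def field_simps)
  have cl_id: "cl z = z" if "norm z \<le> B" for z
    using that B by (auto simp: cl_def max_def)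
  have ccut: "continuous_on UNIV cut" unfolding cut_def by (intro continuous_intros)
  have cut1: "norm (cut x) \<le> 1" for x by (auto simp: cut_def)
  have cut0: "cut x = 0" if "x \<notin> cball 0 (R + 1)" for x using that by (auto simp: cut_def)
  have cut_id: "cut x * T n x = T n x" for x
    using R[of x] by (cases "x \<in> cball 0 R") (auto simp: cut_def T_def)
  have cS: "continuous_on UNIV (S m)" for m
    unfolding S_def by (intro continuous_on_mult ccut continuous_on_compose2[OF ccl g]) auto
  have "sqlim lborel S (T n)"
  proof (rule sqlim_dominated[where g = "\<lambda>x. B\<^sup>2 * indicator (cball 0 (R + 1)) x"])
    show "S m \<in> borel_measurable lborel" for m using cS by (simp add: borel_measurable_continuous_onI)
    show "T n \<in> borel_measurable lborel" using Ti by (simp add: sqint_def)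
    show "integrable lborel (\<lambda>x. B\<^sup>2 * indicat_real (cball (0 :: real ^ 'n) (R + 1)) x)"
      by (rule integrable_cball)
    show "AE x in lborel. (norm (S m x))\<^sup>2 \<le> B\<^sup>2 * indicator (cball 0 (R + 1)) x" for m
    proof (rule AE_I2)
      fix x
      have "norm (S m x) \<le> 1 * B" unfolding S_def norm_mult using B by (intro mult_mono cut1 clB) auto
      then show "(norm (S m x))\<^sup>2 \<le> B\<^sup>2 * indicator (cball 0 (R + 1)) x"
        using cut0[of x] by (cases "x \<in> cball 0 (R + 1)") (auto simp: S_def intro!: power_mono)
    qed
    have "AE x in lebesgue. x \<notin> N" using N by (simp add: negligible_iff_null_sets AE_not_in)
    then have "AE x in lborel. x \<notin> N" by (simp add: AE_completion_iff)
    then show "AE x in lborel. (\<lambda>m. S m x) \<longlonglongrightarrow> T n x"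
    proof eventually_elim
      case (elim x)
      have "isCont cl (T n x)" using ccl by (simp add: continuous_on_eq_continuous_at)
      from tendsto_mult[OF tendsto_const isCont_tendsto_compose[OF this gl[OF elim]], of "cut x"]
      have "(\<lambda>m. S m x) \<longlonglongrightarrow> cut x * cl (T n x)" by (simp add: S_def)
      moreover have "cl (T n x) = T n x" by (rule cl_id) (auto simp: T_def B_def)
      ultimately show ?case by (simp add: cut_id)
    qed
  qed
  then have "(\<lambda>m. sqnorm lborel (\<lambda>x. S m x - T n x)) \<longlonglongrightarrow> 0" and Si: "\<And>m. sqint lborel (S m)"
    by (auto simp: sqlim_def)
  then obtain m where m: "sqnorm lborel (\<lambda>x. S m x - T n x) < e / 4"
    using order_tendstoD(2)[of _ 0 sequentially "e / 4"] \<open>0 < e\<close>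
    by (metis (no_types, lifting) eventually_sequentially order_refl zero_less_divide_iff zero_less_numeral)
  have "sqnorm lborel (\<lambda>x. (v x - T n x) + (T n x - S m x))
     \<le> 2 * sqnorm lborel (\<lambda>x. v x - T n x) + 2 * sqnorm lborel (\<lambda>x. T n x - S m x)"
    by (intro sqnorm_add_le sqint_diff v Ti Si)
  also have "\<dots> < e" using n m by (simp add: sqnorm_diff_commute[of _ v] sqnorm_diff_commute[of _ "T n" "S m"])
  finally have "sqnorm lborel (\<lambda>x. v x - S m x) < e" by simp
  moreover have "S m x = 0" if "x \<notin> cball 0 (R + 1)" for x using cut0[OF that] by (simp add: S_def)
  ultimately show ?thesis using that cS by blast
qed

lemma sqint_translate:
  fixes f :: "real ^ 'n \<Rightarrow> complex"
  assumes "sqint lborel f" shows "sqint lborel (\<lambda>x. f (x - y))"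
proof -
  have m [measurable]: "f \<in> borel_measurable borel" using assms by (simp add: sqint_def)
  have "integrable (distr lborel borel (\<lambda>x. x - y)) (\<lambda>x. (norm (f x))\<^sup>2)"
    unfolding lborel_distr_diff using assms by (simp add: sqint_def)
  then have "integrable lborel (\<lambda>x. (norm (f (x - y)))\<^sup>2)"
    by (subst (asm) integrable_distr_eq) auto
  then show ?thesis by (simp add: sqint_def)
qed

lemma sqnorm_translate:
  fixes f :: "real ^ 'n \<Rightarrow> complex"
  assumes "f \<in> borel_measurable borel" shows "sqnorm lborel (\<lambda>x. f (x - y)) = sqnorm lborel f"
proof -
  have "(LINT x|distr lborel borel (\<lambda>x. x - y). (norm (f x))\<^sup>2) = (LINT x|lborel. (norm (f (x - y)))\<^sup>2)"
    using assms by (intro integral_distr) auto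
  then show ?thesis by (simp add: sqnorm_def lborel_distr_diff)
qed

lemma translation_continuous_sqnorm:
  fixes v :: "real ^ 'n \<Rightarrow> complex"
  assumes v: "sqint lborel v" and R: "\<And>x. x \<notin> cball 0 R \<Longrightarrow> v x = 0" and e: "0 < e"
  obtains d where "0 < d" "\<And>y. norm y < d \<Longrightarrow> sqnorm lborel (\<lambda>x. v (x - y) - v x) \<le> e"
proof -
  have e12: "0 < e / 12" using e by simp
  obtain s where s: "continuous_on UNIV s" "\<And>x. x \<notin> cball 0 (R + 1) \<Longrightarrow> s x = 0"
    "sqnorm lborel (\<lambda>x. v x - s x) < e / 12"
    using continuous_dense_sqnorm[OF v R e12] by metis
  have vm [measurable]: "v \<in> borel_measurable borel" using v by (simp add: sqint_def)
  have sm [measurable]: "s \<in> borel_measurable borel" using s(1) by (rule borel_measurable_continuous_onI)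
  have cs: "compact (supp s)" by (rule compact_supp[OF compact_cball s(2)])
  obtain B where B: "0 < B" "\<And>x. norm (s x) \<le> B" using bounded_of_compact_supp[OF s(1) cs] by metis
  note ind = integrable_cball
  have si: "sqint lborel s"
  proof (rule sqint_bound[OF _ ind])
    show "AE x in lborel. (norm (s x))\<^sup>2 \<le> B\<^sup>2 * indicat_real (cball 0 (R + 1)) x"
    proof (rule AE_I2)
      fix x show "(norm (s x))\<^sup>2 \<le> B\<^sup>2 * indicat_real (cball 0 (R + 1)) x"
        using B s(2)[of x] by (cases "x \<in> cball 0 (R + 1)") (auto intro!: power_mono)
    qed
  qed simp
  define V where "V = measure lborel (cball (0 :: real ^ 'n) (R + 2))"
  define \<delta> where "\<delta> = sqrt (e / (12 * (V + 1)))"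
  have "0 \<le> V" by (simp add: V_def)
  then have \<delta>: "0 < \<delta>" "\<delta>\<^sup>2 * V \<le> e / 12" using e by (auto simp: \<delta>_def field_simps)
  have "uniformly_continuous_on (cball 0 (R + 2)) s"
    by (rule compact_uniformly_continuous) (use s(1) continuous_on_subset in \<open>auto\<close>)
  then obtain d where d: "0 < d" "\<And>x y. x \<in> cball 0 (R + 2) \<Longrightarrow> y \<in> cball 0 (R + 2) \<Longrightarrow> dist y x < d \<Longrightarrow> dist (s y) (s x) < \<delta>"
    unfolding uniformly_continuous_on_def using \<delta>(1) by metis
  have "sqnorm lborel (\<lambda>x. v (x - y) - v x) \<le> e" if y: "norm y < min d 1" for y
  proof -
    have pw: "norm (s (x - y) - s x) \<le> \<delta> * indicator (cball 0 (R + 2)) x" for x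
    proof (cases "x \<in> cball 0 (R + 1) \<or> x - y \<in> cball 0 (R + 1)")
      case True
      have "norm x \<le> norm (x - y) + norm y" "norm (x - y) \<le> norm x + norm y"
        using norm_triangle_ineq[of "x - y" y] norm_triangle_ineq4[of x y] by auto
      with True y have "x \<in> cball 0 (R + 2)" "x - y \<in> cball 0 (R + 2)" by auto
      moreover have "dist (x - y) x < d" using y by (simp add: dist_norm)
      ultimately show ?thesis using d(2)[of x "x - y"] by (simp add: dist_norm)
    next
      case False
      then show ?thesis using s(2)[of x] s(2)[of "x - y"] \<delta>(1) by simp
    qed
    have "sqnorm lborel (\<lambda>x. s (x - y) - s x) \<le> (LINT x|lborel. \<delta>\<^sup>2 * indicator (cball (0 :: real ^ 'n) (R + 2)) x)"
      unfolding sqnorm_def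
    proof (rule integral_mono[OF _ ind])
      show "integrable lborel (\<lambda>x. (norm (s (x - y) - s x))\<^sup>2)"
        using sqint_diff[OF sqint_translate[OF si] si] by (simp add: sqint_def)
      show "(norm (s (x - y) - s x))\<^sup>2 \<le> \<delta>\<^sup>2 * indicator (cball 0 (R + 2)) x" for x
        using power_mono[OF pw[of x], of 2] by (cases "x \<in> cball 0 (R + 2)") (auto simp: power_mult_distrib)
    qed
    also have "\<dots> = \<delta>\<^sup>2 * V" by (simp add: V_def)
    also have "\<dots> \<le> e / 12" by (rule \<delta>)
    finally have 1: "sqnorm lborel (\<lambda>x. s (x - y) - s x) \<le> e / 12" .
    have 2: "sqnorm lborel (\<lambda>x. v (x - y) - s (x - y)) < e / 12"
      using s(3) sqnorm_translate[of "\<lambda>x. v x - s x" y] by simp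
    note I = sqint_diff[OF sqint_translate[OF v] sqint_translate[OF si], of y]
      sqint_diff[OF sqint_translate[OF si] si, of y] sqint_diff[OF si v]
    have "sqnorm lborel (\<lambda>x. v (x - y) - v x) =
       sqnorm lborel (\<lambda>x. (v (x - y) - s (x - y)) + ((s (x - y) - s x) + (s x - v x)))"
      by simp
    also have "\<dots> \<le> 2 * sqnorm lborel (\<lambda>x. v (x - y) - s (x - y)) +
       2 * sqnorm lborel (\<lambda>x. (s (x - y) - s x) + (s x - v x))"
      by (intro sqnorm_add_le sqint_add I)
    finally have 3: "sqnorm lborel (\<lambda>x. v (x - y) - v x) \<le> 2 * sqnorm lborel (\<lambda>x. v (x - y) - s (x - y)) +
       2 * sqnorm lborel (\<lambda>x. (s (x - y) - s x) + (s x - v x))" .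
    have "sqnorm lborel (\<lambda>x. (s (x - y) - s x) + (s x - v x)) \<le>
       2 * sqnorm lborel (\<lambda>x. s (x - y) - s x) + 2 * sqnorm lborel (\<lambda>x. s x - v x)"
      by (intro sqnorm_add_le I)
    then show ?thesis
      using 1 2 3 s(3) e sqnorm_diff_commute[of lborel s v] by linarith
  qed
  with d(1) that[of "min d 1"] show ?thesis by auto
qed

lemma borel_rep_lebesgue:
  fixes v :: "real ^ 'n \<Rightarrow> complex"
  assumes v: "v \<in> borel_measurable lebesgue" and K: "K \<in> sets borel" "\<And>x. x \<notin> K \<Longrightarrow> v x = 0"
  obtains w where "w \<in> borel_measurable borel" "AE x in lebesgue. v x = w x" "\<And>x. x \<notin> K \<Longrightarrow> w x = 0"
proof -
  have m: "(\<lambda>x. Re (v x)) \<in> borel_measurable lebesgue" "(\<lambda>x. Im (v x)) \<in> borel_measurable lebesgue"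
    using v by (auto intro: borel_measurable_Re borel_measurable_Im)
  from completion_ex_borel_measurable_real[OF m(1)]
  obtain f where f [measurable]: "f \<in> borel_measurable lborel" "AE x in lborel. Re (v x) = f x" by auto
  from completion_ex_borel_measurable_real[OF m(2)]
  obtain g where g [measurable]: "g \<in> borel_measurable lborel" "AE x in lborel. Im (v x) = g x" by auto
  define w where "w = (\<lambda>x. indicator K x *\<^sub>R (complex_of_real (f x) + \<i> * complex_of_real (g x)))"
  have "w \<in> borel_measurable borel" unfolding w_def using f(1) g(1) K(1) by simp
  moreover have "AE x in lborel. v x = w x"
    using f(2) g(2)
  proof eventually_elim
    case (elim x)
    then show ?case using K(2)[of x] by (cases "x \<in> K") (auto simp: w_def complex_eq_iff)
  qed
  ultimately show ?thesis
    using that[of w] by (auto simp: w_def AE_completion)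
qed

section \<open>Mollification in \<open>L\<^sup>2\<close>\<close>

lemma mollifier_bounded: obtains B where "0 < B" "\<And>x :: real ^ 'n. mollifier n x \<le> B"
  using test_functions_bounded[OF mollifier_test[of n]]
  by (metis abs_ge_self norm_of_real order_trans)

lemma borel_mollifier [measurable]: "mollifier n \<in> borel_measurable borel"
  by (rule borel_measurable_continuous_onI[OF continuous_mollifier])

lemma norm_mollify_diff_le:
  fixes v :: "real ^ 'n \<Rightarrow> complex"
  assumes v: "sqint lborel v"
  shows "integrable lborel (\<lambda>y. (norm (v (x - y) - v x))\<^sup>2 * mollifier n y)"
    and "(norm ((LINT y|lborel. v y * mollifier n (x - y)) - v x))\<^sup>2
       \<le> (LINT y|lborel. (norm (v (x - y) - v x))\<^sup>2 * mollifier n y)"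
proof -
  have vm [measurable]: "v \<in> borel_measurable borel" using v by (simp add: sqint_def)
  obtain B where B: "0 < B" "\<And>x :: real ^ 'n. mollifier n x \<le> B" using mollifier_bounded by metis
  have vr: "sqint lborel (\<lambda>y. v (x - y))"
  proof -
    have "integrable (distr lborel borel (\<lambda>y. x - y)) (\<lambda>x. (norm (v x))\<^sup>2)"
      unfolding lborel_distr_reflect using v by (simp add: sqint_def)
    then have "integrable lborel (\<lambda>y. (norm (v (x - y)))\<^sup>2)"
      by (subst (asm) integrable_distr_eq) auto
    then show ?thesis by (simp add: sqint_def)
  qed
  define r where "r y = complex_of_real (sqrt (mollifier n y))" for y :: "real ^ 'n"
  have rr: "r y * r y = mollifier n y" "(norm (r y))\<^sup>2 = mollifier n y" for y
    by (simp_all add: r_def mollifier_nonneg flip: of_real_mult)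
  have rm: "r \<in> borel_measurable borel" unfolding r_def[abs_def] by measurable
  have ri: "sqint lborel r" using rm by (simp add: sqint_def rr integrable_mollifier)
  have rB: "norm (r y) \<le> sqrt B" for y using B(2)[of y] by (simp add: r_def mollifier_nonneg)
  have 1: "sqint lborel (\<lambda>y. r y * v (x - y))"
    by (rule sqint_bmult[OF vr]) (use rm rB in auto)
  have 2: "sqint lborel (\<lambda>y. r y * v (x - y) - v x * r y)"
    by (intro sqint_diff 1 sqint_cmult ri)
  have n2: "(norm (r y * v (x - y) - v x * r y))\<^sup>2 = (norm (v (x - y) - v x))\<^sup>2 * mollifier n y" for y
  proof -
    have "r y * v (x - y) - v x * r y = (v (x - y) - v x) * r y" by (simp add: algebra_simps)
    then show ?thesis by (simp add: norm_mult power_mult_distrib rr)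
  qed
  show "integrable lborel (\<lambda>y. (norm (v (x - y) - v x))\<^sup>2 * mollifier n y)"
    using 2 by (simp add: sqint_def n2)
  have eq: "(LINT y|lborel. v y * mollifier n (x - y)) = (LINT y|lborel. v (x - y) * mollifier n y)"
  proof -
    have "(LINT y|distr lborel borel (\<lambda>y. x - y). v y * mollifier n (x - y)) =
       (LINT y|lborel. v (x - y) * mollifier n (x - (x - y)))"
      by (rule integral_distr) measurable
    then show ?thesis by (simp add: lborel_distr_reflect)
  qed
  have e1: "(r y * v (x - y)) * r y = v (x - y) * mollifier n y" for y
    by (simp add: rr(1)[symmetric] ac_simps)
  have i1: "integrable lborel (\<lambda>y. v (x - y) * mollifier n y)"
    using sqint_mult_integrable[OF 1 ri] unfolding e1 .
  have "(LINT y|lborel. v (x - y) * mollifier n y) - v x =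
     (LINT y|lborel. v (x - y) * mollifier n y) - (LINT y|lborel. v x * complex_of_real (mollifier n (y :: real ^ 'n)))"
    by (simp add: integral_mollifier)
  also have "\<dots> = (LINT y|lborel. v (x - y) * mollifier n y - v x * complex_of_real (mollifier n y))"
    by (rule Bochner_Integration.integral_diff[symmetric]) (intro i1, simp add: integrable_mollifier)
  also have "(\<lambda>y. v (x - y) * mollifier n y - v x * complex_of_real (mollifier n y)) =
     (\<lambda>y. (r y * v (x - y) - v x * r y) * r y)"
  proof
    fix y
    have "(r y * v (x - y) - v x * r y) * r y = (r y * v (x - y)) * r y - v x * (r y * r y)"
      by (simp only: left_diff_distrib mult.assoc)
    also have "\<dots> = v (x - y) * mollifier n y - v x * complex_of_real (mollifier n y)"
      unfolding e1 rr(1) ..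
    finally show "v (x - y) * mollifier n y - v x * complex_of_real (mollifier n y) =
      (r y * v (x - y) - v x * r y) * r y" by (rule sym)
  qed
  finally have d: "(LINT y|lborel. v (x - y) * mollifier n y) - v x =
    (LINT y|lborel. (r y * v (x - y) - v x * r y) * r y)" .
  let ?D = "norm ((LINT y|lborel. v y * mollifier n (x - y)) - v x)"
  have "sqnorm lborel r = 1" by (simp add: sqnorm_def rr integral_mollifier)
  then have D: "?D \<le> sqrt (sqnorm lborel (\<lambda>y. r y * v (x - y) - v x * r y))"
    using norm_integral_mult_le[OF 2 ri] unfolding eq d by simp
  have "?D\<^sup>2 \<le> (sqrt (sqnorm lborel (\<lambda>y. r y * v (x - y) - v x * r y)))\<^sup>2"
    using D norm_ge_zero by (rule power_mono)
  then have "?D\<^sup>2 \<le> sqnorm lborel (\<lambda>y. r y * v (x - y) - v x * r y)"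
    by (simp only: real_sqrt_pow2[OF sqnorm_nonneg])
  then show "(norm ((LINT y|lborel. v y * mollifier n (x - y)) - v x))\<^sup>2
       \<le> (LINT y|lborel. (norm (v (x - y) - v x))\<^sup>2 * mollifier n y)"
    by (simp add: sqnorm_def n2)
qed

abbreviation mollify :: "nat \<Rightarrow> (real ^ 'n \<Rightarrow> complex) \<Rightarrow> real ^ 'n \<Rightarrow> complex" where
  "mollify n v \<equiv> conv v (\<lambda>x. complex_of_real (mollifier n x))"

lemma integrable_of_sqint_bounded_support:
  assumes v: "sqint lebesgue v" and R: "\<And>x :: real ^ 'n. x \<notin> cball 0 R \<Longrightarrow> v x = 0"
  shows "integrable lebesgue v"
proof (rule Bochner_Integration.integrable_bound)
  have "integrable lebesgue (\<lambda>x :: real ^ 'n. 1 * indicat_real (cball 0 R) x)"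
    using integrable_cball[of 1 "0 :: real ^ 'n" R] by (subst integrable_completion) auto
  then show "integrable lebesgue (\<lambda>x. (norm (v x))\<^sup>2 + 1 * indicat_real (cball 0 R) x)"
    using v by (intro Bochner_Integration.integrable_add) (auto simp: sqint_def)
  show "AE x in lebesgue. norm (v x) \<le> norm ((norm (v x))\<^sup>2 + 1 * indicat_real (cball 0 R) x)"
  proof (rule AE_I2)
    fix x
    have "0 \<le> (norm (v x) - 1)\<^sup>2" by simp
    then have "2 * norm (v x) \<le> (norm (v x))\<^sup>2 + 1" by (simp add: power2_eq_square algebra_simps)
    then have "norm (v x) \<le> (norm (v x))\<^sup>2 + 1" using norm_ge_zero[of "v x"] by linarith
    then show "norm (v x) \<le> norm ((norm (v x))\<^sup>2 + 1 * indicat_real (cball 0 R) x)"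
      using R[of x] by (cases "x \<in> cball 0 R") auto
  qed
qed (use v in \<open>simp add: sqint_def\<close>)

lemma mollify_eq_0:
  assumes "\<And>y. v y \<noteq> 0 \<Longrightarrow> 1 / real (Suc n) \<le> norm (x - y)"
  shows "mollify n v x = 0"
  by (rule conv_eq_0) (use assms mollifier_outside in auto)

lemma sqint_smooth:
  assumes "smooth f" "compact (supp f)" shows "sqint lebesgue f"
proof -
  have c: "continuous_on UNIV f" using assms(1) by (rule smooth_continuous)
  have "smooth (\<lambda>x. f x * f x)" using assms(1) by (intro smooth_mult)
  then have "continuous_on UNIV (\<lambda>x. f x * f x)" by (rule smooth_continuous)
  moreover have "compact (supp (\<lambda>x. f x * f x))"
    by (rule compact_supp[OF assms(2)]) (simp add: zero_off_supp)
  ultimately have "integrable lborel (\<lambda>x. f x * f x)" by (rule integrable_continuous_compact_supp)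
  then have "integrable lborel (\<lambda>x. (norm (f x))\<^sup>2)"
    using integrable_norm by (fastforce simp: norm_mult power2_eq_square)
  then have "integrable lebesgue (\<lambda>x. (norm (f x))\<^sup>2)"
    by (subst integrable_completion) auto
  with borel_measurable_lebesgue_continuous[OF c] show ?thesis by (simp add: sqint_def)
qed

lemma test_functions_sqint: "\<phi> \<in> test_functions \<Omega> \<Longrightarrow> sqint lebesgue \<phi>"
  by (simp add: test_functions_iff sqint_smooth)

lemma mollify_test:
  fixes v :: "real ^ 'n \<Rightarrow> complex"
  assumes v: "integrable lebesgue v" and R: "\<And>x. x \<notin> cball 0 R \<Longrightarrow> v x = 0"
  shows "mollify n v \<in> test_functions UNIV"
proof -
  have "compact (supp (mollify n v))"
  proof (rule compact_supp[of "cball 0 (R + 1)"])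
    fix x :: "real ^ 'n" assume x: "x \<notin> cball 0 (R + 1)"
    show "mollify n v x = 0"
    proof (rule mollify_eq_0)
      fix y assume "v y \<noteq> 0"
      then have "norm y \<le> R" using R[of y] by auto
      moreover have "R + 1 < norm x" using x by simp
      moreover have "norm x \<le> norm (x - y) + norm y" using norm_triangle_ineq[of "x - y" y] by simp
      moreover have "1 / real (Suc n) \<le> 1" by simp
      ultimately show "1 / real (Suc n) \<le> norm (x - y)" by linarith
    qed
  qed simp
  then show ?thesis using smooth_conv[OF v mollifier_test] by (simp add: test_functions_iff)
qed

lemma sqnorm_lebesgue: "f \<in> borel_measurable borel \<Longrightarrow> sqnorm lebesgue f = sqnorm lborel f"
  unfolding sqnorm_def by (rule integral_completion) simp

lemma sqlim_mollify:
  fixes v :: "real ^ 'n \<Rightarrow> complex"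
  assumes v: "sqint lebesgue v" and R: "\<And>x. x \<notin> cball 0 R \<Longrightarrow> v x = 0"
  shows "sqlim lebesgue (\<lambda>n. mollify n v) v"
proof -
  obtain w where w [measurable]: "w \<in> borel_measurable borel" and vw: "AE x in lebesgue. v x = w x"
    and wR: "\<And>x. x \<notin> cball 0 R \<Longrightarrow> w x = 0"
    using borel_rep_lebesgue[OF sqint_measurable[OF v] borel_closed[OF closed_cball] R] by metis
  have wl: "w \<in> borel_measurable lebesgue" by (simp add: measurable_completion)
  have "sqint lebesgue w" using sqint_cong_AE[OF v vw wl] .
  then have wi: "sqint lborel w" by (simp add: sqint_def integrable_completion)
  have Mi: "sqint lebesgue (mollify n v)" for n
    using mollify_test[OF integrable_of_sqint_bounded_support[OF v R] R] by (rule test_functions_sqint)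
  have Mc: "continuous_on UNIV (mollify n v)" for n
    using mollify_test[OF integrable_of_sqint_bounded_support[OF v R] R]
    by (simp add: test_functions_iff smooth_continuous)
  then have Mb [measurable]: "mollify n v \<in> borel_measurable borel" for n by (rule borel_measurable_continuous_onI)
  have eq: "mollify n v x = (LINT y|lborel. w y * mollifier n (x - y))" for n x
  proof -
    have mm: "(\<lambda>y. complex_of_real (mollifier n (x - y))) \<in> borel_measurable lebesgue"
      by (intro measurable_completion) measurable
    have "mollify n v x = (LINT y|lebesgue. w y * mollifier n (x - y))"
      unfolding conv_def
    proof (rule integral_cong_AE)
      show "AE y in lebesgue. v y * complex_of_real (mollifier n (x - y)) = w y * complex_of_real (mollifier n (x - y))"
        using vw by eventually_elim simp
    qed (use mm wl sqint_measurable[OF v] in auto)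
    also have "\<dots> = (LINT y|lborel. w y * mollifier n (x - y))" by (rule integral_completion) measurable
    finally show ?thesis .
  qed
  have "(\<lambda>n. sqnorm lborel (\<lambda>x. mollify n v x - w x)) \<longlonglongrightarrow> 0"
  proof (rule LIMSEQ_I)
    fix e :: real assume "0 < e"
    then have e2: "0 < e / 2" by simp
    obtain d where d: "0 < d" "\<And>y. norm y < d \<Longrightarrow> sqnorm lborel (\<lambda>x. w (x - y) - w x) \<le> e / 2"
      using translation_continuous_sqnorm[OF wi wR e2] by metis
    obtain N where N: "inverse (real (Suc N)) < d" using reals_Archimedean[OF d(1)] by blast
    have "norm (sqnorm lborel (\<lambda>x. mollify n v x - w x) - 0) < e" if "n \<ge> N" for n
    proof -
      have nd: "1 / real (Suc n) < d"
      proof -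
        have "1 / real (Suc n) \<le> 1 / real (Suc N)" using that by (intro divide_left_mono) auto
        then show ?thesis using N by (simp add: inverse_eq_divide)
      qed
      have "(\<integral>\<^sup>+x. ennreal ((norm (mollify n v x - w x))\<^sup>2) \<partial>lborel)
        \<le> (\<integral>\<^sup>+x. \<integral>\<^sup>+y. ennreal ((norm (w (x - y) - w x))\<^sup>2 * mollifier n y) \<partial>lborel \<partial>lborel)"
      proof (rule nn_integral_mono)
        fix x
        have "(norm (mollify n v x - w x))\<^sup>2 \<le> (LINT y|lborel. (norm (w (x - y) - w x))\<^sup>2 * mollifier n y)"
          unfolding eq by (rule norm_mollify_diff_le[OF wi])
        also have "ennreal \<dots> = (\<integral>\<^sup>+y. ennreal ((norm (w (x - y) - w x))\<^sup>2 * mollifier n y) \<partial>lborel)"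
          by (rule nn_integral_eq_integral[symmetric])
             (auto intro!: norm_mollify_diff_le(1)[OF wi] mult_nonneg_nonneg mollifier_nonneg)
        finally show "ennreal ((norm (mollify n v x - w x))\<^sup>2) \<le>
           (\<integral>\<^sup>+y. ennreal ((norm (w (x - y) - w x))\<^sup>2 * mollifier n y) \<partial>lborel)"
          by (simp add: ennreal_leI)
      qed
      also have "\<dots> = (\<integral>\<^sup>+y. \<integral>\<^sup>+x. ennreal ((norm (w (x - y) - w x))\<^sup>2 * mollifier n y) \<partial>lborel \<partial>lborel)"
        by (rule lborel_pair.Fubini'[symmetric]) measurable
      also have "\<dots> \<le> (\<integral>\<^sup>+y. ennreal (e / 2 * mollifier n (y :: real ^ 'n)) \<partial>lborel)"
      proof (rule nn_integral_mono)
        fix y :: "real ^ 'n"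
        note I = sqint_diff[OF sqint_translate[OF wi] wi, of y]
        have "(\<integral>\<^sup>+x. ennreal ((norm (w (x - y) - w x))\<^sup>2 * mollifier n y) \<partial>lborel)
          = ennreal (LINT x|lborel. (norm (w (x - y) - w x))\<^sup>2 * mollifier n y)"
          by (rule nn_integral_eq_integral) (use I in \<open>auto simp: sqint_def intro!: mult_nonneg_nonneg mollifier_nonneg\<close>)
        also have "\<dots> = ennreal (sqnorm lborel (\<lambda>x. w (x - y) - w x) * mollifier n y)"
          using I by (simp add: sqnorm_def)
        also have "\<dots> \<le> ennreal (e / 2 * mollifier n y)"
        proof (cases "norm y < 1 / real (Suc n)")
          case True
          then show ?thesis using d(2)[of y] nd
            by (intro ennreal_leI mult_right_mono) (auto simp: mollifier_nonneg)
        qed (simp add: mollifier_outside del: of_nat_Suc)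
        finally show "(\<integral>\<^sup>+x. ennreal ((norm (w (x - y) - w x))\<^sup>2 * mollifier n y) \<partial>lborel) \<le> ennreal (e / 2 * mollifier n y)" .
      qed
      also have "\<dots> = ennreal (LINT y|lborel. e / 2 * mollifier n (y :: real ^ 'n))"
        by (rule nn_integral_eq_integral)
           (use \<open>0 < e\<close> in \<open>auto intro!: integrable_mult_right integrable_mollifier mult_nonneg_nonneg mollifier_nonneg simp del: times_divide_eq_left\<close>)
      also have "\<dots> = ennreal (e / 2)"
      proof -
        have "(LINT y|lborel. e / 2 * mollifier n (y :: real ^ 'n)) = e / 2 * (LINT y|lborel. mollifier n (y :: real ^ 'n))"
          by (rule Bochner_Integration.integral_mult_right[OF integrable_mollifier])
        then show ?thesis by (simp add: integral_mollifier)
      qed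
      finally have *: "(\<integral>\<^sup>+x. ennreal ((norm (mollify n v x - w x))\<^sup>2) \<partial>lborel) \<le> ennreal (e / 2)" .
      have "sqnorm lborel (\<lambda>x. mollify n v x - w x) = enn2real (\<integral>\<^sup>+x. ennreal ((norm (mollify n v x - w x))\<^sup>2) \<partial>lborel)"
        unfolding sqnorm_def by (rule integral_eq_nn_integral) auto
      also have "\<dots> \<le> e / 2" using * \<open>0 < e\<close> by (intro enn2real_leI) auto
      finally show ?thesis using \<open>0 < e\<close> sqnorm_nonneg[of lborel "\<lambda>x. mollify n v x - w x"] by simp
    qed
    then show "\<exists>N. \<forall>n\<ge>N. norm (sqnorm lborel (\<lambda>x. mollify n v x - w x) - 0) < e" by blast
  qed
  moreover have "sqnorm lborel (\<lambda>x. mollify n v x - w x) = sqnorm lebesgue (\<lambda>x. mollify n v x - v x)" for n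
  proof -
    have "sqnorm lebesgue (\<lambda>x. mollify n v x - w x) = sqnorm lebesgue (\<lambda>x. mollify n v x - v x)"
    proof (rule sqnorm_cong_AE)
      show "AE x in lebesgue. mollify n v x - w x = mollify n v x - v x"
        using vw by eventually_elim simp
    qed (use Mi[of n] v wl in \<open>auto simp: sqint_def\<close>)
    then show ?thesis by (simp add: sqnorm_lebesgue)
  qed
  ultimately show ?thesis using v Mi by (simp add: sqlim_def)
qed

section \<open>Restriction and extension by zero\<close>

abbreviation zero_ext :: "'a set \<Rightarrow> ('a \<Rightarrow> complex) \<Rightarrow> 'a \<Rightarrow> complex" where
  "zero_ext K f \<equiv> \<lambda>x. indicator K x *\<^sub>R f x"

lemma norm_zero_ext_sq: "(norm (zero_ext K f x))\<^sup>2 = indicator K x *\<^sub>R (norm (f x))\<^sup>2"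
  by (simp add: indicator_def)

lemma sqint_lebesgue_on:
  assumes "K \<in> sets lebesgue"
  shows "sqint (lebesgue_on K) f \<longleftrightarrow> sqint lebesgue (zero_ext K f)"
  using assms unfolding sqint_def norm_zero_ext_sq
  by (subst borel_measurable_restrict_space_iff) (auto simp: integrable_restrict_space)

lemma sqnorm_lebesgue_on:
  assumes "K \<in> sets lebesgue"
  shows "sqnorm (lebesgue_on K) f = sqnorm lebesgue (zero_ext K f)"
  using assms unfolding sqnorm_def norm_zero_ext_sq by (simp add: integral_restrict_space)

lemma integrable_lebesgue_on:
  fixes f :: "real ^ 'n \<Rightarrow> complex"
  assumes "K \<in> sets lebesgue"
  shows "integrable (lebesgue_on K) f \<longleftrightarrow> integrable lebesgue (zero_ext K f)"
  using assms by (simp add: integrable_restrict_space)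

lemma integral_lebesgue_on:
  fixes f :: "real ^ 'n \<Rightarrow> complex"
  assumes "K \<in> sets lebesgue"
  shows "integral\<^sup>L (lebesgue_on K) f = integral\<^sup>L lebesgue (zero_ext K f)"
  using assms by (simp add: integral_restrict_space)

lemma AE_lebesgue_on:
  assumes "K \<in> sets lebesgue"
  shows "(AE x in lebesgue_on K. P x) \<longleftrightarrow> (AE x in lebesgue. x \<in> K \<longrightarrow> P x)"
  using assms by (simp add: AE_restrict_space_iff)

lemma sqint_subset:
  assumes "K \<in> sets lebesgue" "L \<in> sets lebesgue" "K \<subseteq> L" "sqint (lebesgue_on L) f"
  shows "sqint (lebesgue_on K) f"
proof -
  have "sqint lebesgue (\<lambda>x. complex_of_real (indicat_real K x) * zero_ext L f x)"
    using assms by (intro sqint_bmult[where B = 1]) (auto simp: sqint_lebesgue_on indicator_def)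
  moreover have "(\<lambda>x. complex_of_real (indicat_real K x) * zero_ext L f x) = zero_ext K f"
    using assms(3) by (auto simp: fun_eq_iff split: split_indicator)
  ultimately show ?thesis using assms(1) by (simp add: sqint_lebesgue_on)
qed

lemma sqnorm_subset:
  assumes "K \<in> sets lebesgue" "L \<in> sets lebesgue" "K \<subseteq> L" "sqint (lebesgue_on L) f"
  shows "sqnorm (lebesgue_on K) f \<le> sqnorm (lebesgue_on L) f"
proof -
  have "sqint lebesgue (zero_ext K f)" "sqint lebesgue (zero_ext L f)"
    using sqint_subset[OF assms] assms by (simp_all add: sqint_lebesgue_on)
  then have "sqnorm lebesgue (zero_ext K f) \<le> sqnorm lebesgue (zero_ext L f)"
    unfolding sqnorm_def sqint_def using assms(3) by (intro integral_mono) (auto split: split_indicator)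
  then show ?thesis using assms by (simp add: sqnorm_lebesgue_on)
qed

lemma sqlim_subset:
  assumes K: "K \<in> sets lebesgue" "L \<in> sets lebesgue" "K \<subseteq> L" and F: "sqlim (lebesgue_on L) F f"
  shows "sqlim (lebesgue_on K) F f"
proof -
  have "(\<lambda>n. sqnorm (lebesgue_on K) (\<lambda>x. F n x - f x)) \<longlonglongrightarrow> 0"
  proof (rule Lim_null_comparison)
    show "\<forall>\<^sub>F n in sequentially. norm (sqnorm (lebesgue_on K) (\<lambda>x. F n x - f x))
      \<le> sqnorm (lebesgue_on L) (\<lambda>x. F n x - f x)"
      using F by (intro always_eventually allI)
        (simp add: sqnorm_nonneg, intro sqnorm_subset K sqint_diff, auto simp: sqlim_def)
  qed (use F in \<open>simp add: sqlim_def\<close>)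
  with F show ?thesis unfolding sqlim_def using sqint_subset[OF K] by blast
qed

lemma sqlim_lebesgue_restrict:
  assumes "K \<in> sets lebesgue" "sqlim lebesgue F f" shows "sqlim (lebesgue_on K) F f"
  by (rule sqlim_subset[of K UNIV]) (use assms in \<open>auto simp: lebesgue_on_UNIV_eq\<close>)

lemma sqlim_cong_AE:
  assumes F: "sqlim M F f" and ae: "AE x in M. f x = g x" and g: "g \<in> borel_measurable M"
  shows "sqlim M F g"
proof -
  have gi: "sqint M g" by (rule sqint_cong_AE[OF _ ae g]) (use F in \<open>simp add: sqlim_def\<close>)
  have "sqnorm M (\<lambda>x. F n x - f x) = sqnorm M (\<lambda>x. F n x - g x)" for n
  proof (rule sqnorm_cong_AE)
    show "AE x in M. F n x - f x = F n x - g x" using ae by eventually_elim simp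
    have "F n \<in> borel_measurable M" "f \<in> borel_measurable M" using F by (auto simp: sqlim_def sqint_def)
    with g show "(\<lambda>x. F n x - f x) \<in> borel_measurable M" "(\<lambda>x. F n x - g x) \<in> borel_measurable M"
      by simp_all
  qed
  with F gi show ?thesis by (simp add: sqlim_def)
qed

lemma integral_lebesgue_on_subset:
  fixes f :: "real ^ 'n \<Rightarrow> complex"
  assumes "K \<in> sets lebesgue" "L \<in> sets lebesgue" "K \<subseteq> L" "\<And>x. x \<in> L - K \<Longrightarrow> f x = 0"
  shows "integral\<^sup>L (lebesgue_on L) f = integral\<^sup>L (lebesgue_on K) f"
proof -
  have "zero_ext L f = zero_ext K f" using assms(3,4) by (auto simp: fun_eq_iff split: split_indicator)
  then show ?thesis using assms by (simp add: integral_lebesgue_on)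
qed

lemma integrable_lebesgue_on_subset:
  fixes f :: "real ^ 'n \<Rightarrow> complex"
  assumes "K \<in> sets lebesgue" "L \<in> sets lebesgue" "K \<subseteq> L" "\<And>x. x \<in> L - K \<Longrightarrow> f x = 0"
  shows "integrable (lebesgue_on L) f \<longleftrightarrow> integrable (lebesgue_on K) f"
proof -
  have "zero_ext L f = zero_ext K f" using assms(3,4) by (auto simp: fun_eq_iff split: split_indicator)
  then show ?thesis using assms by (simp add: integrable_lebesgue_on)
qed

lemma compact_lebesgue: "compact K \<Longrightarrow> K \<in> sets (lebesgue :: (real ^ 'n) measure)"
  using lmeasurable_compact fmeasurableD by blast

lemma open_lebesgue: "open K \<Longrightarrow> K \<in> sets (lebesgue :: (real ^ 'n) measure)"
  by (simp add: borel_open)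

lemma compact_cball_ex: "compact K \<Longrightarrow> \<exists>R. K \<subseteq> cball (0 :: real ^ 'n) R"
  using compact_imp_bounded[of K] unfolding bounded_iff by (auto simp: subset_iff)

lemma L2loc_sqint: "u \<in> L2loc \<Omega> \<Longrightarrow> compact K \<Longrightarrow> K \<subseteq> \<Omega> \<Longrightarrow> sqint (lebesgue_on K) u"
  by (simp add: L2loc_def L2_iff)

lemma L2_L2loc: "open \<Omega> \<Longrightarrow> u \<in> L2 \<Omega> \<Longrightarrow> u \<in> L2loc \<Omega>"
  unfolding L2loc_def L2_iff using sqint_subset compact_lebesgue open_lebesgue by blast

lemma sqint_integrable:
  fixes u :: "real ^ 'n \<Rightarrow> complex"
  assumes "compact K" "sqint (lebesgue_on K) u" shows "integrable (lebesgue_on K) u"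
proof -
  obtain R where R: "K \<subseteq> cball 0 R" using compact_cball_ex[OF assms(1)] by blast
  have "sqint lebesgue (zero_ext K u)" using assms by (simp add: sqint_lebesgue_on compact_lebesgue)
  then have "integrable lebesgue (zero_ext K u)"
    by (rule integrable_of_sqint_bounded_support[of _ R]) (use R in \<open>auto simp: indicator_def\<close>)
  then show ?thesis using assms by (simp add: integrable_lebesgue_on compact_lebesgue)
qed

lemma L2loc_L1loc: "u \<in> L2loc \<Omega> \<Longrightarrow> u \<in> L1loc \<Omega>"
  by (simp add: L1loc_def L2loc_sqint sqint_integrable)

lemma L1loc_mult:
  "f \<in> L2loc \<Omega> \<Longrightarrow> g \<in> L2loc \<Omega> \<Longrightarrow> (\<lambda>x. f x * g x) \<in> L1loc \<Omega>"
  unfolding L1loc_def by (auto intro: sqint_mult_integrable L2loc_sqint)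

lemma L1loc_add: "f \<in> L1loc \<Omega> \<Longrightarrow> g \<in> L1loc \<Omega> \<Longrightarrow> (\<lambda>x. f x + g x) \<in> L1loc \<Omega>"
  unfolding L1loc_def by auto

lemma L1loc_cmult: "f \<in> L1loc \<Omega> \<Longrightarrow> (\<lambda>x. c * f x) \<in> L1loc \<Omega>"
  unfolding L1loc_def by auto

lemma L1loc_test_integrable:
  fixes f :: "real ^ 'n \<Rightarrow> complex"
  assumes \<Omega>: "open \<Omega>" and f: "f \<in> L1loc \<Omega>" and p: "\<phi> \<in> test_functions \<Omega>"
  shows "integrable (lebesgue_on \<Omega>) (\<lambda>x. f x * \<phi> x)"
proof -
  let ?K = "supp \<phi>"
  have K: "compact ?K" "?K \<subseteq> \<Omega>" using p by (auto simp: test_functions_iff)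
  obtain B where B: "0 < B" "\<And>x. norm (\<phi> x) \<le> B" using test_functions_bounded[OF p] by metis
  have fi: "integrable (lebesgue_on ?K) f" using f K by (simp add: L1loc_def)
  have pm: "\<phi> \<in> borel_measurable (lebesgue_on ?K)"
    using p by (intro measurable_restrict_space1 borel_measurable_lebesgue_continuous smooth_continuous)
      (simp add: test_functions_iff)
  have "integrable (lebesgue_on ?K) (\<lambda>x. f x * \<phi> x)"
  proof (rule Bochner_Integration.integrable_bound)
    show "integrable (lebesgue_on ?K) (\<lambda>x. B * norm (f x))" using fi by simp
    show "AE x in lebesgue_on ?K. norm (f x * \<phi> x) \<le> norm (B * norm (f x))"
    proof (rule AE_I2)
      fix x
      have "norm (f x) * norm (\<phi> x) \<le> norm (f x) * B" by (intro mult_left_mono B) simp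
      with B(1) show "norm (f x * \<phi> x) \<le> norm (B * norm (f x))"
        by (simp add: norm_mult abs_mult mult.commute)
    qed
  qed (use fi pm in simp)
  then show ?thesis
    by (subst integrable_lebesgue_on_subset[of ?K])
       (use K \<Omega> in \<open>auto simp: compact_lebesgue open_lebesgue zero_off_supp\<close>)
qed

lemma L1loc_measurable:
  fixes f :: "real ^ 'n \<Rightarrow> complex"
  assumes \<Omega>: "open \<Omega>" and f: "f \<in> L1loc \<Omega>"
  shows "f \<in> borel_measurable (lebesgue_on \<Omega>)"
proof -
  obtain C where C: "\<And>n. compact (C n)" "\<And>n. C n \<subseteq> \<Omega>" "\<And>n. C n \<subseteq> interior (C (Suc n))" "\<Union>(range C) = \<Omega>"
    using open_Union_compact_subsets[OF \<Omega>] by metis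
  have mono: "incseq C" by (rule incseq_SucI) (use C(3) interior_subset in blast)
  have "zero_ext \<Omega> f \<in> borel_measurable lebesgue"
  proof (rule borel_measurable_LIMSEQ_metric)
    fix n
    have "integrable (lebesgue_on (C n)) f" using f C(1,2) by (simp add: L1loc_def)
    then have "f \<in> borel_measurable (lebesgue_on (C n))" by simp
    then show "zero_ext (C n) f \<in> borel_measurable lebesgue"
      using C(1) by (subst (asm) borel_measurable_restrict_space_iff) (auto simp: compact_lebesgue)
  next
    fix x
    have "eventually (\<lambda>n. zero_ext (C n) f x = zero_ext \<Omega> f x) sequentially"
    proof (cases "x \<in> \<Omega>")
      case True
      then obtain m where m: "x \<in> C m" using C(4) by blast
      show ?thesis unfolding eventually_sequentially
      proof (intro exI allI impI)
        fix n assume "m \<le> n"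
        then have "x \<in> C n" using m mono by (auto simp: incseq_def)
        with True show "zero_ext (C n) f x = zero_ext \<Omega> f x" by simp
      qed
    next
      case False
      then have "x \<notin> C n" for n using C(2) by blast
      with False show ?thesis by simp
    qed
    then show "(\<lambda>n. zero_ext (C n) f x) \<longlonglongrightarrow> zero_ext \<Omega> f x" by (rule tendsto_eventually)
  qed
  then show ?thesis using \<Omega> by (subst borel_measurable_restrict_space_iff) (auto simp: open_lebesgue)
qed

section \<open>Weak derivatives\<close>

lemma is_weak_partial_classical:
  fixes f :: "real ^ 'n \<Rightarrow> complex"
  assumes \<Omega>: "open \<Omega>" and d: "\<And>x. f differentiable (at x)" and c: "continuous_on UNIV (partial k f)"
  shows "is_weak_partial \<Omega> k f (partial k f)"
proof -
  have cf: "continuous_on UNIV f"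
    using d by (meson continuous_at_imp_continuous_on differentiable_imp_continuous_within)
  have L: "h \<in> L1loc \<Omega>" if h: "continuous_on UNIV h" for h :: "real ^ 'n \<Rightarrow> complex"
    unfolding L1loc_def
  proof (intro CollectI allI impI)
    fix K :: "(real ^ 'n) set" assume K: "compact K \<and> K \<subseteq> \<Omega>"
    have "integrable lborel (zero_ext K h)"
      by (rule borel_integrable_compact) (use K h continuous_on_subset in auto)
    moreover have "zero_ext K h \<in> borel_measurable borel"
      using K h by (intro borel_measurable_scaleR borel_measurable_indicator borel_measurable_continuous_onI)
        (auto simp: borel_compact)
    ultimately have "integrable lebesgue (zero_ext K h)" by (simp add: integrable_completion)
    then show "integrable (lebesgue_on K) h" using K by (simp add: integrable_lebesgue_on compact_lebesgue)
  qed
  show ?thesis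
    unfolding is_weak_partial_def
  proof (intro conjI ballI)
    show Lf: "f \<in> L1loc \<Omega>" "partial k f \<in> L1loc \<Omega>" by (auto intro: L cf c)
    fix \<phi> assume p: "\<phi> \<in> test_functions \<Omega>"
    then have s: "smooth \<phi>" "compact (supp \<phi>)" "supp \<phi> \<subseteq> \<Omega>" by (auto simp: test_functions_iff)
    have eq: "partial k (\<lambda>x. f x * \<phi> x) = (\<lambda>x. f x * partial k \<phi> x + partial k f x * \<phi> x)"
      using partial_mult[OF d smooth_differentiable[OF s(1)]] by blast
    have "(LINT x|lebesgue. partial k (\<lambda>x. f x * \<phi> x) x) = 0"
    proof (rule integral_partial_eq_0)
      show "(\<lambda>x. f x * \<phi> x) differentiable (at x)" for x
        by (intro differentiable_mult d smooth_differentiable s)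
      show "continuous_on UNIV (partial k (\<lambda>x. f x * \<phi> x))"
        unfolding eq by (intro continuous_on_add continuous_on_mult cf c smooth_continuous smooth_partial s)
      show "compact (supp (\<lambda>x. f x * \<phi> x))" by (rule compact_supp[OF s(2)]) (simp add: zero_off_supp)
    qed
    moreover have "zero_ext \<Omega> (\<lambda>x. f x * partial k \<phi> x + partial k f x * \<phi> x) =
        (\<lambda>x. f x * partial k \<phi> x + partial k f x * \<phi> x)"
    proof
      fix x show "zero_ext \<Omega> (\<lambda>x. f x * partial k \<phi> x + partial k f x * \<phi> x) x =
        f x * partial k \<phi> x + partial k f x * \<phi> x"
    proof (cases "x \<in> \<Omega>")
      case False
      then have "x \<notin> supp \<phi>" using s(3) by blast
      then show ?thesis by (simp add: zero_off_supp partial_zero_off_supp)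
    qed simp
    qed
    ultimately have "(LINT x|lebesgue_on \<Omega>. f x * partial k \<phi> x + partial k f x * \<phi> x) = 0"
      using \<Omega> by (simp add: integral_lebesgue_on open_lebesgue eq)
    then show "(LINT x|lebesgue_on \<Omega>. f x * partial k \<phi> x) = - (LINT x|lebesgue_on \<Omega>. partial k f x * \<phi> x)"
      by (subst (asm) Bochner_Integration.integral_add)
         (auto intro: L1loc_test_integrable \<Omega> Lf p test_functions_partial simp: eq_neg_iff_add_eq_0)
  qed
qed

lemma is_weak_partial_test:
  "open \<Omega> \<Longrightarrow> smooth f \<Longrightarrow> is_weak_partial \<Omega> k f (partial k f)"
  by (rule is_weak_partial_classical)
     (auto intro: smooth_differentiable smooth_continuous smooth_partial)

lemma is_weak_partial_add:
  assumes \<Omega>: "open \<Omega>" and 1: "is_weak_partial \<Omega> k f g" and 2: "is_weak_partial \<Omega> k f' g'"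
  shows "is_weak_partial \<Omega> k (\<lambda>x. f x + f' x) (\<lambda>x. g x + g' x)"
  unfolding is_weak_partial_def
proof (intro conjI ballI)
  fix \<phi> assume p: "\<phi> \<in> test_functions \<Omega>"
  note i = L1loc_test_integrable[OF \<Omega> _ p] L1loc_test_integrable[OF \<Omega> _ test_functions_partial[OF p]]
  show "(LINT x|lebesgue_on \<Omega>. (f x + f' x) * partial k \<phi> x) = - (LINT x|lebesgue_on \<Omega>. (g x + g' x) * \<phi> x)"
    using 1 2 p by (simp add: distrib_right is_weak_partial_def i)
qed (use 1 2 in \<open>auto simp: is_weak_partial_def L1loc_add\<close>)

lemma is_weak_partial_cmult:
  assumes "is_weak_partial \<Omega> k f g" shows "is_weak_partial \<Omega> k (\<lambda>x. c * f x) (\<lambda>x. c * g x)"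
  using assms by (simp add: is_weak_partial_def L1loc_cmult mult.assoc)

lemma is_weak_partial_diff:
  assumes \<Omega>: "open \<Omega>" and 1: "is_weak_partial \<Omega> k f g" and 2: "is_weak_partial \<Omega> k f' g'"
  shows "is_weak_partial \<Omega> k (\<lambda>x. f x - f' x) (\<lambda>x. g x - g' x)"
  using is_weak_partial_add[OF \<Omega> 1 is_weak_partial_cmult[OF 2, of "-1"]] by simp

lemma is_weak_partial_subset:
  assumes \<Omega>: "open \<Omega>" "open \<Omega>'" "\<Omega>' \<subseteq> \<Omega>" and 1: "is_weak_partial \<Omega> k f g"
  shows "is_weak_partial \<Omega>' k f g"
  unfolding is_weak_partial_def
proof (intro conjI ballI)
  show "f \<in> L1loc \<Omega>'" "g \<in> L1loc \<Omega>'" using 1 \<Omega>(3) unfolding is_weak_partial_def L1loc_def by auto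
  fix \<phi> assume p: "\<phi> \<in> test_functions \<Omega>'"
  then have p': "\<phi> \<in> test_functions \<Omega>" using \<Omega>(3) test_functions_mono by blast
  have z: "\<phi> x = 0" "partial k \<phi> x = 0" if "x \<in> \<Omega> - \<Omega>'" for x
    using p that zero_off_supp[of x \<phi>] partial_zero_off_supp[of x \<phi> k] by (auto simp: test_functions_iff)
  have "(LINT x|lebesgue_on \<Omega>. h x * \<psi> x) = (LINT x|lebesgue_on \<Omega>'. h x * \<psi> x)"
    if "\<And>x. x \<in> \<Omega> - \<Omega>' \<Longrightarrow> \<psi> x = 0" for h \<psi> :: "real ^ 'a \<Rightarrow> complex"
    by (rule integral_lebesgue_on_subset) (use \<Omega> that in \<open>auto simp: open_lebesgue\<close>)
  note e = this[of "partial k \<phi>" f, OF z(2)] this[of \<phi> g, OF z(1)]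
  show "(LINT x|lebesgue_on \<Omega>'. f x * partial k \<phi> x) = - (LINT x|lebesgue_on \<Omega>'. g x * \<phi> x)"
    using 1 p' e unfolding is_weak_partial_def by simp
qed

lemma is_weak_partial_Re:
  fixes f :: "real ^ 'n \<Rightarrow> complex"
  assumes \<Omega>: "open \<Omega>" and 1: "is_weak_partial \<Omega> k f g"
  shows "is_weak_partial \<Omega> k (\<lambda>x. complex_of_real (Re (f x))) (\<lambda>x. complex_of_real (Re (g x)))"
  unfolding is_weak_partial_def
proof (intro conjI ballI)
  show L: "(\<lambda>x. complex_of_real (Re (f x))) \<in> L1loc \<Omega>" "(\<lambda>x. complex_of_real (Re (g x))) \<in> L1loc \<Omega>"
    using 1 unfolding is_weak_partial_def L1loc_def by (auto intro!: integrable_of_real integrable_Re)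
  have real: "(LINT x|lebesgue_on \<Omega>. complex_of_real (Re (f x)) * partial k (\<lambda>x. complex_of_real (Re (\<psi> x))) x)
     = - (LINT x|lebesgue_on \<Omega>. complex_of_real (Re (g x)) * complex_of_real (Re (\<psi> x)))"
    if q: "\<psi> \<in> test_functions \<Omega>" for \<psi>
  proof -
    let ?r = "\<lambda>x. complex_of_real (Re (\<psi> x))"
    have sm: "smooth \<psi>" "compact (supp \<psi>)" "supp \<psi> \<subseteq> \<Omega>" using q by (auto simp: test_functions_iff)
    have "supp ?r \<subseteq> supp \<psi>" by (rule supp_subset[OF closed_supp]) (simp add: zero_off_supp)
    moreover have "compact (supp ?r)" by (rule compact_supp[OF sm(2)]) (simp add: zero_off_supp)
    ultimately have r: "?r \<in> test_functions \<Omega>" using sm by (auto simp: test_functions_iff smooth_Re)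
    have pr: "partial k ?r = (\<lambda>x. complex_of_real (Re (partial k \<psi> x)))"
      using partial_Re[OF smooth_differentiable[OF sm(1)]] by blast
    have "Re (LINT x|lebesgue_on \<Omega>. f x * partial k ?r x) = (LINT x|lebesgue_on \<Omega>. Re (f x * partial k ?r x))"
      by (rule integral_Re[symmetric]) (use 1 in \<open>auto intro: L1loc_test_integrable \<Omega> test_functions_partial r simp: is_weak_partial_def\<close>)
    moreover have "Re (LINT x|lebesgue_on \<Omega>. g x * ?r x) = (LINT x|lebesgue_on \<Omega>. Re (g x * ?r x))"
      by (rule integral_Re[symmetric]) (use 1 in \<open>auto intro: L1loc_test_integrable \<Omega> r simp: is_weak_partial_def\<close>)
    moreover have "(LINT x|lebesgue_on \<Omega>. f x * partial k ?r x) = - (LINT x|lebesgue_on \<Omega>. g x * ?r x)"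
      using 1 r unfolding is_weak_partial_def by blast
    ultimately have "(LINT x|lebesgue_on \<Omega>. Re (f x) * Re (partial k \<psi> x)) = - (LINT x|lebesgue_on \<Omega>. Re (g x) * Re (\<psi> x))"
      by (simp add: pr)
    then show ?thesis
      unfolding pr of_real_mult[symmetric] integral_complex_of_real by simp
  qed
  fix \<phi> assume p: "\<phi> \<in> test_functions \<Omega>"
  have q: "(\<lambda>x. (- \<i>) * \<phi> x) \<in> test_functions \<Omega>"
  proof -
    have "supp (\<lambda>x. (- \<i>) * \<phi> x) = supp \<phi>" by (simp add: supp_def)
    moreover have "smooth (\<lambda>x. (- \<i>) * \<phi> x)"
      by (rule smooth_mult[OF smooth_const]) (use p in \<open>simp add: test_functions_iff\<close>)
    ultimately show ?thesis using p unfolding test_functions_iff by simp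
  qed
  let ?R = "\<lambda>x. complex_of_real (Re (\<phi> x))" and ?I = "\<lambda>x. complex_of_real (Re ((- \<i>) * \<phi> x))"
  have dec: "\<phi> x = ?R x + \<i> * ?I x" for x by (simp add: complex_eq_iff)
  have sp: "smooth \<phi>" "smooth (\<lambda>x. (- \<i>) * \<phi> x)" using p q unfolding test_functions_iff by simp_all
  note sR = sp[THEN smooth_Re]
  have tR: "?R \<in> test_functions \<Omega>" "?I \<in> test_functions \<Omega>"
  proof -
    have s: "supp \<phi> \<subseteq> \<Omega>" "compact (supp \<phi>)" using p by (auto simp: test_functions_iff)
    have "supp ?R \<subseteq> supp \<phi>" "supp ?I \<subseteq> supp \<phi>"
      by (rule supp_subset[OF closed_supp], simp add: zero_off_supp)+
    moreover have "compact (supp ?R)" "compact (supp ?I)"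
      by (rule compact_supp[OF s(2)], simp add: zero_off_supp)+
    ultimately show "?R \<in> test_functions \<Omega>" "?I \<in> test_functions \<Omega>"
      using s sR by (auto simp: test_functions_iff simp del: mult_minus_left)
  qed
  have pd: "partial k \<phi> x = partial k ?R x + \<i> * partial k ?I x" for x
  proof -
    have "partial k \<phi> x = partial k (\<lambda>x. ?R x + \<i> * ?I x) x" using dec by (metis (no_types, lifting) ext)
    also have "\<dots> = partial k ?R x + partial k (\<lambda>x. \<i> * ?I x) x"
      by (intro partial_add smooth_differentiable sR smooth_mult smooth_const)
    also have "partial k (\<lambda>x. \<i> * ?I x) x = \<i> * partial k ?I x"
      using partial_mult[OF differentiable_const smooth_differentiable[OF sR(2)], of k \<i> x]
      by (simp add: partial_const)
    finally show ?thesis .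
  qed
  let ?f = "\<lambda>x. complex_of_real (Re (f x))" and ?g = "\<lambda>x. complex_of_real (Re (g x))"
  note i = L1loc_test_integrable[OF \<Omega> L(1) test_functions_partial[OF tR(1)]]
    L1loc_test_integrable[OF \<Omega> L(1) test_functions_partial[OF tR(2)]]
    L1loc_test_integrable[OF \<Omega> L(2) tR(1)] L1loc_test_integrable[OF \<Omega> L(2) tR(2)]
  have "(LINT x|lebesgue_on \<Omega>. ?f x * partial k \<phi> x) =
     (LINT x|lebesgue_on \<Omega>. ?f x * partial k ?R x + \<i> * (?f x * partial k ?I x))"
    unfolding pd by (simp only: distrib_left mult.left_commute)
  also have "\<dots> = (LINT x|lebesgue_on \<Omega>. ?f x * partial k ?R x) + \<i> * (LINT x|lebesgue_on \<Omega>. ?f x * partial k ?I x)"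
    using i by (simp del: mult_minus_left)
  also have "\<dots> = - ((LINT x|lebesgue_on \<Omega>. ?g x * ?R x) + \<i> * (LINT x|lebesgue_on \<Omega>. ?g x * ?I x))"
    using real[OF p] real[OF q] by (simp del: mult_minus_left)
  also have "(LINT x|lebesgue_on \<Omega>. ?g x * ?R x) + \<i> * (LINT x|lebesgue_on \<Omega>. ?g x * ?I x) =
     (LINT x|lebesgue_on \<Omega>. ?g x * ?R x + \<i> * (?g x * ?I x))"
    using i by (simp del: mult_minus_left)
  also have "(\<lambda>x. ?g x * ?R x + \<i> * (?g x * ?I x)) = (\<lambda>x. ?g x * \<phi> x)"
    by (subst (3) dec) (simp only: distrib_left mult.left_commute)
  finally show "(LINT x|lebesgue_on \<Omega>. ?f x * partial k \<phi> x) = - (LINT x|lebesgue_on \<Omega>. ?g x * \<phi> x)" .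
qed

section \<open>Local approximation by test functions\<close>

lemma compact_cball_neighbourhood:
  fixes K :: "(real ^ 'n) set"
  assumes "compact K" shows "compact (\<Union>x\<in>K. cball x r)"
proof -
  have "(\<Union>x\<in>K. cball x r) = (\<lambda>(x, y). x + y) ` (K \<times> cball 0 r)"
  proof (intro subset_antisym subsetI)
    fix z assume "z \<in> (\<Union>x\<in>K. cball x r)"
    then obtain x where "x \<in> K" "dist x z \<le> r" by auto
    then have "(x, z - x) \<in> K \<times> cball 0 r" "z = x + (z - x)" by (auto simp: dist_norm norm_minus_commute)
    then show "z \<in> (\<lambda>(x, y). x + y) ` (K \<times> cball 0 r)" by (metis (no_types, lifting) case_prod_conv imageI)
  next
    fix z assume "z \<in> (\<lambda>(x, y). x + y) ` (K \<times> cball 0 r)"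
    then obtain a b where ab: "a \<in> K" "norm b \<le> r" "z = a + b" by auto
    then have "z \<in> cball a r" by (simp add: dist_norm)
    with ab(1) show "z \<in> (\<Union>x\<in>K. cball x r)" by blast
  qed
  also have "compact \<dots>"
    by (intro compact_continuous_image compact_Times assms compact_cball)
       (auto simp: case_prod_beta intro!: continuous_intros)
  finally show ?thesis .
qed

lemma sqlim_cong:
  assumes F: "sqlim M F f" and FG: "\<And>n x. x \<in> space M \<Longrightarrow> F n x = G n x" and fg: "\<And>x. x \<in> space M \<Longrightarrow> f x = g x"
  shows "sqlim M G g"
proof -
  have c: "sqint M v \<Longrightarrow> (\<And>x. x \<in> space M \<Longrightarrow> v x = w x) \<Longrightarrow> sqint M w" for v w
    unfolding sqint_def by (simp cong: measurable_cong Bochner_Integration.integrable_cong)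
  have "sqnorm M (\<lambda>x. F n x - f x) = sqnorm M (\<lambda>x. G n x - g x)" for n
    unfolding sqnorm_def by (rule Bochner_Integration.integral_cong) (simp_all add: FG fg)
  then show ?thesis using F c[OF _ FG] c[OF _ fg] unfolding sqlim_def by simp
qed

lemma zero_ext_integrable:
  fixes f :: "real ^ 'n \<Rightarrow> complex"
  assumes "f \<in> L1loc \<Omega>" "compact K" "K \<subseteq> \<Omega>" shows "integrable lebesgue (zero_ext K f)"
  using assms by (simp add: L1loc_def integrable_lebesgue_on compact_lebesgue flip: integrable_lebesgue_on)

lemma partial_conv_weak:
  fixes f :: "real ^ 'n \<Rightarrow> complex"
  assumes \<Omega>: "open \<Omega>" and w: "is_weak_partial \<Omega> k f g" and K: "compact K" "K \<subseteq> \<Omega>"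
    and \<rho>: "\<rho> \<in> test_functions UNIV" "supp \<rho> \<subseteq> cball 0 r" and x: "cball x r \<subseteq> K"
  shows "partial k (conv (zero_ext K f) \<rho>) x = conv (zero_ext K g) \<rho> x"
proof -
  let ?\<psi> = "\<lambda>y. \<rho> (x - y)"
  have L: "f \<in> L1loc \<Omega>" "g \<in> L1loc \<Omega>" using w by (auto simp: is_weak_partial_def)
  have sm: "smooth \<rho>" using \<rho> by (simp add: test_functions_iff)
  have far: "x - y \<notin> supp \<rho>" if "y \<notin> cball x r" for y
    using subsetD[OF \<rho>(2), of "x - y"] that by (auto simp: dist_norm norm_minus_commute)
  have z: "?\<psi> y = 0" "partial k \<rho> (x - y) = 0" if "y \<notin> cball x r" for y
    using far[OF that] by (simp_all add: zero_off_supp partial_zero_off_supp)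
  have "supp ?\<psi> \<subseteq> cball x r" by (rule supp_subset[OF closed_cball]) (rule z(1))
  moreover have "compact (supp ?\<psi>)" by (rule compact_supp[OF compact_cball]) (rule z(1))
  ultimately have \<psi>: "?\<psi> \<in> test_functions \<Omega>"
    using x K(2) smooth_reflect[OF sm] by (auto simp: test_functions_iff)
  have on: "(LINT y|lebesgue. zero_ext K h y * q (x - y)) = (LINT y|lebesgue_on \<Omega>. h y * q (x - y))"
    if "\<And>y. y \<notin> cball x r \<Longrightarrow> q (x - y) = 0" for h q :: "real ^ 'n \<Rightarrow> complex"
  proof -
    have "(LINT y|lebesgue_on \<Omega>. h y * q (x - y)) = (LINT y|lebesgue_on K. h y * q (x - y))"
    proof (rule integral_lebesgue_on_subset)
      fix y assume "y \<in> \<Omega> - K"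
      then have "y \<notin> cball x r" using x by blast
      then show "h y * q (x - y) = 0" using that by simp
    qed (use K \<Omega> in \<open>auto simp: compact_lebesgue open_lebesgue\<close>)
    also have "\<dots> = (LINT y|lebesgue. zero_ext K h y * q (x - y))"
      using K by (simp add: integral_lebesgue_on compact_lebesgue)
    finally show ?thesis by simp
  qed
  have "partial k (conv (zero_ext K f) \<rho>) x = conv (zero_ext K f) (partial k \<rho>) x"
    by (simp add: partial_conv[OF zero_ext_integrable[OF L(1) K] \<rho>(1)])
  also have "\<dots> = (LINT y|lebesgue_on \<Omega>. f y * partial k \<rho> (x - y))"
    unfolding conv_def by (rule on) (rule z(2))
  also have "\<dots> = - (LINT y|lebesgue_on \<Omega>. f y * partial k ?\<psi> y)"
    by (simp add: partial_reflect[OF sm])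
  also have "\<dots> = (LINT y|lebesgue_on \<Omega>. g y * ?\<psi> y)"
    using w \<psi> unfolding is_weak_partial_def by simp
  also have "\<dots> = conv (zero_ext K g) \<rho> x"
    unfolding conv_def by (rule on[symmetric]) (rule z(1))
  finally show ?thesis .
qed

lemma supp_mollifier:
  "supp (\<lambda>x :: real ^ 'n. complex_of_real (mollifier n x)) \<subseteq> cball 0 (1 / real (Suc n))"
  by (rule supp_subset) (simp_all add: mollifier_outside del: of_nat_Suc)

lemma sqlim_mollify_zero_ext:
  fixes f :: "real ^ 'n \<Rightarrow> complex"
  assumes K: "compact K" and f: "sqint (lebesgue_on K) f"
  shows "sqlim lebesgue (\<lambda>n. mollify n (zero_ext K f)) (zero_ext K f)"
proof -
  obtain R where R: "K \<subseteq> cball 0 R" using compact_cball_ex[OF K] by blast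
  show ?thesis
    by (rule sqlim_mollify[where R = R])
       (use f K R in \<open>auto simp: sqint_lebesgue_on compact_lebesgue split: split_indicator\<close>)
qed

lemma inverse_Suc_le:
  assumes "0 < (r :: real)" obtains N where "\<And>n. 1 / real (Suc (n + N)) \<le> r"
proof -
  obtain N where N: "inverse (real (Suc N)) < r" using reals_Archimedean[OF assms] by blast
  have "1 / real (Suc (n + N)) \<le> r" for n
  proof -
    have "1 / real (Suc (n + N)) \<le> 1 / real (Suc N)" by (intro divide_left_mono) auto
    with N show ?thesis by (simp add: inverse_eq_divide)
  qed
  with that show ?thesis by blast
qed

lemma local_approximation:
  fixes f :: "real ^ 'n \<Rightarrow> complex"
  assumes \<Omega>: "open \<Omega>" and K: "compact K" "K \<subseteq> \<Omega>" and f: "f \<in> L2loc \<Omega>" and g: "\<And>k. g k \<in> L2loc \<Omega>"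
    and w: "\<And>k. is_weak_partial \<Omega> k f (g k)"
  obtains \<phi> where "\<And>n. \<phi> n \<in> test_functions UNIV" "sqlim (lebesgue_on K) \<phi> f"
    "\<And>k. sqlim (lebesgue_on K) (\<lambda>n. partial k (\<phi> n)) (g k)"
proof -
  obtain r where r: "0 < r" "(\<Union>x\<in>K. cball x r) \<subseteq> \<Omega>"
    using compact_subset_open_imp_cball_epsilon_subset[OF K(1) \<Omega> K(2)] by metis
  define K1 where "K1 = (\<Union>x\<in>K. cball x r)"
  have K1: "compact K1" "K1 \<subseteq> \<Omega>" unfolding K1_def using compact_cball_neighbourhood[OF K(1)] r by simp_all
  have sub: "K \<subseteq> K1" using r(1) by (auto simp: K1_def intro!: bexI)
  obtain N where N: "\<And>n. 1 / real (Suc (n + N)) \<le> r" using inverse_Suc_le[OF r(1)] by metis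
  have sN: "strict_mono (\<lambda>n. n + N)" by (simp add: strict_mono_def)
  define \<phi> where "\<phi> = (\<lambda>n. mollify (n + N) (zero_ext K1 f))"
  have *: "sqlim (lebesgue_on K) (\<lambda>n. mollify (n + N) (zero_ext K1 h)) (zero_ext K1 h)" if "h \<in> L2loc \<Omega>" for h
    using sqlim_subseq[OF sqlim_mollify_zero_ext[OF K1(1) L2loc_sqint[OF that K1]] sN]
    by (intro sqlim_lebesgue_restrict compact_lebesgue K)
  have K1_eq: "zero_ext K1 h x = h x" if "x \<in> space (lebesgue_on K)" for h x using that sub by auto
  show ?thesis
  proof (rule that)
    show "\<phi> n \<in> test_functions UNIV" for n
    proof -
      obtain R where R: "K1 \<subseteq> cball 0 R" using compact_cball_ex[OF K1(1)] by blast
      show ?thesis unfolding \<phi>_def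
        by (rule mollify_test[where R = R])
           (use R in \<open>auto intro!: zero_ext_integrable[OF L2loc_L1loc[OF f] K1] split: split_indicator\<close>)
    qed
    show "sqlim (lebesgue_on K) \<phi> f" unfolding \<phi>_def by (rule sqlim_cong[OF *[OF f]]) (rule refl, erule K1_eq)
    show "sqlim (lebesgue_on K) (\<lambda>n. partial k (\<phi> n)) (g k)" for k
    proof (rule sqlim_cong[OF *[OF g[of k]]])
      show "zero_ext K1 (g k) x = g k x" if "x \<in> space (lebesgue_on K)" for x using that by (rule K1_eq)
      fix n x assume "x \<in> space (lebesgue_on K)"
      then have x: "cball x r \<subseteq> K1" by (auto simp: K1_def)
      show "mollify (n + N) (zero_ext K1 (g k)) x = partial k (\<phi> n) x"
        unfolding \<phi>_def
      proof (rule partial_conv_weak[OF \<Omega> w K1 mollifier_test _ x, symmetric])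
        show "supp (\<lambda>x :: real ^ 'n. complex_of_real (mollifier (n + N) x)) \<subseteq> cball 0 r"
          by (rule order_trans[OF supp_mollifier subset_cball]) (rule N)
      qed
    qed
  qed
qed

lemma compact_approximation:
  fixes f :: "real ^ 'n \<Rightarrow> complex"
  assumes \<Omega>: "open \<Omega>" and K: "compact K" "K \<subseteq> \<Omega>" and f: "f \<in> L2loc \<Omega>" and g: "\<And>k. g k \<in> L2loc \<Omega>"
    and w: "\<And>k. is_weak_partial \<Omega> k f (g k)"
    and f0: "AE x in lebesgue_on \<Omega>. x \<notin> K \<longrightarrow> f x = 0" and g0: "\<And>k. AE x in lebesgue_on \<Omega>. x \<notin> K \<longrightarrow> g k x = 0"
  obtains \<phi> K' where "compact K'" "K' \<subseteq> \<Omega>" "K \<subseteq> K'" "\<And>n. \<phi> n \<in> test_functions \<Omega>" "\<And>n. supp (\<phi> n) \<subseteq> K'"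
    "sqlim (lebesgue_on \<Omega>) \<phi> f" "\<And>k. sqlim (lebesgue_on \<Omega>) (\<lambda>n. partial k (\<phi> n)) (g k)"
proof -
  obtain r' where r': "0 < r'" "(\<Union>x\<in>K. cball x r') \<subseteq> \<Omega>"
    using compact_subset_open_imp_cball_epsilon_subset[OF K(1) \<Omega> K(2)] by metis
  define r where "r = r' / 2"
  have r: "0 < r" "r' = r + r" using r' by (auto simp: r_def)
  define K1 where "K1 = (\<Union>x\<in>K. cball x r')"
  define K2 where "K2 = (\<Union>x\<in>K. cball x r)"
  have K1: "compact K1" "K1 \<subseteq> \<Omega>" unfolding K1_def using compact_cball_neighbourhood[OF K(1)] r' by simp_all
  have K2: "compact K2" "K2 \<subseteq> K1" unfolding K1_def K2_def using compact_cball_neighbourhood[OF K(1)] r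
    by (auto intro!: bexI)
  have sub: "K \<subseteq> K1" using r'(1) by (auto simp: K1_def intro!: bexI)
  obtain N where N: "\<And>n. 1 / real (Suc (n + N)) \<le> r" using inverse_Suc_le[OF r(1)] by metis
  have sN: "strict_mono (\<lambda>n. n + N)" by (simp add: strict_mono_def)
  define \<phi> where "\<phi> = (\<lambda>n. mollify (n + N) (zero_ext K1 f))"
  have supp_r: "supp (\<lambda>x :: real ^ 'n. complex_of_real (mollifier (n + N) x)) \<subseteq> cball 0 r" for n
    by (rule order_trans[OF supp_mollifier subset_cball]) (rule N)
  note int = zero_ext_integrable[OF L2loc_L1loc K1]
  have AE1: "AE y in lebesgue. zero_ext K1 h y = zero_ext K h y"
    if "AE x in lebesgue_on \<Omega>. x \<notin> K \<longrightarrow> h x = 0" for h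
  proof -
    have "AE x in lebesgue. x \<in> \<Omega> \<longrightarrow> x \<notin> K \<longrightarrow> h x = 0" using that \<Omega> by (simp add: AE_lebesgue_on open_lebesgue)
    then show ?thesis by eventually_elim (use sub K1 in \<open>auto split: split_indicator\<close>)
  qed
  have far: "conv (zero_ext K1 h) q x = 0"
    if h: "h \<in> L2loc \<Omega>" and h0: "AE x in lebesgue_on \<Omega>. x \<notin> K \<longrightarrow> h x = 0"
      and q: "q \<in> test_functions UNIV" "supp q \<subseteq> cball 0 r" and x: "x \<notin> K2" for h q x
  proof -
    have "conv (zero_ext K1 h) q x = (LINT y|(lebesgue :: (real ^ 'n) measure). 0)"
      unfolding conv_def
    proof (rule integral_cong_AE)
      show "(\<lambda>y. zero_ext K1 h y * q (x - y)) \<in> borel_measurable lebesgue"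
        using conv_integrable[OF int[OF h] q(1)] by (rule borel_measurable_integrable)
      show "AE y in lebesgue. zero_ext K1 h y * q (x - y) = 0"
        using AE1[OF h0]
      proof eventually_elim
        case (elim y)
        show ?case
        proof (cases "y \<in> K")
          case True
          then have "x - y \<notin> cball 0 r" using x by (auto simp: K2_def dist_norm norm_minus_commute)
          then have "q (x - y) = 0" using q(2) zero_off_supp by blast
          then show ?thesis by simp
        next
          case False
          with elim have "zero_ext K1 h y = 0" by simp
          then show ?thesis by (simp only: mult_zero_left)
        qed
      qed
    qed simp
    then show ?thesis by simp
  qed
  have part: "partial k (\<phi> n) = mollify (n + N) (zero_ext K1 (g k))" for n k
  proof
    fix x
    show "partial k (\<phi> n) x = mollify (n + N) (zero_ext K1 (g k)) x"
    proof (cases "x \<in> K2")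
      case True
      then obtain z where z: "z \<in> K" "dist z x \<le> r" by (auto simp: K2_def)
      have "cball x r \<subseteq> K1"
      proof
        fix y assume "y \<in> cball x r"
        then have "dist z y \<le> r'" using z(2) dist_triangle[of z y x] r(2) by simp
        with z(1) show "y \<in> K1" by (auto simp: K1_def)
      qed
      then show ?thesis unfolding \<phi>_def by (rule partial_conv_weak[OF \<Omega> w K1 mollifier_test supp_r])
    next
      case False
      have "partial k (\<phi> n) x = conv (zero_ext K1 f) (partial k (\<lambda>x. complex_of_real (mollifier (n + N) x))) x"
        by (simp add: \<phi>_def partial_conv[OF int[OF f] mollifier_test])
      also have "\<dots> = 0"
        using order_trans[OF supp_partial supp_r] by (rule far[OF f f0 test_functions_partial[OF mollifier_test] _ False])
      also have "0 = mollify (n + N) (zero_ext K1 (g k)) x"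
        by (rule far[OF g g0 mollifier_test supp_r False, symmetric])
      finally show ?thesis .
    qed
  qed
  have lim: "sqlim (lebesgue_on \<Omega>) (\<lambda>n. mollify (n + N) (zero_ext K1 h)) h"
    if h: "h \<in> L2loc \<Omega>" and h0: "AE x in lebesgue_on \<Omega>. x \<notin> K \<longrightarrow> h x = 0" for h
  proof (rule sqlim_cong_AE)
    show "sqlim (lebesgue_on \<Omega>) (\<lambda>n. mollify (n + N) (zero_ext K1 h)) (zero_ext K1 h)"
      using sqlim_subseq[OF sqlim_mollify_zero_ext[OF K1(1) L2loc_sqint[OF h K1]] sN]
      by (intro sqlim_lebesgue_restrict open_lebesgue \<Omega>)
    show "AE x in lebesgue_on \<Omega>. zero_ext K1 h x = h x"
      using h0 by eventually_elim (use sub in \<open>auto split: split_indicator\<close>)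
    show "h \<in> borel_measurable (lebesgue_on \<Omega>)" using L1loc_measurable[OF \<Omega> L2loc_L1loc[OF h]] .
  qed
  have supp\<phi>: "supp (\<phi> n) \<subseteq> K2" for n
    unfolding \<phi>_def
    by (rule supp_subset[OF compact_imp_closed[OF K2(1)]]) (rule far[OF f f0 mollifier_test supp_r])
  show ?thesis
  proof (rule that[of K2 \<phi>])
    show "compact K2" "K2 \<subseteq> \<Omega>" using K1 K2 by auto
    show "K \<subseteq> K2" using r(1) by (auto simp: K2_def intro!: bexI)
    show "supp (\<phi> n) \<subseteq> K2" for n by (rule supp\<phi>)
    show "\<phi> n \<in> test_functions \<Omega>" for n
    proof -
      have "compact (supp (\<phi> n))" unfolding \<phi>_def
        by (rule compact_supp[OF K2(1)]) (rule far[OF f f0 mollifier_test supp_r])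
      moreover have "smooth (\<phi> n)" unfolding \<phi>_def by (rule smooth_conv[OF int[OF f] mollifier_test])
      ultimately show ?thesis using supp\<phi>[of n] K1 K2 by (simp add: test_functions_iff)
    qed
    show "sqlim (lebesgue_on \<Omega>) \<phi> f" unfolding \<phi>_def by (rule lim[OF f f0])
    show "sqlim (lebesgue_on \<Omega>) (\<lambda>n. partial k (\<phi> n)) (g k)" for k unfolding part by (rule lim[OF g g0])
  qed
qed

section \<open>Uniqueness of weak derivatives\<close>

lemma norm_mollify_le:
  fixes v :: "real ^ 'n \<Rightarrow> complex"
  assumes v: "integrable lebesgue v" and B: "\<And>x. norm (v x) \<le> B"
  shows "norm (mollify n v x) \<le> B"
proof -
  have m: "(LINT y|distr lborel borel (\<lambda>y. x - y). mollifier n y) = (LINT y|lborel. mollifier n (x - y))"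
    by (rule integral_distr) measurable
  have i: "integrable lborel (\<lambda>y. mollifier n (x - y))"
  proof -
    have "integrable (distr lborel borel (\<lambda>y. x - y)) (mollifier n)"
      unfolding lborel_distr_reflect by (rule integrable_mollifier)
    then show ?thesis by (subst (asm) integrable_distr_eq) auto
  qed
  have "norm (mollify n v x) \<le> (LINT y|lebesgue. B * mollifier n (x - y))"
    unfolding conv_def
  proof (rule Bochner_Integration.integral_norm_bound_integral)
    show "integrable lebesgue (\<lambda>y. v y * complex_of_real (mollifier n (x - y)))"
      by (rule conv_integrable[OF v mollifier_test])
    show "integrable lebesgue (\<lambda>y. B * mollifier n (x - y))"
      using i by (subst integrable_completion) auto
    show "norm (v y * complex_of_real (mollifier n (x - y))) \<le> B * mollifier n (x - y)" for y
      using B by (simp add: norm_mult mollifier_nonneg mult_right_mono)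
  qed
  also have "\<dots> = B * (LINT y|lborel. mollifier n (x - y))" using i by (subst integral_completion) auto
  also have "\<dots> = B" unfolding m[symmetric] lborel_distr_reflect by (simp add: integral_mollifier)
  finally show ?thesis .
qed

lemma AE_zero_of_test_integrals:
  fixes h :: "real ^ 'n \<Rightarrow> complex"
  assumes \<Omega>: "open \<Omega>" and h: "h \<in> L1loc \<Omega>" and 0: "\<And>\<phi>. \<phi> \<in> test_functions \<Omega> \<Longrightarrow> (LINT x|lebesgue_on \<Omega>. h x * \<phi> x) = 0"
  shows "AE x in lebesgue_on \<Omega>. h x = 0"
proof -
  have local: "AE x in lebesgue. x \<in> K \<longrightarrow> h x = 0" if K: "compact K" "K \<subseteq> \<Omega>" for K
  proof -
    obtain r where r: "0 < r" "(\<Union>x\<in>K. cball x r) \<subseteq> \<Omega>"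
      using compact_subset_open_imp_cball_epsilon_subset[OF K(1) \<Omega> K(2)] by metis
    define K1 where "K1 = (\<Union>x\<in>K. cball x r)"
    have K1: "compact K1" "K1 \<subseteq> \<Omega>" unfolding K1_def using compact_cball_neighbourhood[OF K(1)] r by simp_all
    have sub: "K \<subseteq> K1" using r(1) by (auto simp: K1_def intro!: bexI)
    obtain N where N: "\<And>n. 1 / real (Suc (n + N)) \<le> r" using inverse_Suc_le[OF r(1)] by metis
    define s where "s x = cnj (h x) * complex_of_real (inverse (norm (h x)))" for x
    have s1: "norm (s x) \<le> 1" and hs: "h x * s x = complex_of_real (norm (h x))" for x
    proof -
      show "norm (s x) \<le> 1" by (cases "h x = 0") (simp_all add: s_def norm_mult norm_inverse)
      show "h x * s x = complex_of_real (norm (h x))"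
        by (cases "h x = 0") (simp_all add: s_def mult.assoc[symmetric] complex_norm_square[symmetric] power2_eq_square)
    qed
    have hi: "integrable (lebesgue_on K) h" using h K by (simp add: L1loc_def)
    have "s \<in> borel_measurable (lebesgue_on K)"
      unfolding s_def[abs_def] using hi
      by (intro borel_measurable_times measurable_compose[OF _ borel_measurable_continuous_onI, of h _ cnj]
           borel_measurable_of_real borel_measurable_inverse borel_measurable_norm continuous_intros) auto
    moreover have "integrable (lebesgue_on K) (\<lambda>x. 1 :: real)"
      using K by (simp add: finite_measure.integrable_const finite_measure_lebesgue_on lmeasurable_compact)
    ultimately have si: "sqint (lebesgue_on K) s"
      by (rule sqint_bound) (use s1 in \<open>simp add: power_le_one\<close>)
    let ?S = "zero_ext K s"
    have Sint: "integrable lebesgue ?S"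
      using sqint_integrable[OF K(1) si] K by (simp add: integrable_lebesgue_on compact_lebesgue)
    have sN: "strict_mono (\<lambda>n. n + N)" by (simp add: strict_mono_def)
    define \<phi> where "\<phi> = (\<lambda>n. mollify (n + N) ?S)"
    have "sqlim lebesgue \<phi> ?S"
      unfolding \<phi>_def using sqlim_subseq[OF sqlim_mollify_zero_ext[OF K(1) si] sN] .
    then obtain q :: "nat \<Rightarrow> nat" where q: "AE x in lebesgue. (\<lambda>n. \<phi> (q n) x) \<longlonglongrightarrow> ?S x"
      using sqlim_AE_subseq by metis
    have \<phi>0: "\<phi> n x = 0" if "x \<notin> K1" for n x
      unfolding \<phi>_def
    proof (rule mollify_eq_0)
      fix y assume "?S y \<noteq> 0"
      then have "y \<in> K" by (auto split: split_indicator_asm)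
      with that have "r < norm (x - y)" by (auto simp: K1_def dist_norm norm_minus_commute)
      with N[of n] show "1 / real (Suc (n + N)) \<le> norm (x - y)" by linarith
    qed
    have \<phi>t: "\<phi> n \<in> test_functions \<Omega>" for n
    proof -
      have "smooth (\<phi> n)" unfolding \<phi>_def by (rule smooth_conv[OF Sint mollifier_test])
      moreover have "compact (supp (\<phi> n))" by (rule compact_supp[OF K1(1) \<phi>0])
      moreover have "supp (\<phi> n) \<subseteq> K1" by (rule supp_subset[OF compact_imp_closed[OF K1(1)] \<phi>0])
      ultimately show ?thesis using K1 by (simp add: test_functions_iff)
    qed
    have \<phi>1: "norm (\<phi> n x) \<le> 1" for n x
      unfolding \<phi>_def by (rule norm_mollify_le[OF Sint]) (use s1 in \<open>auto split: split_indicator\<close>)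
    have hi1: "integrable (lebesgue_on K1) h" using h K1 by (simp add: L1loc_def)
    have Kb: "K \<in> sets lebesgue" "K1 \<in> sets lebesgue" using K K1 by (auto simp: compact_lebesgue)
    have "(\<lambda>n. LINT x|lebesgue_on K1. h x * \<phi> (q n) x) \<longlonglongrightarrow> (LINT x|lebesgue_on K1. h x * ?S x)"
    proof (rule integral_dominated_convergence[where w = "\<lambda>x. norm (h x)"])
      show "(\<lambda>x. h x * \<phi> (q n) x) \<in> borel_measurable (lebesgue_on K1)" for n
        using hi1 \<phi>t[of "q n"]
        by (intro borel_measurable_times measurable_restrict_space1[of "\<phi> (q n)"] borel_measurable_lebesgue_continuous smooth_continuous)
           (auto simp: test_functions_iff)
      show "(\<lambda>x. h x * ?S x) \<in> borel_measurable (lebesgue_on K1)"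
        using hi1 Sint by (intro borel_measurable_times measurable_restrict_space1[of ?S]) auto
      show "AE x in lebesgue_on K1. (\<lambda>n. h x * \<phi> (q n) x) \<longlonglongrightarrow> h x * ?S x"
        unfolding AE_lebesgue_on[OF Kb(2)] using q
        by eventually_elim (intro impI tendsto_mult tendsto_const)
      show "AE x in lebesgue_on K1. norm (h x * \<phi> (q n) x) \<le> norm (h x)" for n
        using \<phi>1 by (intro AE_I2) (simp add: norm_mult mult_left_le)
    qed (use hi1 in simp)
    moreover have "(LINT x|lebesgue_on K1. h x * \<phi> (q n) x) = 0" for n
      using integral_lebesgue_on_subset[of K1 \<Omega> "\<lambda>x. h x * \<phi> (q n) x"] K1 \<phi>0 0[OF \<phi>t[of "q n"]] \<Omega> Kb
      by (simp add: open_lebesgue)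
    ultimately have "(LINT x|lebesgue_on K1. h x * ?S x) = 0" by (simp add: LIMSEQ_const_iff)
    also have "(LINT x|lebesgue_on K1. h x * ?S x) = (LINT x|lebesgue_on K. h x * ?S x)"
      by (rule integral_lebesgue_on_subset) (use Kb sub in auto)
    also have "\<dots> = (LINT x|lebesgue_on K. complex_of_real (norm (h x)))"
      by (rule Bochner_Integration.integral_cong) (simp_all add: hs)
    finally have "(LINT x|lebesgue_on K. norm (h x)) = 0" by simp
    then have "AE x in lebesgue_on K. norm (h x) = 0"
      using hi by (subst (asm) integral_nonneg_eq_0_iff_AE) auto
    then show ?thesis using Kb by (simp add: AE_lebesgue_on)
  qed
  obtain C where C: "\<And>n. compact (C n)" "\<And>n. C n \<subseteq> \<Omega>"
    "\<And>n. C n \<subseteq> interior (C (Suc n))" "\<Union>(range C) = \<Omega>"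
    using open_Union_compact_subsets[OF \<Omega>] by metis
  have "AE x in lebesgue. \<forall>n. x \<in> C n \<longrightarrow> h x = 0"
    unfolding AE_all_countable using local C(1,2) by blast
  then have "AE x in lebesgue. x \<in> \<Omega> \<longrightarrow> h x = 0"
    by eventually_elim (use C(4) in blast)
  then show ?thesis using \<Omega> by (simp add: AE_lebesgue_on open_lebesgue)
qed

lemma is_weak_partial_unique:
  fixes f :: "real ^ 'n \<Rightarrow> complex"
  assumes \<Omega>: "open \<Omega>" and 1: "is_weak_partial \<Omega> k f g" and 2: "is_weak_partial \<Omega> k f g'"
  shows "AE x in lebesgue_on \<Omega>. g x = g' x"
proof -
  have d: "is_weak_partial \<Omega> k (\<lambda>x. 0) (\<lambda>x. g x - g' x)" using is_weak_partial_diff[OF \<Omega> 1 2] by simp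
  have "AE x in lebesgue_on \<Omega>. g x - g' x = 0"
  proof (rule AE_zero_of_test_integrals[OF \<Omega>])
    show "(\<lambda>x. g x - g' x) \<in> L1loc \<Omega>" using d by (simp add: is_weak_partial_def)
    show "(LINT x|lebesgue_on \<Omega>. (g x - g' x) * \<phi> x) = 0" if "\<phi> \<in> test_functions \<Omega>" for \<phi>
      using d that unfolding is_weak_partial_def by simp
  qed
  then show ?thesis by simp
qed

lemma is_weak_partial_weak_partial:
  "is_weak_partial \<Omega> k u g \<Longrightarrow> is_weak_partial \<Omega> k u (weak_partial \<Omega> k u)"
  unfolding weak_partial_def by (rule someI[of "is_weak_partial \<Omega> k u"])

lemma weak_partial_AE:
  assumes "open \<Omega>" "is_weak_partial \<Omega> k u g" shows "AE x in lebesgue_on \<Omega>. weak_partial \<Omega> k u x = g x"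
  by (rule is_weak_partial_unique[OF assms(1) is_weak_partial_weak_partial[OF assms(2)] assms(2)])

lemma sqnorm_weak_partial:
  fixes u :: "real ^ 'n \<Rightarrow> complex"
  assumes \<Omega>: "open \<Omega>" and w: "is_weak_partial \<Omega> k u g"
  shows "sqnorm (lebesgue_on \<Omega>) (weak_partial \<Omega> k u) = sqnorm (lebesgue_on \<Omega>) g"
  using weak_partial_AE[OF assms] is_weak_partial_weak_partial[OF w] w
  by (intro sqnorm_cong_AE L1loc_measurable[OF \<Omega>]) (auto simp: is_weak_partial_def)

lemma H1_norm_eq:
  fixes u :: "real ^ 'n \<Rightarrow> complex"
  assumes "open \<Omega>" "\<And>k. is_weak_partial \<Omega> k u (g k)"
  shows "H1_norm \<Omega> u = sqrt (sqnorm (lebesgue_on \<Omega>) u + (\<Sum>k\<in>UNIV. sqnorm (lebesgue_on \<Omega>) (g k)))"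
  using sqnorm_weak_partial[OF assms(1) assms(2)]
  by (simp add: H1_norm_def sqnorm_def)

lemma H1loc_weak_partial:
  fixes u :: "real ^ 'n \<Rightarrow> complex"
  assumes \<Omega>: "open \<Omega>" and u: "u \<in> H1loc \<Omega>"
  shows "is_weak_partial \<Omega> k u (weak_partial \<Omega> k u)" "weak_partial \<Omega> k u \<in> L2loc \<Omega>"
proof -
  obtain g where g: "g \<in> L2loc \<Omega>" "is_weak_partial \<Omega> k u g" using u by (auto simp: H1loc_def)
  show w: "is_weak_partial \<Omega> k u (weak_partial \<Omega> k u)" using g(2) by (rule is_weak_partial_weak_partial)
  show "weak_partial \<Omega> k u \<in> L2loc \<Omega>"
    unfolding L2loc_def L2_iff
  proof (intro CollectI allI impI)
    fix K assume K: "compact K \<and> K \<subseteq> \<Omega>"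
    have "AE x in lebesgue. x \<in> \<Omega> \<longrightarrow> weak_partial \<Omega> k u x = g x"
      using weak_partial_AE[OF \<Omega> g(2)] \<Omega> by (simp add: AE_lebesgue_on open_lebesgue)
    then have ae: "AE x in lebesgue_on K. g x = weak_partial \<Omega> k u x"
      unfolding AE_lebesgue_on[OF compact_lebesgue[OF conjunct1[OF K]]]
      by eventually_elim (use K in auto)
    have "integrable (lebesgue_on K) (weak_partial \<Omega> k u)" using w K by (auto simp: is_weak_partial_def L1loc_def)
    then show "sqint (lebesgue_on K) (weak_partial \<Omega> k u)"
      using K by (intro sqint_cong_AE[OF L2loc_sqint[OF g(1)] ae]) auto
  qed
qed

section \<open>Product rule and positive parts\<close>

lemma integral_supp:
  fixes F :: "real ^ 'n \<Rightarrow> complex"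
  assumes \<Omega>: "open \<Omega>" and p: "\<phi> \<in> test_functions \<Omega>"
  shows "(LINT x|lebesgue_on \<Omega>. F x * \<phi> x) = (LINT x|lebesgue_on (supp \<phi>). F x * \<phi> x)"
    and "(LINT x|lebesgue_on \<Omega>. F x * partial k \<phi> x) = (LINT x|lebesgue_on (supp \<phi>). F x * partial k \<phi> x)"
  by (rule integral_lebesgue_on_subset;
      use p \<Omega> in \<open>auto simp: test_functions_iff compact_lebesgue open_lebesgue zero_off_supp partial_zero_off_supp\<close>)+

lemma test_functions_sqint_on:
  fixes \<phi> :: "real ^ 'n \<Rightarrow> complex"
  assumes "\<phi> \<in> test_functions \<Omega>" "compact K" shows "sqint (lebesgue_on K) \<phi>"
  by (rule sqint_subset[of K UNIV])
     (use assms in \<open>auto simp: compact_lebesgue lebesgue_on_UNIV_eq test_functions_sqint\<close>)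

lemma test_functions_measurable:
  assumes "\<phi> \<in> test_functions \<Omega>" shows "\<phi> \<in> borel_measurable (lebesgue_on K)"
  using assms by (intro measurable_restrict_space1 borel_measurable_lebesgue_continuous smooth_continuous)
    (simp add: test_functions_iff)

lemma test_functions_measurable_bounded:
  assumes "\<phi> \<in> test_functions \<Omega>"
  obtains B where "\<phi> \<in> borel_measurable (lebesgue_on K)" "AE x in lebesgue_on K. norm (\<phi> x) \<le> B"
proof -
  obtain B where "\<And>x. norm (\<phi> x) \<le> B" using test_functions_bounded[OF assms] by metis
  with test_functions_measurable[OF assms] that[of B] show ?thesis by simp
qed

lemma borel_measurable_of_realD:
  fixes v :: "'a \<Rightarrow> real"
  shows "(\<lambda>x. complex_of_real (v x)) \<in> borel_measurable M \<Longrightarrow> v \<in> borel_measurable M"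
  using measurable_compose[OF _ borel_measurable_Re, of "\<lambda>x. complex_of_real (v x)" M] by simp

lemma is_weak_partial_mult:
  fixes f :: "real ^ 'n \<Rightarrow> complex"
  assumes \<Omega>: "open \<Omega>" and f: "f \<in> L2loc \<Omega>" and f': "f' \<in> L2loc \<Omega>" and wf: "is_weak_partial \<Omega> k f f'"
    and h: "h \<in> L2loc \<Omega>" and h': "\<And>k. h' k \<in> L2loc \<Omega>" and wh: "\<And>k. is_weak_partial \<Omega> k h (h' k)"
  shows "is_weak_partial \<Omega> k (\<lambda>x. f x * h x) (\<lambda>x. f x * h' k x + f' x * h x)"
  unfolding is_weak_partial_def
proof (intro conjI ballI)
  show "(\<lambda>x. f x * h x) \<in> L1loc \<Omega>" "(\<lambda>x. f x * h' k x + f' x * h x) \<in> L1loc \<Omega>"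
    by (intro L1loc_mult L1loc_add f f' h h')+
  fix \<phi> assume p: "\<phi> \<in> test_functions \<Omega>"
  let ?K = "supp \<phi>"
  have s: "smooth \<phi>" "compact ?K" "?K \<subseteq> \<Omega>" using p by (auto simp: test_functions_iff)
  obtain q where q: "\<And>n. q n \<in> test_functions UNIV" "sqlim (lebesgue_on ?K) q h"
    "\<And>k. sqlim (lebesgue_on ?K) (\<lambda>n. partial k (q n)) (h' k)"
    using local_approximation[OF \<Omega> s(2,3) h h' wh] by metis
  obtain B where B: "\<phi> \<in> borel_measurable (lebesgue_on ?K)" "AE x in lebesgue_on ?K. norm (\<phi> x) \<le> B"
    using test_functions_measurable_bounded[OF p] by metis
  obtain C where C: "partial k \<phi> \<in> borel_measurable (lebesgue_on ?K)" "AE x in lebesgue_on ?K. norm (partial k \<phi> x) \<le> C"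
    using test_functions_measurable_bounded[OF test_functions_partial[OF p]] by metis
  have fi: "sqint (lebesgue_on ?K) f" "sqint (lebesgue_on ?K) f'"
    by (rule L2loc_sqint[OF f s(2,3)], rule L2loc_sqint[OF f' s(2,3)])
  have lim1: "sqlim (lebesgue_on ?K) (\<lambda>n x. partial k \<phi> x * q n x + \<phi> x * partial k (q n) x)
      (\<lambda>x. partial k \<phi> x * h x + \<phi> x * h' k x)"
    by (intro sqlim_add sqlim_bmult[OF q(2) C] sqlim_bmult[OF q(3) B])
  have lim2: "sqlim (lebesgue_on ?K) (\<lambda>n x. \<phi> x * q n x) (\<lambda>x. \<phi> x * h x)"
    by (intro sqlim_bmult[OF q(2) B])
  have "(LINT x|lebesgue_on ?K. f x * (partial k \<phi> x * q n x + \<phi> x * partial k (q n) x))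
     = - (LINT x|lebesgue_on ?K. f' x * (\<phi> x * q n x))" for n
  proof -
    have sq: "smooth (q n)" using q(1) by (simp add: test_functions_iff)
    have z: "(\<phi> x * q n x) = 0" if "x \<notin> ?K" for x using that by (simp add: zero_off_supp)
    have "compact (supp (\<lambda>x. \<phi> x * q n x))" by (rule compact_supp[OF s(2) z])
    moreover have sub: "supp (\<lambda>x. \<phi> x * q n x) \<subseteq> ?K" by (rule supp_subset[OF closed_supp z])
    ultimately have t: "(\<lambda>x. \<phi> x * q n x) \<in> test_functions \<Omega>"
      using s smooth_mult[OF s(1) sq] by (simp add: test_functions_iff)
    have pm: "partial k (\<lambda>x. \<phi> x * q n x) = (\<lambda>x. partial k \<phi> x * q n x + \<phi> x * partial k (q n) x)"
      using partial_mult[OF smooth_differentiable[OF s(1)] smooth_differentiable[OF sq]]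
      by (auto simp: add.commute)
    have r: "(LINT x|lebesgue_on \<Omega>. F x * (\<phi> x * A x + partial k \<phi> x * D x)) = (LINT x|lebesgue_on ?K. F x * (\<phi> x * A x + partial k \<phi> x * D x))"
      for F A D :: "real ^ 'n \<Rightarrow> complex"
      by (rule integral_lebesgue_on_subset)
         (use s \<Omega> in \<open>auto simp: compact_lebesgue open_lebesgue zero_off_supp partial_zero_off_supp\<close>)
    have "(LINT x|lebesgue_on \<Omega>. f x * partial k (\<lambda>x. \<phi> x * q n x) x) = - (LINT x|lebesgue_on \<Omega>. f' x * (\<phi> x * q n x))"
      using wf t unfolding is_weak_partial_def by blast
    then show ?thesis
      unfolding pm using r[of f "partial k (q n)" "q n"] r[of f' "q n" "\<lambda>_. 0"] by (simp add: add.commute)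
  qed
  then have "(\<lambda>n. LINT x|lebesgue_on ?K. f x * (partial k \<phi> x * q n x + \<phi> x * partial k (q n) x))
     \<longlonglongrightarrow> - (LINT x|lebesgue_on ?K. f' x * (\<phi> x * h x))"
    using tendsto_minus[OF tendsto_integral_mult[OF sqlim_const[OF fi(2)] lim2]] by simp
  moreover note tendsto_integral_mult[OF sqlim_const[OF fi(1)] lim1]
  ultimately have e: "(LINT x|lebesgue_on ?K. f x * (partial k \<phi> x * h x + \<phi> x * h' k x)) = - (LINT x|lebesgue_on ?K. f' x * (\<phi> x * h x))"
    by (rule LIMSEQ_unique[symmetric])
  have hi: "sqint (lebesgue_on ?K) h" "sqint (lebesgue_on ?K) (h' k)"
    by (rule L2loc_sqint[OF h s(2,3)], rule L2loc_sqint[OF h' s(2,3)])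
  note i = sqint_mult_integrable[OF fi(1) sqint_bmult[OF hi(1) C]] sqint_mult_integrable[OF fi(1) sqint_bmult[OF hi(2) B]]
    sqint_mult_integrable[OF fi(2) sqint_bmult[OF hi(1) B]]
  have "(LINT x|lebesgue_on ?K. f x * (partial k \<phi> x * h x)) + (LINT x|lebesgue_on ?K. f x * (\<phi> x * h' k x))
     = - (LINT x|lebesgue_on ?K. f' x * (\<phi> x * h x))"
    using e i by (simp add: distrib_left)
  then have "(LINT x|lebesgue_on ?K. f x * (partial k \<phi> x * h x)) =
     - (LINT x|lebesgue_on ?K. f x * (\<phi> x * h' k x) + f' x * (\<phi> x * h x))"
    using i by (simp add: algebra_simps)
  then have "(LINT x|lebesgue_on ?K. (f x * h x) * partial k \<phi> x) = - (LINT x|lebesgue_on ?K. (f x * h' k x + f' x * h x) * \<phi> x)"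
    by (simp add: algebra_simps)
  then show "(LINT x|lebesgue_on \<Omega>. (f x * h x) * partial k \<phi> x) = - (LINT x|lebesgue_on \<Omega>. (f x * h' k x + f' x * h x) * \<phi> x)"
    unfolding integral_supp[OF \<Omega> p] .
qed

lemma sqlim_Lipschitz:
  assumes 1: "integrable M (\<lambda>x. 1 :: real)" and p: "sqlim M (\<lambda>n x. complex_of_real (p n x)) (\<lambda>x. complex_of_real (f x))"
    and h: "h \<in> borel_measurable borel" and L: "\<And>s t. \<bar>h s - h t\<bar> \<le> L * \<bar>s - t\<bar>"
  shows "sqlim M (\<lambda>n x. complex_of_real (h (p n x))) (\<lambda>x. complex_of_real (h (f x)))"
proof -
  have m: "v \<in> borel_measurable M" if "sqint M (\<lambda>x. complex_of_real (v x))" for v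
    using sqint_measurable[OF that] by (rule borel_measurable_of_realD)
  have i: "sqint M (\<lambda>x. complex_of_real (h (v x)))" if v: "sqint M (\<lambda>x. complex_of_real (v x))" for v
  proof (rule sqint_bound[where g = "\<lambda>x. 2 * L\<^sup>2 * (v x)\<^sup>2 + 2 * (h 0)\<^sup>2 * 1"])
    show "(\<lambda>x. complex_of_real (h (v x))) \<in> borel_measurable M"
      using measurable_compose[OF m[OF v] h] by simp
    show "integrable M (\<lambda>x. 2 * L\<^sup>2 * (v x)\<^sup>2 + 2 * (h 0)\<^sup>2 * 1)"
      using v 1 by (intro Bochner_Integration.integrable_add integrable_mult_right) (auto simp: sqint_def)
    show "AE x in M. (norm (complex_of_real (h (v x))))\<^sup>2 \<le> 2 * L\<^sup>2 * (v x)\<^sup>2 + 2 * (h 0)\<^sup>2 * 1"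
    proof (rule AE_I2)
      fix x
      have "\<bar>h (v x) - h 0\<bar> \<le> L * \<bar>v x\<bar>" using L[of "v x" 0] by simp
      then have "\<bar>h (v x) - h 0\<bar>\<^sup>2 \<le> (L * \<bar>v x\<bar>)\<^sup>2" by (intro power_mono) auto
      moreover have "\<bar>(h (v x) - h 0) + h 0\<bar>\<^sup>2 \<le> 2 * \<bar>h (v x) - h 0\<bar>\<^sup>2 + 2 * \<bar>h 0\<bar>\<^sup>2"
        using norm_add_sq_le[of "h (v x) - h 0" "h 0"] unfolding real_norm_def .
      ultimately show "(norm (complex_of_real (h (v x))))\<^sup>2 \<le> 2 * L\<^sup>2 * (v x)\<^sup>2 + 2 * (h 0)\<^sup>2 * 1"
        by (simp add: power_mult_distrib)
    qed
  qed
  have pi: "\<And>n. sqint M (\<lambda>x. complex_of_real (p n x))" "sqint M (\<lambda>x. complex_of_real (f x))"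
    using p by (auto simp: sqlim_def)
  have "(\<lambda>n. sqnorm M (\<lambda>x. complex_of_real (h (p n x)) - complex_of_real (h (f x)))) \<longlonglongrightarrow> 0"
  proof (rule Lim_null_comparison)
    show "(\<lambda>n. L\<^sup>2 * sqnorm M (\<lambda>x. complex_of_real (p n x) - complex_of_real (f x))) \<longlonglongrightarrow> 0"
      using p by (auto simp: sqlim_def intro!: tendsto_eq_intros)
    show "\<forall>\<^sub>F n in sequentially. norm (sqnorm M (\<lambda>x. complex_of_real (h (p n x)) - complex_of_real (h (f x))))
       \<le> L\<^sup>2 * sqnorm M (\<lambda>x. complex_of_real (p n x) - complex_of_real (f x))"
    proof (intro always_eventually allI)
      fix n
      have "sqnorm M (\<lambda>x. complex_of_real (h (p n x)) - complex_of_real (h (f x)))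
        \<le> (LINT x|M. L\<^sup>2 * (norm (complex_of_real (p n x) - complex_of_real (f x)))\<^sup>2)"
        unfolding sqnorm_def
      proof (rule integral_mono)
        fix x
        have "\<bar>h (p n x) - h (f x)\<bar>\<^sup>2 \<le> (L * \<bar>p n x - f x\<bar>)\<^sup>2" by (intro power_mono L) auto
        then show "(norm (complex_of_real (h (p n x)) - complex_of_real (h (f x))))\<^sup>2
            \<le> L\<^sup>2 * (norm (complex_of_real (p n x) - complex_of_real (f x)))\<^sup>2"
          by (simp add: power_mult_distrib flip: of_real_diff)
      qed (use sqint_diff[OF i[OF pi(1)] i[OF pi(2)]] sqint_diff[OF pi] in \<open>auto simp: sqint_def\<close>)
      then show "norm (sqnorm M (\<lambda>x. complex_of_real (h (p n x)) - complex_of_real (h (f x))))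
       \<le> L\<^sup>2 * sqnorm M (\<lambda>x. complex_of_real (p n x) - complex_of_real (f x))"
        by (simp add: sqnorm_nonneg) (simp add: sqnorm_def)
    qed
  qed
  then show ?thesis using i pi by (simp add: sqlim_def)
qed

lemma integral_chain_rule:
  fixes f :: "real ^ 'n \<Rightarrow> real" and G G' :: "real \<Rightarrow> real"
  assumes \<Omega>: "open \<Omega>" and f: "(\<lambda>x. complex_of_real (f x)) \<in> L2loc \<Omega>"
    and g: "\<And>k. (\<lambda>x. complex_of_real (g k x)) \<in> L2loc \<Omega>"
    and w: "\<And>k. is_weak_partial \<Omega> k (\<lambda>x. complex_of_real (f x)) (\<lambda>x. complex_of_real (g k x))"
    and G: "\<And>t. (G has_real_derivative G' t) (at t)" and G1: "\<And>t. \<bar>G' t\<bar> \<le> 1"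
    and cG': "continuous_on UNIV G'" and L: "\<And>s t. \<bar>G' s - G' t\<bar> \<le> L * \<bar>s - t\<bar>"
    and p: "\<phi> \<in> test_functions \<Omega>"
  shows "(LINT x|lebesgue_on \<Omega>. complex_of_real (G (f x)) * partial k \<phi> x) =
     - (LINT x|lebesgue_on \<Omega>. complex_of_real (G' (f x) * g k x) * \<phi> x)"
proof -
  let ?K = "supp \<phi>" and ?c = complex_of_real
  have s: "smooth \<phi>" "compact ?K" "?K \<subseteq> \<Omega>" using p by (auto simp: test_functions_iff)
  obtain q where q: "\<And>n. q n \<in> test_functions UNIV" "sqlim (lebesgue_on ?K) q (\<lambda>x. ?c (f x))"
    "\<And>k. sqlim (lebesgue_on ?K) (\<lambda>n. partial k (q n)) (\<lambda>x. ?c (g k x))"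
    using local_approximation[OF \<Omega> s(2,3) f g w] by metis
  have qR: "sqlim (lebesgue_on ?K) (\<lambda>n x. ?c (Re (q n x))) (\<lambda>x. ?c (f x))"
    "sqlim (lebesgue_on ?K) (\<lambda>n x. ?c (Re (partial k (q n) x))) (\<lambda>x. ?c (g k x))"
    using sqlim_Re[OF q(2)] sqlim_Re[OF q(3)[of k]] by simp_all
  have one: "integrable (lebesgue_on ?K) (\<lambda>x. 1 :: real)"
    using s by (simp add: finite_measure.integrable_const finite_measure_lebesgue_on lmeasurable_compact)
  have GL: "\<bar>G s - G t\<bar> \<le> 1 * \<bar>s - t\<bar>" for s t
  proof -
    have "norm (G s - G t) \<le> 1 * norm (s - t)"
    proof (rule differentiable_bound[OF convex_UNIV])
      show "(G has_derivative (\<lambda>h. G' t * h)) (at t)" for t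
        using G[of t] by (simp add: has_field_derivative_def)
      show "onorm (\<lambda>h. G' t * h) \<le> 1" for t
        by (rule onorm_bound) (use G1[of t] in \<open>auto simp: abs_mult intro: mult_left_le_one_le\<close>)
    qed auto
    then show ?thesis by simp
  qed
  have cG: "continuous_on UNIV G"
    using G by (meson DERIV_isCont continuous_at_imp_continuous_on)
  define \<psi> where "\<psi> n x = ?c (G (Re (q n x)))" for n x
  have D: "(\<psi> n has_derivative (\<lambda>h. ?c (G' (Re (q n x)) * Re (frechet_derivative (q n) (at x) h)))) (at x)" for n x
  proof -
    have "q n differentiable (at x)" using q(1)[of n] by (simp add: test_functions_iff smooth_differentiable)
    then have "((\<lambda>x. Re (q n x)) has_derivative (\<lambda>h. Re (frechet_derivative (q n) (at x) h))) (at x)"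
      by (intro has_derivative_Re has_frechet_derivative)
    from DERIV_compose_FDERIV[OF G this]
    show ?thesis unfolding \<psi>_def by (intro has_derivative_of_real) (simp add: mult.commute)
  qed
  have P: "partial k (\<psi> n) = (\<lambda>x. ?c (G' (Re (q n x)) * Re (partial k (q n) x)))" for n
    using partial_eqI[OF D] by (auto simp: partial_def)
  have "is_weak_partial \<Omega> k (\<psi> n) (partial k (\<psi> n))" for n
  proof (rule is_weak_partial_classical[OF \<Omega>])
    show "\<psi> n differentiable (at x)" for x using D by (rule differentiableI)
    have sq: "smooth (q n)" using q(1) by (simp add: test_functions_iff)
    have "continuous_on UNIV (\<lambda>x. G' (Re (q n x)))"
      by (rule continuous_on_compose2[OF cG']) (auto intro: continuous_on_Re smooth_continuous sq)
    then show "continuous_on UNIV (partial k (\<psi> n))"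
      unfolding P by (intro continuous_on_of_real continuous_on_mult continuous_on_Re smooth_continuous smooth_partial sq)
  qed
  then have "(LINT x|lebesgue_on \<Omega>. \<psi> n x * partial k \<phi> x) = - (LINT x|lebesgue_on \<Omega>. partial k (\<psi> n) x * \<phi> x)" for n
    using p unfolding is_weak_partial_def by blast
  then have e: "(LINT x|lebesgue_on ?K. \<psi> n x * partial k \<phi> x) = - (LINT x|lebesgue_on ?K. partial k (\<psi> n) x * \<phi> x)" for n
    unfolding integral_supp[OF \<Omega> p] .
  obtain B where B: "\<phi> \<in> borel_measurable (lebesgue_on ?K)" "AE x in lebesgue_on ?K. norm (\<phi> x) \<le> B"
    using test_functions_measurable_bounded[OF p] by metis
  have "sqlim (lebesgue_on ?K) \<psi> (\<lambda>x. ?c (G (f x)))"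
    unfolding \<psi>_def[abs_def]
    by (rule sqlim_Lipschitz[OF one qR(1) borel_measurable_continuous_onI[OF cG] GL])
  moreover have "sqlim (lebesgue_on ?K) (\<lambda>n. partial k \<phi>) (partial k \<phi>)"
    by (intro sqlim_const test_functions_sqint_on[OF test_functions_partial[OF p] s(2)])
  ultimately have l1: "(\<lambda>n. LINT x|lebesgue_on ?K. \<psi> n x * partial k \<phi> x) \<longlonglongrightarrow> (LINT x|lebesgue_on ?K. ?c (G (f x)) * partial k \<phi> x)"
    by (rule tendsto_integral_mult)
  have "(\<lambda>n. LINT x|lebesgue_on ?K. ?c (G' (Re (q n x))) * (\<phi> x * ?c (Re (partial k (q n) x))))
      \<longlonglongrightarrow> (LINT x|lebesgue_on ?K. ?c (G' (f x)) * (\<phi> x * ?c (g k x)))"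
    by (rule tendsto_integral_mult[OF sqlim_Lipschitz[OF one qR(1) borel_measurable_continuous_onI[OF cG'] L] sqlim_bmult[OF qR(2) B]])
  then have "(\<lambda>n. LINT x|lebesgue_on ?K. partial k (\<psi> n) x * \<phi> x) \<longlonglongrightarrow> (LINT x|lebesgue_on ?K. ?c (G' (f x) * g k x) * \<phi> x)"
    unfolding P by (simp add: mult_ac)
  then have "(\<lambda>n. LINT x|lebesgue_on ?K. \<psi> n x * partial k \<phi> x) \<longlonglongrightarrow> - (LINT x|lebesgue_on ?K. ?c (G' (f x) * g k x) * \<phi> x)"
    unfolding e by (rule tendsto_minus)
  then have "(LINT x|lebesgue_on ?K. ?c (G (f x)) * partial k \<phi> x) = - (LINT x|lebesgue_on ?K. ?c (G' (f x) * g k x) * \<phi> x)"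
    by (rule LIMSEQ_unique[OF l1])
  then show ?thesis unfolding integral_supp[OF \<Omega> p] .
qed

text \<open>A continuously differentiable regularization of the positive part. Its derivative vanishes at \<open>0\<close>,
  so that it tends to the indicator function of \<open>t > 0\<close> at every point as \<open>e\<close> tends to \<open>0\<close>.\<close>

definition ramp :: "real \<Rightarrow> real \<Rightarrow> real" where
  "ramp e t = ((max 0 t)\<^sup>2 - (max 0 (t - e))\<^sup>2) / (2 * e)"

definition ramp' :: "real \<Rightarrow> real \<Rightarrow> real" where
  "ramp' e t = (max 0 t - max 0 (t - e)) / e"

lemma max_0_square_deriv: "((\<lambda>t :: real. (max 0 t)\<^sup>2) has_real_derivative 2 * max 0 t) (at t)"
proof (cases t "0 :: real" rule: linorder_cases)
  case greater
  have "((\<lambda>t :: real. t\<^sup>2) has_real_derivative 2 * max 0 t) (at t)"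
    using greater by (auto intro!: derivative_eq_intros)
  then show ?thesis
    by (rule has_field_derivative_transform_within[where d = t]) (use greater in \<open>auto simp: dist_real_def\<close>)
next
  case less
  have "((\<lambda>t :: real. 0) has_real_derivative 2 * max 0 t) (at t)" using less by simp
  then show ?thesis
    by (rule has_field_derivative_transform_within[where d = "- t"]) (use less in \<open>auto simp: dist_real_def\<close>)
next
  case equal
  have "((\<lambda>h. ((max 0 (0 + h))\<^sup>2 - (max 0 0)\<^sup>2) / h) \<longlongrightarrow> (0 :: real)) (at 0)"
  proof (rule Lim_transform_eventually)
    have "((\<lambda>h :: real. max 0 h) \<longlongrightarrow> max 0 0) (at 0)" by (intro tendsto_intros)
    then show "((\<lambda>h :: real. max 0 h) \<longlongrightarrow> 0) (at 0)" by simp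
    show "eventually (\<lambda>h :: real. max 0 h = ((max 0 (0 + h))\<^sup>2 - (max 0 0)\<^sup>2) / h) (at 0)"
      unfolding eventually_at_filter
    proof (intro always_eventually allI impI)
      fix h :: real assume "h \<noteq> 0"
      then show "max 0 h = ((max 0 (0 + h))\<^sup>2 - (max 0 0)\<^sup>2) / h"
        by (cases "0 \<le> h") (simp_all add: power2_eq_square)
    qed
  qed
  then show ?thesis using equal by (simp add: DERIV_def)
qed

lemma ramp_deriv: "0 < e \<Longrightarrow> (ramp e has_real_derivative ramp' e t) (at t)"
proof -
  assume e: "0 < e"
  have "((\<lambda>t. (max 0 (t - e))\<^sup>2) has_real_derivative 2 * max 0 (t - e)) (at t)"
  proof -
    have "((\<lambda>t. t - e) has_real_derivative 1) (at t)" by (auto intro!: derivative_eq_intros)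
    from DERIV_chain2[OF max_0_square_deriv this] show ?thesis by simp
  qed
  from DERIV_cdivide[OF DERIV_diff[OF max_0_square_deriv this], of "2 * e"]
  have "(ramp e has_real_derivative (2 * max 0 t - 2 * max 0 (t - e)) / (2 * e)) (at t)"
    unfolding ramp_def[abs_def] .
  moreover have "(2 * a - 2 * b) / (2 * e) = (a - b) / e" for a b using e by (simp add: field_simps)
  ultimately show ?thesis by (simp only: ramp'_def)
qed

lemma ramp'_bounds:
  assumes "0 < e" shows "\<bar>ramp' e t\<bar> \<le> 1"
proof -
  have "\<bar>max 0 t - max 0 (t - e)\<bar> \<le> e" using assms by linarith
  then show ?thesis using assms by (simp add: ramp'_def divide_le_eq)
qed

lemma ramp'_Lipschitz:
  assumes "0 < e" shows "\<bar>ramp' e s - ramp' e t\<bar> \<le> (2 / e) * \<bar>s - t\<bar>"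
proof -
  have m: "\<bar>max 0 a - max 0 b\<bar> \<le> \<bar>a - b\<bar>" for a b :: real by (simp add: max_def)
  have tri: "\<bar>p - r\<bar> \<le> d \<Longrightarrow> \<bar>q - w\<bar> \<le> d \<Longrightarrow> \<bar>(p - q) - (r - w)\<bar> \<le> 2 * d" for p q r w d :: real
    by linarith
  have "\<bar>s - e - (t - e)\<bar> = \<bar>s - t\<bar>" by simp
  then have "\<bar>(max 0 s - max 0 (s - e)) - (max 0 t - max 0 (t - e))\<bar> \<le> 2 * \<bar>s - t\<bar>"
    by (intro tri m) (use m[of "s - e" "t - e"] in \<open>simp only:\<close>)
  then have "\<bar>(max 0 s - max 0 (s - e)) - (max 0 t - max 0 (t - e))\<bar> / e \<le> (2 * \<bar>s - t\<bar>) / e"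
    by (rule divide_right_mono) (use assms in simp)
  moreover have "ramp' e s - ramp' e t = ((max 0 s - max 0 (s - e)) - (max 0 t - max 0 (t - e))) / e"
    by (simp only: ramp'_def diff_divide_distrib[symmetric])
  ultimately show ?thesis using assms by (simp only: abs_divide abs_of_pos times_divide_eq_left)
qed

lemma ramp_bound: "0 < e \<Longrightarrow> \<bar>ramp e t - max 0 t\<bar> \<le> e"
proof -
  assume e: "0 < e"
  consider "t \<le> 0" | "0 < t" "t \<le> e" | "e < t" by linarith
  then show ?thesis
  proof cases
    case 2
    have "t * t \<le> e * t" using 2 by (intro mult_right_mono) auto
    then have "0 \<le> ramp e t" "ramp e t \<le> t" using 2 by (auto simp: ramp_def field_simps power2_eq_square)
    then show ?thesis using 2 by simp
  next
    case 3
    then have "ramp e t = (t\<^sup>2 - (t - e)\<^sup>2) / (2 * e)" using e by (simp add: ramp_def)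
    also have "\<dots> = t - e / 2" using e by (simp add: power2_eq_square field_simps)
    finally show ?thesis using 3 e by simp
  qed (use e in \<open>simp add: ramp_def\<close>)
qed

lemma is_weak_partial_pos_part:
  fixes f :: "real ^ 'n \<Rightarrow> real"
  assumes \<Omega>: "open \<Omega>" and f: "(\<lambda>x. complex_of_real (f x)) \<in> L2loc \<Omega>"
    and g: "\<And>k. (\<lambda>x. complex_of_real (g k x)) \<in> L2loc \<Omega>"
    and w: "\<And>k. is_weak_partial \<Omega> k (\<lambda>x. complex_of_real (f x)) (\<lambda>x. complex_of_real (g k x))"
  shows "is_weak_partial \<Omega> k (\<lambda>x. complex_of_real (max (f x) 0)) (\<lambda>x. complex_of_real (if 0 < f x then g k x else 0))"
    and "(\<lambda>x. complex_of_real (max (f x) 0)) \<in> L2loc \<Omega>"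
    and "(\<lambda>x. complex_of_real (if 0 < f x then g k x else 0)) \<in> L2loc \<Omega>"
proof -
  let ?c = complex_of_real
  have fm: "f \<in> borel_measurable (lebesgue_on K)" "g k \<in> borel_measurable (lebesgue_on K)" if "compact K" "K \<subseteq> \<Omega>" for K
    by (rule borel_measurable_of_realD[OF sqint_measurable[OF L2loc_sqint[OF f that]]],
        rule borel_measurable_of_realD[OF sqint_measurable[OF L2loc_sqint[OF g that]]])
  show L: "(\<lambda>x. ?c (max (f x) 0)) \<in> L2loc \<Omega>"
    unfolding L2loc_def L2_iff
  proof (intro CollectI allI impI)
    fix K assume K: "compact K \<and> K \<subseteq> \<Omega>"
    have [measurable]: "f \<in> borel_measurable (lebesgue_on K)" using K by (intro fm) simp_all
    show "sqint (lebesgue_on K) (\<lambda>x. ?c (max (f x) 0))"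
    proof (rule sqint_bound[where g = "\<lambda>x. (norm (?c (f x)))\<^sup>2"])
      show "(\<lambda>x. ?c (max (f x) 0)) \<in> borel_measurable (lebesgue_on K)" by measurable
      show "integrable (lebesgue_on K) (\<lambda>x. (norm (?c (f x)))\<^sup>2)" using L2loc_sqint[OF f] K unfolding sqint_def by blast
      show "AE x in lebesgue_on K. (norm (?c (max (f x) 0)))\<^sup>2 \<le> (norm (?c (f x)))\<^sup>2"
        by (intro AE_I2 power_mono) (simp_all add: max_def)
    qed
  qed
  show L': "(\<lambda>x. ?c (if 0 < f x then g k x else 0)) \<in> L2loc \<Omega>"
    unfolding L2loc_def L2_iff
  proof (intro CollectI allI impI)
    fix K assume K: "compact K \<and> K \<subseteq> \<Omega>"
    have [measurable]: "f \<in> borel_measurable (lebesgue_on K)" "g k \<in> borel_measurable (lebesgue_on K)" using K by (intro fm; simp)+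
    show "sqint (lebesgue_on K) (\<lambda>x. ?c (if 0 < f x then g k x else 0))"
    proof (rule sqint_bound[where g = "\<lambda>x. (norm (?c (g k x)))\<^sup>2"])
      show "(\<lambda>x. ?c (if 0 < f x then g k x else 0)) \<in> borel_measurable (lebesgue_on K)" by measurable
      show "integrable (lebesgue_on K) (\<lambda>x. (norm (?c (g k x)))\<^sup>2)" using L2loc_sqint[OF g] K unfolding sqint_def by blast
    qed auto
  qed
  show "is_weak_partial \<Omega> k (\<lambda>x. ?c (max (f x) 0)) (\<lambda>x. ?c (if 0 < f x then g k x else 0))"
    unfolding is_weak_partial_def
  proof (intro conjI ballI L2loc_L1loc L L')
    fix \<phi> assume p: "\<phi> \<in> test_functions \<Omega>"
    let ?K = "supp \<phi>"
    have s: "smooth \<phi>" "compact ?K" "?K \<subseteq> \<Omega>" using p by (auto simp: test_functions_iff)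
    note [measurable] = fm[OF s(2,3)] test_functions_measurable[OF p, where K = ?K]
      test_functions_measurable[OF test_functions_partial[OF p], where K = ?K]
    define e where "e n = inverse (real (Suc n))" for n
    have e: "0 < e n" "e n \<le> 1" for n by (auto simp: e_def field_simps)
    have e0: "e \<longlonglongrightarrow> 0" unfolding e_def[abs_def] by (rule LIMSEQ_inverse_real_of_nat)
    have rm [measurable]: "ramp e \<in> borel_measurable borel" "ramp' e \<in> borel_measurable borel" for e
      unfolding ramp_def[abs_def] ramp'_def[abs_def] by measurable
    have eq: "(LINT x|lebesgue_on ?K. ?c (ramp (e n) (f x)) * partial k \<phi> x) =
       - (LINT x|lebesgue_on ?K. ?c (ramp' (e n) (f x) * g k x) * \<phi> x)" for n
      unfolding integral_supp[OF \<Omega> p, symmetric]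
    proof (rule integral_chain_rule[OF \<Omega> f g w ramp_deriv[OF e(1)] ramp'_bounds[OF e(1)] _ ramp'_Lipschitz[OF e(1)] p])
      show "continuous_on UNIV (ramp' (e n))"
        unfolding ramp'_def[abs_def] using e[of n] by (intro continuous_intros) auto
    qed
    have i1: "integrable (lebesgue_on ?K) (\<lambda>x. (\<bar>f x\<bar> + 1) * norm (partial k \<phi> x))"
    proof -
      have "integrable (lebesgue_on ?K) (\<lambda>x. norm (?c (f x)) * norm (partial k \<phi> x))"
        by (rule sqint_mult_abs_integrable[OF L2loc_sqint[OF f s(2,3)]
              test_functions_sqint_on[OF test_functions_partial[OF p] s(2)]])
      moreover have "integrable (lebesgue_on ?K) (partial k \<phi>)"
        by (rule sqint_integrable[OF s(2) test_functions_sqint_on[OF test_functions_partial[OF p] s(2)]])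
      ultimately show ?thesis by (simp add: distrib_right)
    qed
    have "(\<lambda>n. LINT x|lebesgue_on ?K. ?c (ramp (e n) (f x)) * partial k \<phi> x) \<longlonglongrightarrow> (LINT x|lebesgue_on ?K. ?c (max (f x) 0) * partial k \<phi> x)"
    proof (rule integral_dominated_convergence[where w = "\<lambda>x. (\<bar>f x\<bar> + 1) * norm (partial k \<phi> x)", OF _ _ i1])
      show "AE x in lebesgue_on ?K. (\<lambda>n. ?c (ramp (e n) (f x)) * partial k \<phi> x) \<longlonglongrightarrow> ?c (max (f x) 0) * partial k \<phi> x"
      proof (rule AE_I2)
        fix x
        have "(\<lambda>n. ramp (e n) (f x) - max 0 (f x)) \<longlonglongrightarrow> 0"
          by (rule Lim_null_comparison[OF _ e0], unfold real_norm_def)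
             (intro always_eventually allI ramp_bound e)
        then have "(\<lambda>n. ramp (e n) (f x)) \<longlonglongrightarrow> max (f x) 0" by (simp add: LIM_zero_iff max.commute)
        then show "(\<lambda>n. ?c (ramp (e n) (f x)) * partial k \<phi> x) \<longlonglongrightarrow> ?c (max (f x) 0) * partial k \<phi> x"
          by (intro tendsto_intros)
      qed
      show "AE x in lebesgue_on ?K. norm (?c (ramp (e n) (f x)) * partial k \<phi> x) \<le> (\<bar>f x\<bar> + 1) * norm (partial k \<phi> x)" for n
      proof (rule AE_I2)
        fix x
        have "\<bar>ramp (e n) (f x)\<bar> \<le> \<bar>f x\<bar> + 1"
        proof -
          have *: "\<bar>a - b\<bar> \<le> c \<Longrightarrow> c \<le> 1 \<Longrightarrow> \<bar>b\<bar> \<le> d \<Longrightarrow> \<bar>a\<bar> \<le> d + 1" for a b c d :: real by linarith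
          show ?thesis by (rule *[OF ramp_bound[OF e(1)] e(2)]) (simp add: max_def)
        qed
        then show "norm (?c (ramp (e n) (f x)) * partial k \<phi> x) \<le> (\<bar>f x\<bar> + 1) * norm (partial k \<phi> x)"
          by (simp add: norm_mult mult_right_mono)
      qed
    qed measurable
    moreover have "(\<lambda>n. LINT x|lebesgue_on ?K. ?c (ramp' (e n) (f x) * g k x) * \<phi> x) \<longlonglongrightarrow> (LINT x|lebesgue_on ?K. ?c (if 0 < f x then g k x else 0) * \<phi> x)"
    proof (rule integral_dominated_convergence[where w = "\<lambda>x. norm (?c (g k x)) * norm (\<phi> x)"])
      show "integrable (lebesgue_on ?K) (\<lambda>x. norm (?c (g k x)) * norm (\<phi> x))"
        by (rule sqint_mult_abs_integrable[OF L2loc_sqint[OF g s(2,3)] test_functions_sqint_on[OF p s(2)]])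
      show "AE x in lebesgue_on ?K. (\<lambda>n. ?c (ramp' (e n) (f x) * g k x) * \<phi> x) \<longlonglongrightarrow> ?c (if 0 < f x then g k x else 0) * \<phi> x"
      proof (rule AE_I2)
        fix x
        have "(\<lambda>n. ramp' (e n) (f x)) \<longlonglongrightarrow> (if 0 < f x then 1 else 0)"
        proof (cases "0 < f x")
          case True
          have "eventually (\<lambda>n. e n < f x) sequentially" using order_tendstoD(2)[OF e0 True] .
          then have "eventually (\<lambda>n. ramp' (e n) (f x) = 1) sequentially"
          proof eventually_elim
            case (elim n)
            then show ?case using True e(1)[of n] by (simp add: ramp'_def)
          qed
          with True show ?thesis by (simp add: tendsto_eventually)
        next
          case False
          have "ramp' (e n) (f x) = 0" for n using False e(1)[of n] by (simp add: ramp'_def)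
          with False show ?thesis by simp
        qed
        then have "(\<lambda>n. ?c (ramp' (e n) (f x) * g k x) * \<phi> x) \<longlonglongrightarrow> ?c ((if 0 < f x then 1 else 0) * g k x) * \<phi> x"
          by (intro tendsto_intros)
        then show "(\<lambda>n. ?c (ramp' (e n) (f x) * g k x) * \<phi> x) \<longlonglongrightarrow> ?c (if 0 < f x then g k x else 0) * \<phi> x"
          by (simp split: if_splits)
      qed
      show "AE x in lebesgue_on ?K. norm (?c (ramp' (e n) (f x) * g k x) * \<phi> x) \<le> norm (?c (g k x)) * norm (\<phi> x)" for n
      proof (rule AE_I2)
        fix x
        have "\<bar>ramp' (e n) (f x)\<bar> * \<bar>g k x\<bar> \<le> 1 * \<bar>g k x\<bar>" by (intro mult_right_mono ramp'_bounds e) simp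
        then show "norm (?c (ramp' (e n) (f x) * g k x) * \<phi> x) \<le> norm (?c (g k x)) * norm (\<phi> x)"
          unfolding norm_mult norm_of_real abs_mult by (intro mult_right_mono) auto
      qed
    qed measurable
    ultimately have "(LINT x|lebesgue_on ?K. ?c (max (f x) 0) * partial k \<phi> x) = - (LINT x|lebesgue_on ?K. ?c (if 0 < f x then g k x else 0) * \<phi> x)"
      unfolding eq by (rule LIMSEQ_unique[OF _ tendsto_minus])
    then show "(LINT x|lebesgue_on \<Omega>. ?c (max (f x) 0) * partial k \<phi> x) = - (LINT x|lebesgue_on \<Omega>. ?c (if 0 < f x then g k x else 0) * \<phi> x)"
      unfolding integral_supp[OF \<Omega> p] .
  qed
qed

section \<open>The energy estimate\<close>

lemma bdd_measurable_subset:
  fixes f :: "real ^ 'n \<Rightarrow> 'b :: real_normed_vector"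
  assumes "bdd_measurable \<Omega> f" "K \<subseteq> \<Omega>"
  obtains B where "0 \<le> B" "f \<in> borel_measurable (lebesgue_on K)" "\<And>x. x \<in> \<Omega> \<Longrightarrow> norm (f x) \<le> B"
proof -
  obtain B where "0 < B" "\<forall>y \<in> f ` \<Omega>. norm y \<le> B"
    using assms(1) unfolding bdd_measurable_def bounded_pos by auto
  moreover have "f \<in> borel_measurable (lebesgue_on K)"
    using assms by (auto simp: bdd_measurable_def intro: measurable_restrict_mono)
  ultimately show ?thesis using that[of B] by auto
qed

lemma sqint_coefficient:
  fixes f g :: "real ^ 'n \<Rightarrow> complex"
  assumes f: "bdd_measurable \<Omega> f" and K: "K \<subseteq> \<Omega>" and g: "sqint (lebesgue_on K) g"
  shows "sqint (lebesgue_on K) (\<lambda>x. f x * g x)"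
proof -
  obtain B where B: "0 \<le> B" "f \<in> borel_measurable (lebesgue_on K)" "\<And>x. x \<in> \<Omega> \<Longrightarrow> norm (f x) \<le> B"
    using bdd_measurable_subset[OF f K] by metis
  show ?thesis
    by (rule sqint_bmult[OF g B(2), of B]) (rule AE_I2, use B(3) K in auto)
qed

lemma bdd_measurable_of_real:
  "bdd_measurable \<Omega> f \<Longrightarrow> bdd_measurable \<Omega> (\<lambda>x. complex_of_real (f x))"
  unfolding bdd_measurable_def bounded_iff by auto

lemma elliptic_op_extension:
  fixes \<Omega> :: "(real ^ 'n) set" and a :: "'n \<Rightarrow> 'n \<Rightarrow> real ^ 'n \<Rightarrow> real" and b :: "'n \<Rightarrow> real ^ 'n \<Rightarrow> complex"
    and c :: "'n \<Rightarrow> real ^ 'n \<Rightarrow> real" and h :: "'n \<Rightarrow> real ^ 'n \<Rightarrow> complex"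
  assumes \<Omega>: "open \<Omega>"
    and a: "\<And>k l. bdd_measurable \<Omega> (a k l)" and b: "\<And>k. bdd_measurable \<Omega> (b k)"
    and c: "\<And>k. bdd_measurable \<Omega> (c k)" and c0: "bdd_measurable \<Omega> c0"
    and u: "u \<in> H1loc \<Omega>"
    and C: "\<And>v. v \<in> test_functions \<Omega> \<Longrightarrow> norm (elliptic_op \<Omega> a b c c0 u v) \<le> C * H1_norm \<Omega> v"
    and K: "compact K" "K \<subseteq> \<Omega>" and v: "v \<in> L2loc \<Omega>" and h: "\<And>k. h k \<in> L2loc \<Omega>"
    and w: "\<And>k. is_weak_partial \<Omega> k v (h k)"
    and v0: "AE x in lebesgue_on \<Omega>. x \<notin> K \<longrightarrow> v x = 0" and h0: "\<And>k. AE x in lebesgue_on \<Omega>. x \<notin> K \<longrightarrow> h k x = 0"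
  obtains K' where "compact K'" "K' \<subseteq> \<Omega>" "K \<subseteq> K'"
    "norm ((\<Sum>k\<in>UNIV. \<Sum>l\<in>UNIV. LINT x|lebesgue_on K'.
        complex_of_real (a k l x) * weak_partial \<Omega> l u x * cnj (h k x)) +
     (\<Sum>k\<in>UNIV. LINT x|lebesgue_on K'. b k x * u x * cnj (h k x)) +
     (\<Sum>k\<in>UNIV. LINT x|lebesgue_on K'. complex_of_real (c k x) * weak_partial \<Omega> k u x * cnj (v x)) +
     (LINT x|lebesgue_on K'. c0 x * u x * cnj (v x)))
     \<le> C * sqrt (sqnorm (lebesgue_on K') v + (\<Sum>k\<in>UNIV. sqnorm (lebesgue_on K') (h k)))"
proof -
  obtain \<phi> K' where K': "compact K'" "K' \<subseteq> \<Omega>" "K \<subseteq> K'" and \<phi>: "\<And>n. \<phi> n \<in> test_functions \<Omega>"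
    "\<And>n. supp (\<phi> n) \<subseteq> K'" and l: "sqlim (lebesgue_on \<Omega>) \<phi> v"
    "\<And>k. sqlim (lebesgue_on \<Omega>) (\<lambda>n. partial k (\<phi> n)) (h k)"
    using compact_approximation[OF \<Omega> K v h w v0 h0] by metis
  have s: "K' \<in> sets lebesgue" "\<Omega> \<in> sets lebesgue" using K' \<Omega> by (auto simp: compact_lebesgue open_lebesgue)
  note l' = sqlim_subset[OF s K'(2) l(1)] sqlim_subset[OF s K'(2) l(2)]
  have z: "\<phi> n x = 0" "partial k (\<phi> n) x = 0" if "x \<notin> K'" for n x k
  proof -
    have "x \<notin> supp (\<phi> n)" using \<phi>(2) that by blast
    then show "\<phi> n x = 0" "partial k (\<phi> n) x = 0" by (simp_all add: zero_off_supp partial_zero_off_supp)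
  qed
  have I: "(LINT x|lebesgue_on \<Omega>. F x * cnj (q x)) = (LINT x|lebesgue_on K'. F x * cnj (q x))"
    if "\<And>x. x \<notin> K' \<Longrightarrow> q x = 0" for F q :: "real ^ 'n \<Rightarrow> complex"
    by (rule integral_lebesgue_on_subset[OF s K'(2)]) (use that in auto)
  have u2: "sqint (lebesgue_on K') u" using u K' by (auto simp: H1loc_def L2loc_sqint)
  have g2: "sqint (lebesgue_on K') (weak_partial \<Omega> k u)" for k
    by (rule L2loc_sqint[OF H1loc_weak_partial(2)[OF \<Omega> u] K'(1,2)])
  have T: "(\<lambda>n. LINT x|lebesgue_on K'. F x * cnj (Q n x)) \<longlonglongrightarrow> (LINT x|lebesgue_on K'. F x * cnj (q x))"
    if "sqint (lebesgue_on K') F" "sqlim (lebesgue_on K') Q q" for F Q q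
    using tendsto_integral_mult[OF sqlim_const[OF that(1)] sqlim_cnj[OF that(2)]] .
  have E: "elliptic_op \<Omega> a b c c0 u (\<phi> n) = (\<Sum>k\<in>UNIV. \<Sum>l\<in>UNIV. LINT x|lebesgue_on K'.
        (complex_of_real (a k l x) * weak_partial \<Omega> l u x) * cnj (partial k (\<phi> n) x)) +
     (\<Sum>k\<in>UNIV. LINT x|lebesgue_on K'. (b k x * u x) * cnj (partial k (\<phi> n) x)) +
     (\<Sum>k\<in>UNIV. LINT x|lebesgue_on K'. (complex_of_real (c k x) * weak_partial \<Omega> k u x) * cnj (\<phi> n x)) +
     (LINT x|lebesgue_on K'. (c0 x * u x) * cnj (\<phi> n x))" for n
  proof -
    have "(LINT x|lebesgue_on \<Omega>. F x * cnj (\<phi> n x)) = (LINT x|lebesgue_on K'. F x * cnj (\<phi> n x))"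
      "(LINT x|lebesgue_on \<Omega>. F x * cnj (partial k (\<phi> n) x)) = (LINT x|lebesgue_on K'. F x * cnj (partial k (\<phi> n) x))"
      for F k by (rule I, erule z)+
    then show ?thesis unfolding elliptic_op_def by (simp only:)
  qed
  have "(\<lambda>n. elliptic_op \<Omega> a b c c0 u (\<phi> n)) \<longlonglongrightarrow> (\<Sum>k\<in>UNIV. \<Sum>l\<in>UNIV. LINT x|lebesgue_on K'.
        complex_of_real (a k l x) * weak_partial \<Omega> l u x * cnj (h k x)) +
     (\<Sum>k\<in>UNIV. LINT x|lebesgue_on K'. b k x * u x * cnj (h k x)) +
     (\<Sum>k\<in>UNIV. LINT x|lebesgue_on K'. complex_of_real (c k x) * weak_partial \<Omega> k u x * cnj (v x)) +
     (LINT x|lebesgue_on K'. c0 x * u x * cnj (v x))" (is "_ \<longlonglongrightarrow> ?lim")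
    unfolding E
    by (intro tendsto_add tendsto_sum T l' sqint_coefficient[OF _ K'(2)] a b c c0 bdd_measurable_of_real u2 g2)
  then have "(\<lambda>n. norm (elliptic_op \<Omega> a b c c0 u (\<phi> n))) \<longlonglongrightarrow> norm ?lim" by (rule tendsto_norm)
  moreover have N: "sqnorm (lebesgue_on \<Omega>) q = sqnorm (lebesgue_on K') q" if "\<And>x. x \<notin> K' \<Longrightarrow> q x = 0" for q :: "real ^ 'n \<Rightarrow> complex"
  proof -
    have "zero_ext \<Omega> q = zero_ext K' q" using that K'(2) by (auto simp: fun_eq_iff split: split_indicator)
    then show ?thesis by (simp add: sqnorm_lebesgue_on s)
  qed
  have H: "H1_norm \<Omega> (\<phi> n) = sqrt (sqnorm (lebesgue_on K') (\<phi> n) + (\<Sum>k\<in>UNIV. sqnorm (lebesgue_on K') (partial k (\<phi> n))))" for n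
  proof -
    have "smooth (\<phi> n)" using \<phi>(1)[of n] by (simp add: test_functions_iff)
    then have "H1_norm \<Omega> (\<phi> n) = sqrt (sqnorm (lebesgue_on \<Omega>) (\<phi> n) + (\<Sum>k\<in>UNIV. sqnorm (lebesgue_on \<Omega>) (partial k (\<phi> n))))"
      by (intro H1_norm_eq \<Omega> is_weak_partial_test)
    moreover have "sqnorm (lebesgue_on \<Omega>) (\<phi> n) = sqnorm (lebesgue_on K') (\<phi> n)"
      "sqnorm (lebesgue_on \<Omega>) (partial k (\<phi> n)) = sqnorm (lebesgue_on K') (partial k (\<phi> n))" for k
      by (rule N, erule z)+
    ultimately show ?thesis by (simp only:)
  qed
  have "(\<lambda>n. C * H1_norm \<Omega> (\<phi> n)) \<longlonglongrightarrow> C * sqrt (sqnorm (lebesgue_on K') v + (\<Sum>k\<in>UNIV. sqnorm (lebesgue_on K') (h k)))"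
    unfolding H by (intro tendsto_mult tendsto_const tendsto_real_sqrt tendsto_add tendsto_sum sqlim_sqnorm l')
  ultimately have "norm ?lim \<le> C * sqrt (sqnorm (lebesgue_on K') v + (\<Sum>k\<in>UNIV. sqnorm (lebesgue_on K') (h k)))"
    by (rule LIMSEQ_le) (use C[OF \<phi>(1)] in auto)
  with K' that show ?thesis by blast
qed

lemma young_lower: "0 < t \<Longrightarrow> - (t * x\<^sup>2 + y\<^sup>2 / (4 * t)) \<le> x * (y :: real)"
proof -
  assume t: "0 < t"
  have "0 \<le> (2 * t * x + y)\<^sup>2 / (4 * t)" using t by simp
  also have "\<dots> = t * x\<^sup>2 + x * y + y\<^sup>2 / (4 * t)"
    using t by (simp add: field_simps power2_eq_square)
  finally show ?thesis by simp
qed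

lemma energy_pointwise:
  fixes a :: "'n :: finite \<Rightarrow> 'n \<Rightarrow> real" and p d e \<beta> \<gamma> :: "'n \<Rightarrow> real"
  assumes el: "\<mu> * (\<Sum>k\<in>UNIV. (chi * p k)\<^sup>2) \<le> (\<Sum>k\<in>UNIV. \<Sum>l\<in>UNIV. a k l * (chi * p k) * (chi * p l))"
    and \<mu>: "0 < \<mu>" and B: "0 \<le> B" "\<And>k l. \<bar>a k l\<bar> \<le> B" "\<And>k. \<bar>\<beta> k\<bar> \<le> B" "\<And>k. \<bar>\<gamma> k\<bar> \<le> B" "\<bar>\<delta>\<bar> \<le> B"
    and chi: "0 \<le> chi" "chi \<le> 1" and \<psi>: "0 < \<psi>" "\<psi> \<le> M * chi" and M: "0 \<le> M" "\<bar>u\<bar> \<le> M"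
    and h: "\<And>k. h k = chi * (chi * p k + u * d k - M * e k) + \<psi> * d k"
    and N: "N = real CARD('n)"
    and \<kappa>: "\<kappa> = (2 * N\<^sup>2 * B\<^sup>2 / \<mu> + 1) * (8 * M\<^sup>2) + N * (2 * B\<^sup>2 / \<mu> + B\<^sup>2 + 2 * B\<^sup>2 * M\<^sup>2 / \<mu>) + B * M"
  shows "(\<mu> / 2) * (\<Sum>k\<in>UNIV. (chi * p k)\<^sup>2) - \<kappa> * (1 + (\<Sum>k\<in>UNIV. (d k)\<^sup>2) + (\<Sum>k\<in>UNIV. (e k)\<^sup>2))
    \<le> (\<Sum>k\<in>UNIV. \<Sum>l\<in>UNIV. a k l * p l * h k) + (\<Sum>k\<in>UNIV. \<beta> k * h k)
       + (\<Sum>k\<in>UNIV. \<gamma> k * p k * (chi * \<psi>)) + \<delta> * (chi * \<psi>)"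
proof -
  define P where "P k = chi * p k" for k
  define \<theta> where "\<theta> = \<psi> / chi"
  have "0 < M * chi" using \<psi> by linarith
  then have chi0: "0 < chi" using chi(1) M(1) by (simp add: zero_less_mult_iff)
  have \<psi>_eq: "\<psi> = \<theta> * chi" using chi0 by (simp add: \<theta>_def)
  have \<theta>: "0 \<le> \<theta>" "\<theta> \<le> M" using \<psi> chi0 by (auto simp: \<theta>_def divide_le_eq)
  have \<psi>M: "\<psi> \<le> M" using \<psi>(2) mult_left_mono[OF chi(2) M(1)] by simp
  define r where "r k = u * d k - M * e k + \<theta> * d k" for k
  define t where "t k = 2 * M * \<bar>d k\<bar> + M * \<bar>e k\<bar>" for k
  have t0: "0 \<le> t k" for k using M by (simp add: t_def)
  have t2: "(t k)\<^sup>2 \<le> 8 * M\<^sup>2 * ((d k)\<^sup>2 + (e k)\<^sup>2)" for k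
  proof -
    have "(t k)\<^sup>2 \<le> 2 * (2 * M * \<bar>d k\<bar>)\<^sup>2 + 2 * (M * \<bar>e k\<bar>)\<^sup>2"
      using norm_add_sq_le[of "2 * M * \<bar>d k\<bar>" "M * \<bar>e k\<bar>"] by (simp add: t_def)
    also have "\<dots> = 8 * M\<^sup>2 * (d k)\<^sup>2 + 2 * M\<^sup>2 * (e k)\<^sup>2" by (simp add: power_mult_distrib)
    also have "\<dots> \<le> 8 * M\<^sup>2 * (d k)\<^sup>2 + 8 * M\<^sup>2 * (e k)\<^sup>2" by (intro add_mono mult_right_mono) auto
    finally show ?thesis by (simp add: distrib_left)
  qed
  have ud: "\<bar>u * d k\<bar> \<le> M * \<bar>d k\<bar>" "\<bar>M * e k\<bar> = M * \<bar>e k\<bar>" for k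
    using M by (auto simp: abs_mult intro: mult_right_mono)
  have rt: "\<bar>r k\<bar> \<le> t k" for k
  proof -
    have "\<bar>\<theta> * d k\<bar> \<le> M * \<bar>d k\<bar>" using \<theta> by (auto simp: abs_mult intro: mult_right_mono)
    with ud[of k] show ?thesis unfolding r_def t_def by linarith
  qed
  have Nn: "0 < N" by (simp add: N)
  define \<tau> where "\<tau> = \<mu> / (8 * N)"
  have \<tau>: "0 < \<tau>" using \<mu> Nn by (simp add: \<tau>_def)
  have A1: "a k l * p l * h k \<ge> a k l * P k * P l - \<tau> * (P l)\<^sup>2 - B\<^sup>2 / (4 * \<tau>) * (t k)\<^sup>2" for k l
  proof -
    have "a k l * p l * h k = a k l * P k * P l + P l * (a k l * r k)"
      by (simp add: h P_def r_def \<psi>_eq algebra_simps)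
    moreover have "- (\<tau> * (P l)\<^sup>2 + (a k l * r k)\<^sup>2 / (4 * \<tau>)) \<le> P l * (a k l * r k)" by (rule young_lower[OF \<tau>])
    moreover have "(a k l * r k)\<^sup>2 / (4 * \<tau>) \<le> B\<^sup>2 / (4 * \<tau>) * (t k)\<^sup>2"
    proof -
      have "\<bar>a k l * r k\<bar> \<le> B * t k" unfolding abs_mult using B rt t0 by (intro mult_mono) auto
      then have "\<bar>a k l * r k\<bar>\<^sup>2 \<le> (B * t k)\<^sup>2" by (intro power_mono) auto
      then have "(a k l * r k)\<^sup>2 / (4 * \<tau>) \<le> (B * t k)\<^sup>2 / (4 * \<tau>)" using \<tau> by (intro divide_right_mono) auto
      then show ?thesis by (simp add: power_mult_distrib)
    qed
    ultimately show ?thesis by linarith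
  qed
  have A2: "\<beta> k * h k \<ge> - (\<mu> / 8 * (P k)\<^sup>2) - 2 * B\<^sup>2 / \<mu> - B\<^sup>2 - (t k)\<^sup>2" for k
  proof -
    have hb: "\<bar>h k\<bar> \<le> \<bar>P k\<bar> + t k"
    proof -
      have "\<bar>chi * (P k + u * d k - M * e k)\<bar> \<le> 1 * \<bar>P k + u * d k - M * e k\<bar>"
        unfolding abs_mult using chi by (intro mult_right_mono) auto
      moreover have "\<bar>\<psi> * d k\<bar> \<le> M * \<bar>d k\<bar>" using \<psi>(1) \<psi>M by (auto simp: abs_mult intro: mult_right_mono)
      moreover have "\<bar>X + Y\<bar> \<le> \<bar>p\<bar> + (2 * z + w)"
        if "\<bar>X\<bar> \<le> 1 * \<bar>p + x - y\<bar>" "\<bar>Y\<bar> \<le> z" "\<bar>x\<bar> \<le> z" "\<bar>y\<bar> = w" for X Y p x y z w :: real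
        using that abs_triangle_ineq[of X Y] abs_triangle_ineq[of p x] abs_triangle_ineq4[of "p + x" y] by simp
      ultimately show ?thesis using ud[of k] unfolding h P_def[symmetric] t_def mult.assoc[of 2] by blast
    qed
    have "\<bar>\<beta> k * h k\<bar> \<le> B * (\<bar>P k\<bar> + t k)" unfolding abs_mult using B hb by (intro mult_mono) auto
    moreover have "- (\<mu> / 8 * \<bar>P k\<bar>\<^sup>2 + (- B)\<^sup>2 / (4 * (\<mu> / 8))) \<le> \<bar>P k\<bar> * (- B)"
      using \<mu> by (intro young_lower) auto
    moreover have "- (1 * (t k)\<^sup>2 + (- B)\<^sup>2 / (4 * 1)) \<le> t k * (- B)" by (intro young_lower) auto
    moreover have "(- B)\<^sup>2 / (4 * (\<mu> / 8)) = 2 * B\<^sup>2 / \<mu>" using \<mu> by simp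
    moreover have "(- B)\<^sup>2 / (4 * 1) \<le> B\<^sup>2" by simp
    ultimately show ?thesis
      using abs_ge_minus_self[of "\<beta> k * h k"]
      by (simp add: distrib_left mult.commute) (insert zero_le_power2[of B], linarith)
  qed
  have A3: "\<gamma> k * p k * (chi * \<psi>) \<ge> - (\<mu> / 8 * (P k)\<^sup>2) - 2 * B\<^sup>2 * M\<^sup>2 / \<mu>" for k
  proof -
    have "\<gamma> k * p k * (chi * \<psi>) = P k * (\<gamma> k * \<psi>)" by (simp add: P_def mult_ac)
    moreover have "- (\<mu> / 8 * (P k)\<^sup>2 + (\<gamma> k * \<psi>)\<^sup>2 / (4 * (\<mu> / 8))) \<le> P k * (\<gamma> k * \<psi>)"
      using \<mu> by (intro young_lower) auto
    moreover have "(\<gamma> k * \<psi>)\<^sup>2 / (4 * (\<mu> / 8)) \<le> 2 * B\<^sup>2 * M\<^sup>2 / \<mu>"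
    proof -
      have "\<bar>\<gamma> k * \<psi>\<bar> \<le> B * M" unfolding abs_mult using B(1,4) \<psi>(1) \<psi>M by (intro mult_mono) auto
      then have "\<bar>\<gamma> k * \<psi>\<bar>\<^sup>2 \<le> (B * M)\<^sup>2" by (intro power_mono) auto
      then have "(\<gamma> k * \<psi>)\<^sup>2 \<le> B\<^sup>2 * M\<^sup>2" by (simp add: power_mult_distrib)
      then have "2 * (\<gamma> k * \<psi>)\<^sup>2 / \<mu> \<le> 2 * (B\<^sup>2 * M\<^sup>2) / \<mu>" using \<mu> by (intro divide_right_mono) auto
      moreover have "x / (4 * (\<mu> / 8)) = 2 * x / \<mu>" for x using \<mu> by simp
      ultimately show ?thesis by (simp only: mult.assoc)
    qed
    ultimately show ?thesis by linarith
  qed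
  have A4: "\<delta> * (chi * \<psi>) \<ge> - (B * M)"
  proof -
    have "chi * \<psi> \<le> 1 * M" using chi \<psi> \<psi>M by (intro mult_mono) auto
    moreover have "0 \<le> chi * \<psi>" using chi \<psi> by simp
    ultimately have "\<bar>\<delta>\<bar> * \<bar>chi * \<psi>\<bar> \<le> B * M" using B(1,5) by (intro mult_mono) auto
    then have "\<bar>\<delta> * (chi * \<psi>)\<bar> \<le> B * M" by (simp only: abs_mult[symmetric])
    then show ?thesis by linarith
  qed
  define S where "S = (\<Sum>k\<in>UNIV. (P k)\<^sup>2)"
  define T where "T = (\<Sum>k\<in>UNIV. (t k)\<^sup>2)"
  define D where "D = (\<Sum>k\<in>UNIV. (d k)\<^sup>2) + (\<Sum>k\<in>UNIV. (e k)\<^sup>2)"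
  have D0: "0 \<le> D" by (simp add: D_def sum_nonneg)
  have TD: "T \<le> 8 * M\<^sup>2 * D"
    unfolding T_def D_def sum.distrib[symmetric] sum_distrib_left by (rule sum_mono) (rule t2)
  have "(\<Sum>k\<in>UNIV. \<Sum>l\<in>UNIV. a k l * P k * P l - \<tau> * (P l)\<^sup>2 - B\<^sup>2 / (4 * \<tau>) * (t k)\<^sup>2)
     \<le> (\<Sum>k\<in>UNIV. \<Sum>l\<in>UNIV. a k l * p l * h k)"
    by (intro sum_mono A1)
  moreover have "(\<Sum>k\<in>UNIV. \<Sum>l\<in>UNIV. a k l * P k * P l - \<tau> * (P l)\<^sup>2 - B\<^sup>2 / (4 * \<tau>) * (t k)\<^sup>2) =
     (\<Sum>k\<in>UNIV. \<Sum>l\<in>UNIV. a k l * P k * P l) - N * (\<tau> * S) - B\<^sup>2 / (4 * \<tau>) * (N * T)"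
    by (simp add: sum_subtractf S_def T_def N sum_distrib_left mult_ac)
  moreover have "\<mu> * S \<le> (\<Sum>k\<in>UNIV. \<Sum>l\<in>UNIV. a k l * P k * P l)" using el by (simp add: S_def P_def)
  moreover have "N * (\<tau> * S) = \<mu> / 8 * S" using Nn by (simp add: \<tau>_def)
  moreover have "B\<^sup>2 / (4 * \<tau>) * (N * T) = 2 * N\<^sup>2 * B\<^sup>2 / \<mu> * T"
    using Nn \<mu> by (simp add: \<tau>_def field_simps power2_eq_square)
  ultimately have s1: "\<mu> * S - \<mu> / 8 * S - 2 * N\<^sup>2 * B\<^sup>2 / \<mu> * T \<le> (\<Sum>k\<in>UNIV. \<Sum>l\<in>UNIV. a k l * p l * h k)"
    by linarith
  have "(\<Sum>k\<in>UNIV. - (\<mu> / 8 * (P k)\<^sup>2) - 2 * B\<^sup>2 / \<mu> - B\<^sup>2 - (t k)\<^sup>2) \<le> (\<Sum>k\<in>UNIV. \<beta> k * h k)"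
    by (intro sum_mono A2)
  moreover have "(\<Sum>k\<in>UNIV. - (\<mu> / 8 * (P k)\<^sup>2) - 2 * B\<^sup>2 / \<mu> - B\<^sup>2 - (t k)\<^sup>2) = - (\<mu> / 8 * S) - N * (2 * B\<^sup>2 / \<mu>) - N * B\<^sup>2 - T"
    by (simp add: sum_subtractf sum_negf S_def T_def N sum_distrib_left)
  ultimately have s2: "- (\<mu> / 8 * S) - N * (2 * B\<^sup>2 / \<mu>) - N * B\<^sup>2 - T \<le> (\<Sum>k\<in>UNIV. \<beta> k * h k)" by linarith
  have "(\<Sum>k\<in>UNIV. - (\<mu> / 8 * (P k)\<^sup>2) - 2 * B\<^sup>2 * M\<^sup>2 / \<mu>) \<le> (\<Sum>k\<in>UNIV. \<gamma> k * p k * (chi * \<psi>))"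
    by (intro sum_mono A3)
  moreover have "(\<Sum>k\<in>UNIV. - (\<mu> / 8 * (P k)\<^sup>2) - 2 * B\<^sup>2 * M\<^sup>2 / \<mu>) = - (\<mu> / 8 * S) - N * (2 * B\<^sup>2 * M\<^sup>2 / \<mu>)"
    by (simp add: sum_subtractf sum_negf S_def N sum_distrib_left)
  ultimately have s3: "- (\<mu> / 8 * S) - N * (2 * B\<^sup>2 * M\<^sup>2 / \<mu>) \<le> (\<Sum>k\<in>UNIV. \<gamma> k * p k * (chi * \<psi>))" by linarith
  have S0: "0 \<le> \<mu> / 8 * S" using \<mu> by (simp add: S_def sum_nonneg)
  define k1 where "k1 = 2 * N\<^sup>2 * B\<^sup>2 / \<mu> + 1"
  define k2 where "k2 = N * (2 * B\<^sup>2 / \<mu>) + N * B\<^sup>2 + N * (2 * B\<^sup>2 * M\<^sup>2 / \<mu>) + B * M"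
  have k: "0 \<le> k1" "0 \<le> k2" using \<mu> Nn B(1) M(1) by (auto simp: k1_def k2_def intro!: add_nonneg_nonneg)
  have \<kappa>': "\<kappa> = k1 * (8 * M\<^sup>2) + k2" by (simp add: \<kappa> k1_def k2_def distrib_left)
  have "k1 * T \<le> k1 * (8 * M\<^sup>2 * D)" by (rule mult_left_mono[OF TD k(1)])
  moreover have "k1 * (8 * M\<^sup>2 * D) + k2 \<le> \<kappa> * (1 + D)"
  proof -
    have "0 \<le> k1 * (8 * M\<^sup>2)" "0 \<le> k2 * D" using k D0 by auto
    then show ?thesis by (simp add: \<kappa>' algebra_simps)
  qed
  moreover have "\<mu> * S - \<mu> / 8 * S - \<mu> / 8 * S - \<mu> / 8 * S = \<mu> / 2 * S + \<mu> / 8 * S" by (simp add: field_simps)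
  moreover have "k1 * T = 2 * N\<^sup>2 * B\<^sup>2 / \<mu> * T + T" by (simp add: k1_def distrib_right)
  ultimately have "\<mu> / 2 * S - \<kappa> * (1 + D) \<le> (\<Sum>k\<in>UNIV. \<Sum>l\<in>UNIV. a k l * p l * h k) + (\<Sum>k\<in>UNIV. \<beta> k * h k)
       + (\<Sum>k\<in>UNIV. \<gamma> k * p k * (chi * \<psi>)) + \<delta> * (chi * \<psi>)"
    using s1 s2 s3 A4 S0 unfolding k2_def by linarith
  then show ?thesis by (simp only: S_def P_def D_def add.assoc)
qed

lemma bdd_measurable_bound:
  "bdd_measurable \<Omega> f \<Longrightarrow> \<exists>B\<ge>0. \<forall>x\<in>\<Omega>. norm (f x) \<le> B"
  unfolding bdd_measurable_def bounded_pos by (auto intro: less_imp_le)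

lemma L2loc_bmult:
  assumes "f \<in> L2loc \<Omega>" "g \<in> borel_measurable (lebesgue_on \<Omega>)" "\<And>x. x \<in> \<Omega> \<Longrightarrow> norm (g x) \<le> B"
  shows "(\<lambda>x. g x * f x) \<in> L2loc \<Omega>"
  unfolding L2loc_def L2_iff
proof (intro CollectI allI impI)
  fix K assume K: "compact K \<and> K \<subseteq> \<Omega>"
  show "sqint (lebesgue_on K) (\<lambda>x. g x * f x)"
  proof (rule sqint_bmult[of _ _ _ B])
    show "sqint (lebesgue_on K) f" using assms(1) K by (simp add: L2loc_sqint)
    show "g \<in> borel_measurable (lebesgue_on K)" using K assms(2) by (auto intro: measurable_restrict_mono)
    show "AE x in lebesgue_on K. norm (g x) \<le> B" by (rule AE_I2) (use K assms(3) in auto)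
  qed
qed

lemma L2loc_add: "f \<in> L2loc \<Omega> \<Longrightarrow> g \<in> L2loc \<Omega> \<Longrightarrow> (\<lambda>x. f x + g x) \<in> L2loc \<Omega>"
  unfolding L2loc_def L2_iff by (simp add: sqint_add)

lemma L2loc_diff: "f \<in> L2loc \<Omega> \<Longrightarrow> g \<in> L2loc \<Omega> \<Longrightarrow> (\<lambda>x. f x - g x) \<in> L2loc \<Omega>"
  unfolding L2loc_def L2_iff by (simp add: sqint_diff)

lemma L2loc_cmult: "f \<in> L2loc \<Omega> \<Longrightarrow> (\<lambda>x. c * f x) \<in> L2loc \<Omega>"
  unfolding L2loc_def L2_iff by (simp add: sqint_cmult)

lemma L2loc_Re: "f \<in> L2loc \<Omega> \<Longrightarrow> (\<lambda>x. complex_of_real (Re (f x))) \<in> L2loc \<Omega>"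
  unfolding L2loc_def L2_iff by (simp add: sqint_Re)

lemma sqint_const:
  assumes "S \<in> lmeasurable" shows "sqint (lebesgue_on S) (\<lambda>x. c)"
  using finite_measure.integrable_const[OF finite_measure_lebesgue_on[OF assms], of "(norm c)\<^sup>2"] by (simp add: sqint_def)

lemma L2loc_const: "(\<lambda>x. c) \<in> L2loc \<Omega>"
  unfolding L2loc_def L2_iff by (simp add: sqint_const lmeasurable_compact)

lemma is_weak_partial_const: "open \<Omega> \<Longrightarrow> is_weak_partial \<Omega> k (\<lambda>x. c) (\<lambda>x. 0)"
  using is_weak_partial_test[OF _ smooth_const, of \<Omega> k c] by (simp add: partial_const)

lemma sqint_extend:
  fixes f :: "real ^ 'n \<Rightarrow> complex"
  assumes K: "K \<in> sets lebesgue" "L \<in> sets lebesgue" "K \<subseteq> L" and f: "f \<in> borel_measurable (lebesgue_on L)"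
    and 0: "AE x in lebesgue_on L. x \<notin> K \<longrightarrow> f x = 0" and i: "sqint (lebesgue_on K) f"
  shows "sqint (lebesgue_on L) f" "sqnorm (lebesgue_on L) f = sqnorm (lebesgue_on K) f"
proof -
  have ae: "AE x in lebesgue. zero_ext K f x = zero_ext L f x"
  proof -
    have "AE x in lebesgue. x \<in> L \<longrightarrow> x \<notin> K \<longrightarrow> f x = 0" using 0 K by (simp add: AE_lebesgue_on)
    then show ?thesis by eventually_elim (use K(3) in \<open>auto split: split_indicator\<close>)
  qed
  have m: "zero_ext L f \<in> borel_measurable lebesgue"
    using f K by (subst (asm) borel_measurable_restrict_space_iff) auto
  have iK: "sqint lebesgue (zero_ext K f)" using i K by (simp add: sqint_lebesgue_on)
  show "sqint (lebesgue_on L) f" using sqint_cong_AE[OF iK ae m] K by (simp add: sqint_lebesgue_on)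
  show "sqnorm (lebesgue_on L) f = sqnorm (lebesgue_on K) f"
    using sqnorm_cong_AE[OF ae sqint_measurable[OF iK] m] K by (simp add: sqnorm_lebesgue_on)
qed

lemma square_sum3_le: "(x + y + z)\<^sup>2 \<le> 3 * x\<^sup>2 + 3 * y\<^sup>2 + 3 * (z :: real)\<^sup>2"
proof -
  have "0 \<le> (x - y)\<^sup>2 + (y - z)\<^sup>2 + (x - z)\<^sup>2" by simp
  then show ?thesis by (simp add: power2_eq_square algebra_simps)
qed

lemma Young_sqrt:
  assumes "0 < s" "0 \<le> X" shows "c * sqrt X \<le> s * X + c\<^sup>2 / (4 * s)"
  using young_lower[OF assms(1), of "sqrt X" "- c"] assms(2) by (simp add: mult.commute)

lemma cutoff_difference:
  fixes chi u1 \<eta> :: "real ^ 'n \<Rightarrow> real" and d p e :: "'n \<Rightarrow> real ^ 'n \<Rightarrow> real"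
  assumes \<Omega>: "open \<Omega>"
    and chi: "(\<lambda>x. complex_of_real (chi x)) \<in> L2loc \<Omega>" "\<And>x. x \<in> \<Omega> \<Longrightarrow> \<bar>chi x\<bar> \<le> 1"
    and d: "\<And>k. (\<lambda>x. complex_of_real (d k x)) \<in> L2loc \<Omega>"
    and wchi: "\<And>k. is_weak_partial \<Omega> k (\<lambda>x. complex_of_real (chi x)) (\<lambda>x. complex_of_real (d k x))"
    and u1: "(\<lambda>x. complex_of_real (u1 x)) \<in> L2loc \<Omega>" "\<And>x. x \<in> \<Omega> \<Longrightarrow> \<bar>u1 x\<bar> \<le> M"
    and p: "\<And>k. (\<lambda>x. complex_of_real (p k x)) \<in> L2loc \<Omega>"
    and wu: "\<And>k. is_weak_partial \<Omega> k (\<lambda>x. complex_of_real (u1 x)) (\<lambda>x. complex_of_real (p k x))"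
    and \<eta>: "(\<lambda>x. complex_of_real (\<eta> x)) \<in> L2loc \<Omega>" and e: "\<And>k. (\<lambda>x. complex_of_real (e k x)) \<in> L2loc \<Omega>"
    and w\<eta>: "\<And>k. is_weak_partial \<Omega> k (\<lambda>x. complex_of_real (\<eta> x)) (\<lambda>x. complex_of_real (e k x))"
  shows "(\<lambda>x. complex_of_real (chi x * u1 x - \<epsilon> - M * \<eta> x)) \<in> L2loc \<Omega>"
    and "(\<lambda>x. complex_of_real (chi x * p k x + u1 x * d k x - M * e k x)) \<in> L2loc \<Omega>"
    and "is_weak_partial \<Omega> k (\<lambda>x. complex_of_real (chi x * u1 x - \<epsilon> - M * \<eta> x))
      (\<lambda>x. complex_of_real (chi x * p k x + u1 x * d k x - M * e k x))"
proof -
  let ?c = complex_of_real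
  note Lm = L1loc_measurable[OF \<Omega> L2loc_L1loc]
  have b: "norm (?c (chi x)) \<le> 1" "norm (?c (u1 x)) \<le> M" if "x \<in> \<Omega>" for x
    using chi(2)[OF that] u1(2)[OF that] by simp_all
  show "(\<lambda>x. ?c (chi x * u1 x - \<epsilon> - M * \<eta> x)) \<in> L2loc \<Omega>"
    unfolding of_real_diff of_real_mult
    by (intro L2loc_diff L2loc_bmult[OF u1(1) Lm[OF chi(1)] b(1)] L2loc_const L2loc_cmult \<eta>)
  show "(\<lambda>x. ?c (chi x * p k x + u1 x * d k x - M * e k x)) \<in> L2loc \<Omega>"
    unfolding of_real_diff of_real_mult of_real_add
    by (intro L2loc_diff L2loc_add L2loc_bmult[OF p Lm[OF chi(1)] b(1)] L2loc_bmult[OF d Lm[OF u1(1)] b(2)] L2loc_cmult e)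
  have "is_weak_partial \<Omega> k (\<lambda>x. (?c (chi x) * ?c (u1 x) - ?c \<epsilon>) - ?c M * ?c (\<eta> x))
     (\<lambda>x. ((?c (chi x) * ?c (p k x) + ?c (d k x) * ?c (u1 x)) - 0) - ?c M * ?c (e k x))"
    by (intro is_weak_partial_diff \<Omega> is_weak_partial_mult[OF \<Omega> chi(1) d wchi u1(1) p wu]
          is_weak_partial_const is_weak_partial_cmult w\<eta>)
  then show "is_weak_partial \<Omega> k (\<lambda>x. ?c (chi x * u1 x - \<epsilon> - M * \<eta> x))
      (\<lambda>x. ?c (chi x * p k x + u1 x * d k x - M * e k x))"
    by (simp add: mult.commute[of "?c (d k _)"])
qed

text \<open>The test function for the equation is \<open>v = chi * f\<^sup>+\<close>; on its support
  \<open>chi * grad (Re u)\<close> is \<open>grad f\<^sup>+\<close> up to terms bounded in \<open>L\<^sup>2\<close>, and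
  \<open>0 \<le> f\<^sup>+ \<le> M * chi\<close> allows to absorb the terms containing \<open>grad chi\<close>.\<close>

lemma energy_estimate:
  fixes \<Omega> :: "(real ^ 'n) set" and a :: "'n \<Rightarrow> 'n \<Rightarrow> real ^ 'n \<Rightarrow> real" and b :: "'n \<Rightarrow> real ^ 'n \<Rightarrow> complex"
    and c :: "'n \<Rightarrow> real ^ 'n \<Rightarrow> real" and d :: "'n \<Rightarrow> real ^ 'n \<Rightarrow> real" and chi :: "real ^ 'n \<Rightarrow> real"
  assumes \<Omega>: "open \<Omega>" "bounded \<Omega>"
    and a: "\<And>k l. bdd_measurable \<Omega> (a k l)" and b: "\<And>k. bdd_measurable \<Omega> (b k)"
    and c: "\<And>k. bdd_measurable \<Omega> (c k)" and c0: "bdd_measurable \<Omega> c0"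
    and \<mu>: "0 < \<mu>"
    and el: "\<And>x \<xi>. x \<in> \<Omega> \<Longrightarrow> \<mu> * (\<Sum>k\<in>UNIV. (\<xi> k)\<^sup>2) \<le> (\<Sum>k\<in>UNIV. \<Sum>l\<in>UNIV. a k l x * \<xi> k * \<xi> l)"
    and u: "u \<in> H1loc \<Omega>"
    and C: "\<And>v. v \<in> test_functions \<Omega> \<Longrightarrow> norm (elliptic_op \<Omega> a b c c0 u v) \<le> C * H1_norm \<Omega> v"
    and M: "0 < M" "\<And>x. x \<in> \<Omega> \<Longrightarrow> norm (u x) \<le> M"
    and chi: "\<And>x. x \<in> \<Omega> \<Longrightarrow> 0 \<le> chi x \<and> chi x \<le> 1" "(\<lambda>x. complex_of_real (chi x)) \<in> L2 \<Omega>"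
    and d: "\<And>k. (\<lambda>x. complex_of_real (d k x)) \<in> L2 \<Omega>"
    and wchi: "\<And>k. is_weak_partial \<Omega> k (\<lambda>x. complex_of_real (chi x)) (\<lambda>x. complex_of_real (d k x))"
  shows "\<exists>E. \<forall>\<epsilon> \<eta> e K f P k. 0 < \<epsilon> \<longrightarrow> (\<forall>x. 0 \<le> \<eta> x) \<longrightarrow> (\<lambda>x. complex_of_real (\<eta> x)) \<in> L2 \<Omega> \<longrightarrow>
      (\<forall>k. (\<lambda>x. complex_of_real (e k x)) \<in> L2 \<Omega>) \<longrightarrow>
      (\<forall>k. is_weak_partial \<Omega> k (\<lambda>x. complex_of_real (\<eta> x)) (\<lambda>x. complex_of_real (e k x))) \<longrightarrow>
      (\<Sum>k\<in>UNIV. sqnorm (lebesgue_on \<Omega>) (\<lambda>x. complex_of_real (e k x))) \<le> 1 \<longrightarrow>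
      compact K \<longrightarrow> K \<subseteq> \<Omega> \<longrightarrow> f = (\<lambda>x. chi x * Re (u x) - \<epsilon> - M * \<eta> x) \<longrightarrow>
      (AE x in lebesgue_on \<Omega>. x \<notin> K \<longrightarrow> f x \<le> 0) \<longrightarrow>
      P = (\<lambda>k x. complex_of_real (if 0 < f x then chi x * Re (weak_partial \<Omega> k u x) else 0)) \<longrightarrow>
      sqint (lebesgue_on \<Omega>) (P k) \<and> sqnorm (lebesgue_on \<Omega>) (P k) \<le> E"
proof -
  let ?c = complex_of_real
  define p where "p k x = Re (weak_partial \<Omega> k u x)" for k x
  define u1 where "u1 x = Re (u x)" for x
  have lm: "\<Omega> \<in> lmeasurable" using \<Omega>(2,1) by (rule lmeasurable_open)
  have s\<Omega>: "\<Omega> \<in> sets lebesgue" using \<Omega> by (simp add: open_lebesgue)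
  have uL: "u \<in> L2loc \<Omega>" using u by (simp add: H1loc_def)
  note gu = H1loc_weak_partial[OF \<Omega>(1) u]
  have u1L: "(\<lambda>x. ?c (u1 x)) \<in> L2loc \<Omega>" unfolding u1_def by (rule L2loc_Re[OF uL])
  have pL: "(\<lambda>x. ?c (p k x)) \<in> L2loc \<Omega>" for k unfolding p_def by (rule L2loc_Re[OF gu(2)])
  have wu: "is_weak_partial \<Omega> k (\<lambda>x. ?c (u1 x)) (\<lambda>x. ?c (p k x))" for k
    unfolding p_def u1_def by (rule is_weak_partial_Re[OF \<Omega>(1) gu(1)])
  have u1M: "\<bar>u1 x\<bar> \<le> M" if "x \<in> \<Omega>" for x
    using M(2)[OF that] abs_Re_le_cmod[of "u x"] by (simp add: u1_def)
  have chiL: "(\<lambda>x. ?c (chi x)) \<in> L2loc \<Omega>" by (rule L2_L2loc[OF \<Omega>(1) chi(2)])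
  have dL: "(\<lambda>x. ?c (d k x)) \<in> L2loc \<Omega>" for k by (rule L2_L2loc[OF \<Omega>(1) d])
  note Lm = L1loc_measurable[OF \<Omega>(1) L2loc_L1loc]
  note chim = Lm[OF chiL]
  have chi1': "\<bar>chi x\<bar> \<le> 1" if "x \<in> \<Omega>" for x using chi(1)[OF that] by simp
  have chi1: "norm (?c (chi x)) \<le> 1" if "x \<in> \<Omega>" for x using chi(1)[OF that] by simp
  obtain Ba where Ba: "\<And>k l. 0 \<le> Ba k l" "\<And>k l x. x \<in> \<Omega> \<Longrightarrow> \<bar>a k l x\<bar> \<le> Ba k l"
    using bdd_measurable_bound[OF a] unfolding real_norm_def by metis
  obtain Bb where Bb: "\<And>k. 0 \<le> Bb k" "\<And>k x. x \<in> \<Omega> \<Longrightarrow> norm (b k x) \<le> Bb k"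
    using bdd_measurable_bound[OF b] by metis
  obtain Bc where Bc: "\<And>k. 0 \<le> Bc k" "\<And>k x. x \<in> \<Omega> \<Longrightarrow> \<bar>c k x\<bar> \<le> Bc k"
    using bdd_measurable_bound[OF c] unfolding real_norm_def by metis
  obtain B0 where B0: "0 \<le> B0" "\<And>x. x \<in> \<Omega> \<Longrightarrow> norm (c0 x) \<le> B0"
    using bdd_measurable_bound[OF c0] by metis
  define B where "B = (\<Sum>k\<in>UNIV. \<Sum>l\<in>UNIV. Ba k l) + (\<Sum>k\<in>UNIV. Bb k * M) + (\<Sum>k\<in>UNIV. Bc k) + B0 * M"
  have parts: "0 \<le> (\<Sum>k\<in>UNIV. \<Sum>l\<in>UNIV. Ba k l)" "0 \<le> (\<Sum>k\<in>UNIV. Bb k * M)" "0 \<le> (\<Sum>k\<in>UNIV. Bc k)" "0 \<le> B0 * M"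
    using Ba(1) Bb(1) Bc(1) B0(1) M(1) by (auto intro!: sum_nonneg)
  have Bn: "0 \<le> B" using parts by (simp add: B_def)
  have Ba': "\<bar>a k l x\<bar> \<le> B" if "x \<in> \<Omega>" for k l x
  proof -
    have "Ba k l \<le> (\<Sum>l\<in>UNIV. Ba k l)" by (rule member_le_sum) (use Ba(1) in auto)
    also have "\<dots> \<le> (\<Sum>k\<in>UNIV. \<Sum>l\<in>UNIV. Ba k l)"
      by (rule member_le_sum[of k UNIV "\<lambda>k. \<Sum>l\<in>UNIV. Ba k l"]) (use Ba(1) in \<open>auto intro: sum_nonneg\<close>)
    finally show ?thesis using Ba(2)[OF that, of k l] parts unfolding B_def by linarith
  qed
  have Bb': "\<bar>Re (b k x * u x)\<bar> \<le> B" if "x \<in> \<Omega>" for k x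
  proof -
    have "\<bar>Re (b k x * u x)\<bar> \<le> norm (b k x) * norm (u x)" using abs_Re_le_cmod[of "b k x * u x"] by (simp add: norm_mult)
    also have "\<dots> \<le> Bb k * M" using Bb(2)[OF that] M(2)[OF that] Bb(1) by (intro mult_mono) auto
    also have "\<dots> \<le> (\<Sum>k\<in>UNIV. Bb k * M)" by (rule member_le_sum[of k UNIV "\<lambda>k. Bb k * M"]) (use Bb(1) M(1) in auto)
    finally show ?thesis using parts unfolding B_def by linarith
  qed
  have Bc': "\<bar>c k x\<bar> \<le> B" if "x \<in> \<Omega>" for k x
  proof -
    have "Bc k \<le> (\<Sum>k\<in>UNIV. Bc k)" by (rule member_le_sum) (use Bc(1) in auto)
    then show ?thesis using Bc(2)[OF that, of k] parts unfolding B_def by linarith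
  qed
  have B0': "\<bar>Re (c0 x * u x)\<bar> \<le> B" if "x \<in> \<Omega>" for x
  proof -
    have "\<bar>Re (c0 x * u x)\<bar> \<le> norm (c0 x) * norm (u x)" using abs_Re_le_cmod[of "c0 x * u x"] by (simp add: norm_mult)
    also have "\<dots> \<le> B0 * M" using B0(2)[OF that] M(2)[OF that] B0(1) by (intro mult_mono) auto
    finally show ?thesis using parts unfolding B_def by linarith
  qed
  define N where "N = real CARD('n)"
  define \<kappa> where "\<kappa> = (2 * N\<^sup>2 * B\<^sup>2 / \<mu> + 1) * (8 * M\<^sup>2) + N * (2 * B\<^sup>2 / \<mu> + B\<^sup>2 + 2 * B\<^sup>2 * M\<^sup>2 / \<mu>) + B * M"
  have \<kappa>0: "0 \<le> \<kappa>" using \<mu> M(1) Bn by (auto simp: \<kappa>_def N_def intro!: add_nonneg_nonneg mult_nonneg_nonneg)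
  define V where "V = sqnorm (lebesgue_on \<Omega>) (\<lambda>x. 1)"
  define D where "D = (\<Sum>k\<in>UNIV. sqnorm (lebesgue_on \<Omega>) (\<lambda>x. ?c (d k x)))"
  define E where "E = (4 / \<mu>) * (\<kappa> * (V + D + 1) + (\<mu> / 12) * (M\<^sup>2 * V + 12 * M\<^sup>2 * D + 3 * M\<^sup>2) + C\<^sup>2 / (4 * (\<mu> / 12)))"
  show ?thesis
  proof (rule exI[of _ E], intro allI impI)
    fix \<epsilon> and \<eta> :: "real ^ 'n \<Rightarrow> real" and e :: "'n \<Rightarrow> real ^ 'n \<Rightarrow> real" and K :: "(real ^ 'n) set"
      and f :: "real ^ 'n \<Rightarrow> real" and P :: "'n \<Rightarrow> real ^ 'n \<Rightarrow> complex" and k :: 'n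
    assume \<epsilon>: "0 < \<epsilon>" and \<eta>_all: "\<forall>x. 0 \<le> \<eta> x" and \<eta>2: "(\<lambda>x. ?c (\<eta> x)) \<in> L2 \<Omega>"
      and e_all: "\<forall>k. (\<lambda>x. ?c (e k x)) \<in> L2 \<Omega>" and w\<eta>_all: "\<forall>k. is_weak_partial \<Omega> k (\<lambda>x. ?c (\<eta> x)) (\<lambda>x. ?c (e k x))"
      and e1: "(\<Sum>k\<in>UNIV. sqnorm (lebesgue_on \<Omega>) (\<lambda>x. ?c (e k x))) \<le> 1"
      and K: "compact K" "K \<subseteq> \<Omega>" and f_def: "f = (\<lambda>x. chi x * Re (u x) - \<epsilon> - M * \<eta> x)"
      and f0: "AE x in lebesgue_on \<Omega>. x \<notin> K \<longrightarrow> f x \<le> 0"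
      and P_def: "P = (\<lambda>k x. ?c (if 0 < f x then chi x * Re (weak_partial \<Omega> k u x) else 0))"
    note \<eta> = \<eta>_all[rule_format] \<eta>2 and e = e_all[rule_format] and w\<eta> = w\<eta>_all[rule_format]
    have f_eq: "f x = chi x * u1 x - \<epsilon> - M * \<eta> x" for x by (simp add: f_def u1_def)
    have \<eta>L: "(\<lambda>x. ?c (\<eta> x)) \<in> L2loc \<Omega>" by (rule L2_L2loc[OF \<Omega>(1) \<eta>(2)])
    have eL: "(\<lambda>x. ?c (e k x)) \<in> L2loc \<Omega>" for k by (rule L2_L2loc[OF \<Omega>(1) e])
    define F where "F k x = chi x * p k x + u1 x * d k x - M * e k x" for k x
    note cut = cutoff_difference[OF \<Omega>(1) chiL chi1' dL wchi u1L u1M pL wu \<eta>L eL w\<eta>]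
    have fL: "(\<lambda>x. ?c (f x)) \<in> L2loc \<Omega>" unfolding f_eq by (rule cut)
    have FL: "(\<lambda>x. ?c (F k x)) \<in> L2loc \<Omega>" for k unfolding F_def by (rule cut)
    have wf: "is_weak_partial \<Omega> k (\<lambda>x. ?c (f x)) (\<lambda>x. ?c (F k x))" for k
      unfolding f_eq F_def by (rule cut)
    define \<psi> where "\<psi> x = max (f x) 0" for x
    define G where "G k x = (if 0 < f x then F k x else 0)" for k x
    note pp = is_weak_partial_pos_part[OF \<Omega>(1) fL FL wf, folded \<psi>_def G_def]
    have \<psi>M: "\<psi> x \<le> M" and \<psi>chi: "\<psi> x \<le> M * chi x" and \<psi>0: "0 \<le> \<psi> x" if "x \<in> \<Omega>" for x
    proof -
      have "chi x * u1 x \<le> chi x * M" using u1M[OF that] chi(1)[OF that] by (intro mult_left_mono) auto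
      moreover have "0 \<le> M * \<eta> x" using M(1) \<eta>(1)[of x] by simp
      moreover have "0 \<le> M * chi x" using M(1) chi(1)[OF that] by simp
      ultimately show m: "\<psi> x \<le> M * chi x" using \<epsilon> by (simp add: \<psi>_def f_eq mult.commute)
      have "M * chi x \<le> M * 1" using M(1) chi(1)[OF that] by (intro mult_left_mono) auto
      with m show "\<psi> x \<le> M" by simp
      show "0 \<le> \<psi> x" by (simp add: \<psi>_def)
    qed
    have \<psi>1: "norm (?c (\<psi> x)) \<le> M" if "x \<in> \<Omega>" for x using \<psi>M[OF that] \<psi>0[OF that] by simp
    define v where "v x = chi x * \<psi> x" for x
    define h where "h k x = chi x * G k x + d k x * \<psi> x" for k x
    have vL: "(\<lambda>x. ?c (v x)) \<in> L2loc \<Omega>"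
      unfolding v_def of_real_mult by (rule L2loc_bmult[OF pp(2) chim chi1])
    have hL: "(\<lambda>x. ?c (h k x)) \<in> L2loc \<Omega>" for k
    proof -
      have "(\<lambda>x. ?c (chi x) * ?c (G k x) + ?c (\<psi> x) * ?c (d k x)) \<in> L2loc \<Omega>"
        by (intro L2loc_add L2loc_bmult[OF pp(3) chim chi1] L2loc_bmult[OF dL Lm[OF pp(2)] \<psi>1])
      then show ?thesis by (simp add: h_def mult.commute)
    qed
    have wv: "is_weak_partial \<Omega> k (\<lambda>x. ?c (v x)) (\<lambda>x. ?c (h k x))" for k
      unfolding v_def h_def of_real_mult of_real_add
      by (rule is_weak_partial_mult[OF \<Omega>(1) chiL dL wchi pp(2) pp(3) pp(1)])
    have v0: "AE x in lebesgue_on \<Omega>. x \<notin> K \<longrightarrow> ?c (v x) = 0"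
      using f0 by eventually_elim (auto simp: v_def \<psi>_def)
    have h0: "AE x in lebesgue_on \<Omega>. x \<notin> K \<longrightarrow> ?c (h k x) = 0" for k
      using f0 by eventually_elim (auto simp: h_def \<psi>_def G_def)
    obtain K' where K': "compact K'" "K' \<subseteq> \<Omega>" "K \<subseteq> K'" and ineq:
      "norm ((\<Sum>k\<in>UNIV. \<Sum>l\<in>UNIV. LINT x|lebesgue_on K'.
        ?c (a k l x) * weak_partial \<Omega> l u x * cnj (?c (h k x))) +
       (\<Sum>k\<in>UNIV. LINT x|lebesgue_on K'. b k x * u x * cnj (?c (h k x))) +
       (\<Sum>k\<in>UNIV. LINT x|lebesgue_on K'. ?c (c k x) * weak_partial \<Omega> k u x * cnj (?c (v x))) +
       (LINT x|lebesgue_on K'. c0 x * u x * cnj (?c (v x))))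
       \<le> C * sqrt (sqnorm (lebesgue_on K') (\<lambda>x. ?c (v x)) + (\<Sum>k\<in>UNIV. sqnorm (lebesgue_on K') (\<lambda>x. ?c (h k x))))"
      (is "norm ?Z \<le> C * sqrt ?X")
      by (rule elliptic_op_extension[OF \<Omega>(1) a b c c0 u C K vL hL wv v0 h0])
    let ?M = "lebesgue_on K'"
    have sK': "K' \<in> sets lebesgue" using K' by (simp add: compact_lebesgue)
    note sub = sK' s\<Omega> K'(2)
    note Ls = L2loc_sqint[OF _ K'(1,2)]
    note S1 = Ls[OF uL] Ls[OF gu(2)] Ls[OF vL] Ls[OF hL]
    note coef = sqint_coefficient[OF _ K'(2)]
    have i1: "integrable ?M (\<lambda>x. ?c (a k l x) * weak_partial \<Omega> l u x * cnj (?c (h k x)))" for k l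
      by (rule sqint_mult_integrable[OF coef[OF bdd_measurable_of_real[OF a] S1(2)] sqint_cnj[OF S1(4)]])
    have i2: "integrable ?M (\<lambda>x. b k x * u x * cnj (?c (h k x)))" for k
      by (rule sqint_mult_integrable[OF coef[OF b S1(1)] sqint_cnj[OF S1(4)]])
    have i3: "integrable ?M (\<lambda>x. ?c (c k x) * weak_partial \<Omega> k u x * cnj (?c (v x)))" for k
      by (rule sqint_mult_integrable[OF coef[OF bdd_measurable_of_real[OF c] S1(2)] sqint_cnj[OF S1(3)]])
    have i4: "integrable ?M (\<lambda>x. c0 x * u x * cnj (?c (v x)))"
      by (rule sqint_mult_integrable[OF coef[OF c0 S1(1)] sqint_cnj[OF S1(3)]])
    have r1: "Re (?c (a k l x) * weak_partial \<Omega> l u x * cnj (?c (h k x))) = a k l x * p l x * h k x" for k l x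
      by (simp add: p_def)
    have r2: "Re (b k x * u x * cnj (?c (h k x))) = Re (b k x * u x) * h k x" for k x by simp
    have r3: "Re (?c (c k x) * weak_partial \<Omega> k u x * cnj (?c (v x))) = c k x * p k x * v x" for k x
      by (simp add: p_def)
    have r4: "Re (c0 x * u x * cnj (?c (v x))) = Re (c0 x * u x) * v x" for x by simp
    have j1: "integrable ?M (\<lambda>x. a k l x * p l x * h k x)" for k l using integrable_Re[OF i1] unfolding r1 .
    have j2: "integrable ?M (\<lambda>x. Re (b k x * u x) * h k x)" for k using integrable_Re[OF i2] unfolding r2 .
    have j3: "integrable ?M (\<lambda>x. c k x * p k x * v x)" for k using integrable_Re[OF i3] unfolding r3 .
    have j4: "integrable ?M (\<lambda>x. Re (c0 x * u x) * v x)" using integrable_Re[OF i4] unfolding r4 .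
    define J where "J x = (\<Sum>k\<in>UNIV. \<Sum>l\<in>UNIV. a k l x * p l x * h k x) + (\<Sum>k\<in>UNIV. Re (b k x * u x) * h k x)
       + (\<Sum>k\<in>UNIV. c k x * p k x * v x) + Re (c0 x * u x) * v x" for x
    have Ji: "integrable ?M J"
      unfolding J_def by (intro Bochner_Integration.integrable_add Bochner_Integration.integrable_sum j1 j2 j3 j4)
    have ReZ: "Re ?Z = (LINT x|?M. J x)"
    proof -
      have "Re ?Z = (\<Sum>k\<in>UNIV. \<Sum>l\<in>UNIV. LINT x|?M. a k l x * p l x * h k x) +
        (\<Sum>k\<in>UNIV. LINT x|?M. Re (b k x * u x) * h k x) + (\<Sum>k\<in>UNIV. LINT x|?M. c k x * p k x * v x) +
        (LINT x|?M. Re (c0 x * u x) * v x)"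
        unfolding plus_complex.sel Re_sum
        by (simp only: integral_Re[OF i1, symmetric] integral_Re[OF i2, symmetric] integral_Re[OF i3, symmetric]
              integral_Re[OF i4, symmetric] r1 r2 r3 r4)
      also have "\<dots> = (LINT x|?M. J x)"
        unfolding J_def
        by (simp only: Bochner_Integration.integral_add Bochner_Integration.integral_sum j1 j2 j3 j4
              Bochner_Integration.integrable_add Bochner_Integration.integrable_sum)
      finally show ?thesis .
    qed
    define Pr where "Pr k x = (if 0 < f x then chi x * p k x else 0)" for k x
    have P_eq: "P k = (\<lambda>x. ?c (Pr k x))" for k unfolding P_def Pr_def p_def ..
    have fm: "f \<in> borel_measurable (lebesgue_on \<Omega>)" using Lm[OF fL] by (rule borel_measurable_of_realD)
    have Pm: "P k \<in> borel_measurable (lebesgue_on \<Omega>)" for k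
    proof -
      have [measurable]: "chi \<in> borel_measurable (lebesgue_on \<Omega>)" "p k \<in> borel_measurable (lebesgue_on \<Omega>)"
        using borel_measurable_of_realD[OF chim] borel_measurable_of_realD[OF Lm[OF pL]] by auto
      note fm [measurable]
      show ?thesis unfolding P_eq Pr_def by measurable
    qed
    have Pi: "sqint ?M (P k)" for k
    proof (rule sqint_bound[where g = "\<lambda>x. (norm (?c (p k x)))\<^sup>2"])
      show "P k \<in> borel_measurable ?M" using Pm K'(2) by (rule measurable_restrict_mono)
      show "integrable ?M (\<lambda>x. (norm (?c (p k x)))\<^sup>2)" using Ls[OF pL] unfolding sqint_def by blast
      show "AE x in ?M. (norm (P k x))\<^sup>2 \<le> (norm (?c (p k x)))\<^sup>2"
      proof (rule AE_I2)
        fix x assume "x \<in> space ?M"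
        then have "x \<in> \<Omega>" using K'(2) by auto
        then have "\<bar>chi x\<bar> * \<bar>p k x\<bar> \<le> 1 * \<bar>p k x\<bar>" using chi(1) by (intro mult_right_mono) auto
        then show "(norm (P k x))\<^sup>2 \<le> (norm (?c (p k x)))\<^sup>2"
          by (intro power_mono) (auto simp: P_eq Pr_def abs_mult)
      qed
    qed
    have di: "sqint ?M (\<lambda>x. ?c (d k x))" and ei: "sqint ?M (\<lambda>x. ?c (e k x))" for k
      by (rule Ls[OF dL], rule Ls[OF eL])
    have oi: "sqint ?M (\<lambda>x. 1)" by (rule sqint_const[OF lmeasurable_compact[OF K'(1)]])
    have sq: "integrable ?M (\<lambda>x. (Pr k x)\<^sup>2)" "(LINT x|?M. (Pr k x)\<^sup>2) = sqnorm ?M (P k)"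
      "integrable ?M (\<lambda>x. (d k x)\<^sup>2)" "(LINT x|?M. (d k x)\<^sup>2) = sqnorm ?M (\<lambda>x. ?c (d k x))"
      "integrable ?M (\<lambda>x. (e k x)\<^sup>2)" "(LINT x|?M. (e k x)\<^sup>2) = sqnorm ?M (\<lambda>x. ?c (e k x))"
      "integrable ?M (\<lambda>x. 1 :: real)" "(LINT x|?M. (1 :: real)) = sqnorm ?M (\<lambda>x. 1)" for k
      using Pi[of k] di[of k] ei[of k] oi unfolding P_eq by (simp_all add: sqint_def sqnorm_def)
    define Tt where "Tt = (\<Sum>k\<in>UNIV. sqnorm ?M (P k))"
    have dK: "(\<Sum>k\<in>UNIV. sqnorm ?M (\<lambda>x. ?c (d k x))) \<le> D"
      unfolding D_def by (intro sum_mono sqnorm_subset sub) (use d in \<open>simp add: L2_iff\<close>)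
    have eK: "(\<Sum>k\<in>UNIV. sqnorm ?M (\<lambda>x. ?c (e k x))) \<le> 1"
      by (rule order_trans[OF sum_mono e1], rule sqnorm_subset[OF sub]) (use e in \<open>simp add: L2_iff\<close>)
    have oK: "sqnorm ?M (\<lambda>x. 1) \<le> V"
      unfolding V_def by (rule sqnorm_subset[OF sub sqint_const[OF lm]])
    have low: "(\<mu> / 2) * Tt - \<kappa> * (V + D + 1) \<le> (LINT x|?M. J x)"
    proof -
      have "(LINT x|?M. (\<mu> / 2) * (\<Sum>k\<in>UNIV. (Pr k x)\<^sup>2) - \<kappa> * (1 + (\<Sum>k\<in>UNIV. (d k x)\<^sup>2) + (\<Sum>k\<in>UNIV. (e k x)\<^sup>2)))
         \<le> (LINT x|?M. J x)"
      proof (rule integral_mono[OF _ Ji])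
        show "integrable ?M (\<lambda>x. (\<mu> / 2) * (\<Sum>k\<in>UNIV. (Pr k x)\<^sup>2) - \<kappa> * (1 + (\<Sum>k\<in>UNIV. (d k x)\<^sup>2) + (\<Sum>k\<in>UNIV. (e k x)\<^sup>2)))"
          by (intro Bochner_Integration.integrable_diff Bochner_Integration.integrable_add integrable_mult_right Bochner_Integration.integrable_sum sq)
        fix x assume "x \<in> space ?M"
        then have x: "x \<in> \<Omega>" using K'(2) by auto
        show "(\<mu> / 2) * (\<Sum>k\<in>UNIV. (Pr k x)\<^sup>2) - \<kappa> * (1 + (\<Sum>k\<in>UNIV. (d k x)\<^sup>2) + (\<Sum>k\<in>UNIV. (e k x)\<^sup>2)) \<le> J x"
        proof (cases "0 < f x")
          case True
          then have 1: "\<psi> x = f x" "\<And>k. G k x = F k x" "\<And>k. Pr k x = chi x * p k x" by (auto simp: \<psi>_def G_def Pr_def)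
          have hx: "h k x = chi x * (chi x * p k x + u1 x * d k x - M * e k x) + \<psi> x * d k x" for k
            by (simp add: h_def 1(2) F_def mult.commute)
          show ?thesis
            unfolding J_def v_def 1(3)
            by (rule energy_pointwise[where chi = "chi x" and p = "\<lambda>k. p k x" and u = "u1 x" and \<psi> = "\<psi> x" and M = M and B = B and N = N and a = "\<lambda>k l. a k l x"
                  and d = "\<lambda>k. d k x" and e = "\<lambda>k. e k x" and h = "\<lambda>k. h k x" and \<beta> = "\<lambda>k. Re (b k x * u x)" and \<gamma> = "\<lambda>k. c k x" and \<delta> = "Re (c0 x * u x)",
                  OF el[OF x] \<mu> Bn Ba'[OF x] Bb'[OF x] Bc'[OF x] B0'[OF x] _ _ _ \<psi>chi[OF x] _ u1M[OF x] hx N_def \<kappa>_def])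
               (use chi(1)[OF x] True 1 M(1) in auto)
        next
          case False
          then have "J x = 0" "Pr k x = 0" for k by (auto simp: J_def v_def h_def \<psi>_def G_def Pr_def)
          then show ?thesis using \<kappa>0 by (simp add: sum_nonneg)
        qed
      qed
      also have "(LINT x|?M. (\<mu> / 2) * (\<Sum>k\<in>UNIV. (Pr k x)\<^sup>2) - \<kappa> * (1 + (\<Sum>k\<in>UNIV. (d k x)\<^sup>2) + (\<Sum>k\<in>UNIV. (e k x)\<^sup>2))) =
         (\<mu> / 2) * Tt - \<kappa> * (sqnorm ?M (\<lambda>x. 1) + (\<Sum>k\<in>UNIV. sqnorm ?M (\<lambda>x. ?c (d k x))) + (\<Sum>k\<in>UNIV. sqnorm ?M (\<lambda>x. ?c (e k x))))"
        unfolding Tt_def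
        by (simp only: Bochner_Integration.integral_diff Bochner_Integration.integral_add Bochner_Integration.integral_sum
            integral_mult_right_zero Bochner_Integration.integrable_diff Bochner_Integration.integrable_add integrable_mult_right Bochner_Integration.integrable_sum sq)
      finally have l: "(\<mu> / 2) * Tt - \<kappa> * (sqnorm ?M (\<lambda>x. 1) + (\<Sum>k\<in>UNIV. sqnorm ?M (\<lambda>x. ?c (d k x))) + (\<Sum>k\<in>UNIV. sqnorm ?M (\<lambda>x. ?c (e k x))))
        \<le> (LINT x|?M. J x)" .
      have "\<kappa> * (sqnorm ?M (\<lambda>x. 1) + (\<Sum>k\<in>UNIV. sqnorm ?M (\<lambda>x. ?c (d k x))) + (\<Sum>k\<in>UNIV. sqnorm ?M (\<lambda>x. ?c (e k x)))) \<le> \<kappa> * (V + D + 1)"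
        by (intro mult_left_mono add_mono oK dK eK \<kappa>0)
      with l show ?thesis by linarith
    qed
    have hsq: "sqnorm ?M (\<lambda>x. ?c (h k x)) \<le> 3 * sqnorm ?M (P k) + 12 * M\<^sup>2 * sqnorm ?M (\<lambda>x. ?c (d k x)) + 3 * M\<^sup>2 * sqnorm ?M (\<lambda>x. ?c (e k x))" for k
    proof -
      have "sqnorm ?M (\<lambda>x. ?c (h k x)) \<le> (LINT x|?M. 3 * (Pr k x)\<^sup>2 + 12 * M\<^sup>2 * (d k x)\<^sup>2 + 3 * M\<^sup>2 * (e k x)\<^sup>2)"
        unfolding sqnorm_def
      proof (rule integral_mono)
        show "integrable ?M (\<lambda>x. (norm (?c (h k x)))\<^sup>2)" using S1(4)[of k] unfolding sqint_def by blast
        show "integrable ?M (\<lambda>x. 3 * (Pr k x)\<^sup>2 + 12 * M\<^sup>2 * (d k x)\<^sup>2 + 3 * M\<^sup>2 * (e k x)\<^sup>2)"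
          by (intro Bochner_Integration.integrable_add integrable_mult_right sq)
        fix x assume "x \<in> space ?M"
        then have x: "x \<in> \<Omega>" using K'(2) by auto
        have hb: "\<bar>h k x\<bar> \<le> \<bar>Pr k x\<bar> + 2 * (M * \<bar>d k x\<bar>) + M * \<bar>e k x\<bar>"
        proof (cases "0 < f x")
          case True
          have "\<bar>chi x * F k x\<bar> \<le> 1 * \<bar>F k x\<bar>" unfolding abs_mult using chi(1)[OF x] by (intro mult_right_mono) auto
          moreover have "\<bar>F k x\<bar> \<le> \<bar>Pr k x\<bar> + \<bar>u1 x * d k x\<bar> + \<bar>M * e k x\<bar>"
            using True abs_triangle_ineq[of "chi x * p k x" "u1 x * d k x"] abs_triangle_ineq4[of "chi x * p k x + u1 x * d k x" "M * e k x"]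
            by (simp add: F_def Pr_def)
          moreover have "\<bar>u1 x * d k x\<bar> \<le> M * \<bar>d k x\<bar>" unfolding abs_mult by (intro mult_right_mono u1M x) simp
          moreover have "\<bar>M * e k x\<bar> = M * \<bar>e k x\<bar>" using M(1) by (simp add: abs_mult)
          moreover have "\<bar>d k x * \<psi> x\<bar> \<le> M * \<bar>d k x\<bar>"
            unfolding abs_mult using \<psi>0[OF x] \<psi>M[OF x] by (subst mult.commute) (intro mult_right_mono, auto)
          moreover have "\<bar>h k x\<bar> \<le> \<bar>chi x * F k x\<bar> + \<bar>d k x * \<psi> x\<bar>"
            using True abs_triangle_ineq[of "chi x * F k x" "d k x * \<psi> x"] by (simp add: h_def G_def)
          ultimately show ?thesis by simp
        next
          case False
          then show ?thesis using M(1) by (simp add: h_def G_def \<psi>_def Pr_def)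
        qed
        then have "\<bar>h k x\<bar>\<^sup>2 \<le> (\<bar>Pr k x\<bar> + 2 * (M * \<bar>d k x\<bar>) + M * \<bar>e k x\<bar>)\<^sup>2" by (intro power_mono) auto
        also have "\<dots> \<le> 3 * \<bar>Pr k x\<bar>\<^sup>2 + 3 * (2 * (M * \<bar>d k x\<bar>))\<^sup>2 + 3 * (M * \<bar>e k x\<bar>)\<^sup>2" by (rule square_sum3_le)
        finally show "(norm (?c (h k x)))\<^sup>2 \<le> 3 * (Pr k x)\<^sup>2 + 12 * M\<^sup>2 * (d k x)\<^sup>2 + 3 * M\<^sup>2 * (e k x)\<^sup>2"
          by (simp add: power_mult_distrib)
      qed
      also have "\<dots> = 3 * sqnorm ?M (P k) + 12 * M\<^sup>2 * sqnorm ?M (\<lambda>x. ?c (d k x)) + 3 * M\<^sup>2 * sqnorm ?M (\<lambda>x. ?c (e k x))"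
        by (simp only: Bochner_Integration.integral_add integral_mult_right_zero Bochner_Integration.integrable_add integrable_mult_right sq)
      finally show ?thesis .
    qed
    have vsq: "sqnorm ?M (\<lambda>x. ?c (v x)) \<le> M\<^sup>2 * V"
    proof -
      have "sqnorm ?M (\<lambda>x. ?c (v x)) \<le> (LINT x|?M. M\<^sup>2 * 1)"
        unfolding sqnorm_def
      proof (rule integral_mono)
        show "integrable ?M (\<lambda>x. (norm (?c (v x)))\<^sup>2)" using S1(3) unfolding sqint_def by blast
        show "integrable ?M (\<lambda>x. M\<^sup>2 * 1)" by (intro integrable_mult_right sq)
        fix x assume "x \<in> space ?M"
        then have x: "x \<in> \<Omega>" using K'(2) by auto
        have "\<bar>v x\<bar> \<le> 1 * M" unfolding v_def abs_mult using chi(1)[OF x] \<psi>0[OF x] \<psi>M[OF x] by (intro mult_mono) auto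
        then have "\<bar>v x\<bar>\<^sup>2 \<le> M\<^sup>2" by (intro power_mono) auto
        then show "(norm (?c (v x)))\<^sup>2 \<le> M\<^sup>2 * 1" by simp
      qed
      also have "\<dots> = M\<^sup>2 * sqnorm ?M (\<lambda>x. 1)" by (simp only: integral_mult_right_zero sq)
      also have "\<dots> \<le> M\<^sup>2 * V" by (intro mult_left_mono oK) simp
      finally show ?thesis .
    qed
    define Q where "Q = M\<^sup>2 * V + 12 * M\<^sup>2 * D + 3 * M\<^sup>2"
    have X: "?X \<le> 3 * Tt + Q"
    proof -
      have "(\<Sum>k\<in>UNIV. sqnorm ?M (\<lambda>x. ?c (h k x))) \<le>
        (\<Sum>k\<in>UNIV. 3 * sqnorm ?M (P k) + 12 * M\<^sup>2 * sqnorm ?M (\<lambda>x. ?c (d k x)) + 3 * M\<^sup>2 * sqnorm ?M (\<lambda>x. ?c (e k x)))"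
        by (intro sum_mono hsq)
      also have "\<dots> = 3 * Tt + 12 * M\<^sup>2 * (\<Sum>k\<in>UNIV. sqnorm ?M (\<lambda>x. ?c (d k x))) + 3 * M\<^sup>2 * (\<Sum>k\<in>UNIV. sqnorm ?M (\<lambda>x. ?c (e k x)))"
        by (simp add: Tt_def sum.distrib sum_distrib_left)
      also have "\<dots> \<le> 3 * Tt + 12 * M\<^sup>2 * D + 3 * M\<^sup>2 * 1"
        by (intro add_mono mult_left_mono dK eK) auto
      finally show ?thesis using vsq by (simp add: Q_def)
    qed
    have X0: "0 \<le> ?X" by (intro add_nonneg_nonneg sum_nonneg sqnorm_nonneg)
    have "(\<mu> / 2) * Tt - \<kappa> * (V + D + 1) \<le> norm ?Z" using low complex_Re_le_cmod[of ?Z] unfolding ReZ by linarith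
    also have "norm ?Z \<le> C * sqrt ?X" by (rule ineq)
    also have "\<dots> \<le> (\<mu> / 12) * ?X + C\<^sup>2 / (4 * (\<mu> / 12))" using \<mu> X0 by (intro Young_sqrt) auto
    also have "\<dots> \<le> (\<mu> / 12) * (3 * Tt + Q) + C\<^sup>2 / (4 * (\<mu> / 12))" using X \<mu> by (intro add_right_mono mult_left_mono) auto
    finally have fin: "(\<mu> / 2) * Tt - \<kappa> * (V + D + 1) \<le> (\<mu> / 12) * (3 * Tt + Q) + C\<^sup>2 / (4 * (\<mu> / 12))" .
    have "(\<mu> / 4) * Tt \<le> \<kappa> * (V + D + 1) + (\<mu> / 12) * Q + C\<^sup>2 / (4 * (\<mu> / 12))"
    proof -
      have "(\<mu> / 12) * (3 * Tt + Q) = (\<mu> / 4) * Tt + (\<mu> / 12) * Q" by (simp add: distrib_left)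
      moreover have "(\<mu> / 2) * Tt = (\<mu> / 4) * Tt + (\<mu> / 4) * Tt" by simp
      ultimately show ?thesis using fin by linarith
    qed
    then have "(4 / \<mu>) * ((\<mu> / 4) * Tt) \<le> E"
      unfolding E_def Q_def using \<mu> by (intro mult_left_mono) auto
    then have TE: "Tt \<le> E" using \<mu> by simp
    have Pk: "sqnorm ?M (P k) \<le> Tt"
      unfolding Tt_def by (rule member_le_sum[of k UNIV "\<lambda>k. sqnorm ?M (P k)"]) (auto simp: sqnorm_nonneg)
    have P0: "AE x in lebesgue_on \<Omega>. x \<notin> K' \<longrightarrow> P k x = 0"
      using f0 by eventually_elim (use K'(3) in \<open>auto simp: P_eq Pr_def\<close>)
    show "sqint (lebesgue_on \<Omega>) (P k) \<and> sqnorm (lebesgue_on \<Omega>) (P k) \<le> E"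
      using sqint_extend[OF sub Pm P0 Pi] Pk TE by simp
  qed
qed

section \<open>Limits and capacity\<close>

lemma sqint_Fatou:
  assumes F: "\<And>n. sqint M (F n)" "\<And>n. sqnorm M (F n) \<le> E"
    and l: "AE x in M. (\<lambda>n. F n x) \<longlonglongrightarrow> f x" and f: "f \<in> borel_measurable M"
  shows "sqint M f"
proof -
  have Fm: "F n \<in> borel_measurable M" for n using F(1) by (rule sqint_measurable)
  have "(\<integral>\<^sup>+x. ennreal ((norm (f x))\<^sup>2) \<partial>M) = (\<integral>\<^sup>+x. liminf (\<lambda>n. ennreal ((norm (F n x))\<^sup>2)) \<partial>M)"
  proof (rule nn_integral_cong_AE)
    show "AE x in M. ennreal ((norm (f x))\<^sup>2) = liminf (\<lambda>n. ennreal ((norm (F n x))\<^sup>2))"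
      using l
    proof eventually_elim
      case (elim x)
      then have "(\<lambda>n. ennreal ((norm (F n x))\<^sup>2)) \<longlonglongrightarrow> ennreal ((norm (f x))\<^sup>2)"
        by (intro tendsto_ennrealI tendsto_intros)
      then show ?case by (intro lim_imp_Liminf[symmetric]) auto
    qed
  qed
  also have "\<dots> \<le> liminf (\<lambda>n. \<integral>\<^sup>+x. ennreal ((norm (F n x))\<^sup>2) \<partial>M)"
    by (rule nn_integral_liminf) (use Fm in measurable)
  also have "\<dots> \<le> liminf (\<lambda>n. ennreal E)"
  proof (rule Liminf_mono, rule always_eventually, rule allI)
    fix n
    have "(\<integral>\<^sup>+x. ennreal ((norm (F n x))\<^sup>2) \<partial>M) = ennreal (sqnorm M (F n))"
      unfolding sqnorm_def by (rule nn_integral_eq_integral) (use F(1)[of n] in \<open>auto simp: sqint_def\<close>)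
    then show "(\<integral>\<^sup>+x. ennreal ((norm (F n x))\<^sup>2) \<partial>M) \<le> ennreal E" using F(2)[of n] by (simp add: ennreal_leI)
  qed
  also have "\<dots> < \<infinity>" by (simp add: Liminf_const)
  finally have fin: "(\<integral>\<^sup>+x. ennreal ((norm (f x))\<^sup>2) \<partial>M) < \<infinity>" .
  have "integrable M (\<lambda>x. (norm (f x))\<^sup>2)"
    using f fin by (intro integrableI_bounded) auto
  with f show ?thesis by (simp add: sqint_def)
qed

lemma H10I:
  fixes v :: "real ^ 'n \<Rightarrow> complex"
  assumes \<Omega>: "open \<Omega>" and v: "v \<in> L2 \<Omega>" and g: "\<And>k. g k \<in> L2 \<Omega>" and w: "\<And>k. is_weak_partial \<Omega> k v (g k)"
    and approx: "\<And>\<delta>. 0 < \<delta> \<Longrightarrow> \<exists>\<phi>\<in>test_functions \<Omega>. sqnorm (lebesgue_on \<Omega>) (\<lambda>x. v x - \<phi> x)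
        + (\<Sum>k\<in>UNIV. sqnorm (lebesgue_on \<Omega>) (\<lambda>x. g k x - partial k \<phi> x)) < \<delta>"
  shows "v \<in> H10 \<Omega>"
  unfolding H10_def
proof (intro CollectI conjI allI impI)
  show "v \<in> H1 \<Omega>" unfolding H1_def using v g w by blast
  fix \<epsilon> :: real assume \<epsilon>: "0 < \<epsilon>"
  then obtain \<phi> where \<phi>: "\<phi> \<in> test_functions \<Omega>" "sqnorm (lebesgue_on \<Omega>) (\<lambda>x. v x - \<phi> x)
        + (\<Sum>k\<in>UNIV. sqnorm (lebesgue_on \<Omega>) (\<lambda>x. g k x - partial k \<phi> x)) < \<epsilon>\<^sup>2"
    using approx[of "\<epsilon>\<^sup>2"] by auto
  have "H1_norm \<Omega> (\<lambda>x. v x - \<phi> x) = sqrt (sqnorm (lebesgue_on \<Omega>) (\<lambda>x. v x - \<phi> x)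
        + (\<Sum>k\<in>UNIV. sqnorm (lebesgue_on \<Omega>) (\<lambda>x. g k x - partial k \<phi> x)))"
    by (intro H1_norm_eq \<Omega> is_weak_partial_diff w is_weak_partial_test test_functions_smooth[OF \<phi>(1)])
  also have "\<dots> < sqrt (\<epsilon>\<^sup>2)" using \<phi>(2) by (rule real_sqrt_less_mono)
  finally show "\<exists>\<phi>\<in>test_functions \<Omega>. H1_norm \<Omega> (\<lambda>x. v x - \<phi> x) < \<epsilon>" using \<phi>(1) \<epsilon> by auto
qed

lemma H10_limit:
  fixes v :: "real ^ 'n \<Rightarrow> complex"
  assumes \<Omega>: "open \<Omega>" and v: "v \<in> L2 \<Omega>" and g: "\<And>k. g k \<in> L2 \<Omega>" and w: "\<And>k. is_weak_partial \<Omega> k v (g k)"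
    and K: "\<And>n. compact (K n)" "\<And>n. K n \<subseteq> \<Omega>"
    and \<psi>: "\<And>n. \<psi> n \<in> L2loc \<Omega>" and G: "\<And>n k. G n k \<in> L2loc \<Omega>" and w\<psi>: "\<And>n k. is_weak_partial \<Omega> k (\<psi> n) (G n k)"
    and \<psi>0: "\<And>n. AE x in lebesgue_on \<Omega>. x \<notin> K n \<longrightarrow> \<psi> n x = 0"
    and G0: "\<And>n k. AE x in lebesgue_on \<Omega>. x \<notin> K n \<longrightarrow> G n k x = 0"
    and l: "sqlim (lebesgue_on \<Omega>) \<psi> v" "\<And>k. sqlim (lebesgue_on \<Omega>) (\<lambda>n. G n k) (g k)"
  shows "v \<in> H10 \<Omega>"
proof (rule H10I[OF \<Omega> v g w])
  let ?M = "lebesgue_on \<Omega>"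
  fix \<delta> :: real assume \<delta>: "0 < \<delta>"
  have small: "\<exists>n. sqnorm ?M (\<lambda>x. A n x - f x) + (\<Sum>k\<in>UNIV. sqnorm ?M (\<lambda>x. B n k x - h k x)) < \<delta> / 4"
    if "sqlim ?M A f" "\<And>k. sqlim ?M (\<lambda>n. B n k) (h k)" for A f and B :: "nat \<Rightarrow> 'n \<Rightarrow> real ^ 'n \<Rightarrow> complex" and h
  proof -
    have "(\<lambda>n. sqnorm ?M (\<lambda>x. A n x - f x) + (\<Sum>k\<in>UNIV. sqnorm ?M (\<lambda>x. B n k x - h k x))) \<longlonglongrightarrow> 0 + (\<Sum>k\<in>(UNIV :: 'n set). 0)"
      using that unfolding sqlim_def by (intro tendsto_add tendsto_sum) auto
    then have "\<forall>\<^sub>F n in sequentially. sqnorm ?M (\<lambda>x. A n x - f x) + (\<Sum>k\<in>UNIV. sqnorm ?M (\<lambda>x. B n k x - h k x)) < \<delta> / 4"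
      by (rule order_tendstoD(2)) (use \<delta> in simp)
    then show ?thesis by (meson eventually_happens' sequentially_bot)
  qed
  obtain n where n: "sqnorm ?M (\<lambda>x. \<psi> n x - v x) + (\<Sum>k\<in>UNIV. sqnorm ?M (\<lambda>x. G n k x - g k x)) < \<delta> / 4"
    using small[where B = G and h = g, OF l] by auto
  obtain \<phi> K' where \<phi>: "compact K'" "K' \<subseteq> \<Omega>" "K n \<subseteq> K'" "\<And>m. \<phi> m \<in> test_functions \<Omega>" "\<And>m. supp (\<phi> m) \<subseteq> K'"
    "sqlim ?M \<phi> (\<psi> n)" "\<And>k. sqlim ?M (\<lambda>m. partial k (\<phi> m)) (G n k)"
    by (rule compact_approximation[OF \<Omega> K(1)[of n] K(2)[of n] \<psi>[of n] G w\<psi> \<psi>0 G0], rule that)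
  obtain m where m: "sqnorm ?M (\<lambda>x. \<phi> m x - \<psi> n x) + (\<Sum>k\<in>UNIV. sqnorm ?M (\<lambda>x. partial k (\<phi> m) x - G n k x)) < \<delta> / 4"
    using small[where B = "\<lambda>m k. partial k (\<phi> m)" and h = "G n", OF \<phi>(6,7)] by auto
  have tri: "sqnorm ?M (\<lambda>x. f x - q x) \<le> 2 * sqnorm ?M (\<lambda>x. r x - f x) + 2 * sqnorm ?M (\<lambda>x. q x - r x)"
    if "sqint ?M f" "sqint ?M q" "sqint ?M r" for f q r
  proof -
    have "sqnorm ?M (\<lambda>x. (f x - r x) + (r x - q x)) \<le> 2 * sqnorm ?M (\<lambda>x. f x - r x) + 2 * sqnorm ?M (\<lambda>x. r x - q x)"
      by (intro sqnorm_add_le sqint_diff that)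
    then show ?thesis by (simp add: sqnorm_diff_commute[of _ f r] sqnorm_diff_commute[of _ r q])
  qed
  have i: "sqint ?M v" "sqint ?M (g k)" "sqint ?M (\<psi> n)" "sqint ?M (G n k)" "sqint ?M (\<phi> m)" "sqint ?M (partial k (\<phi> m))" for k
    using l \<phi>(6) \<phi>(7)[of k] v g by (auto simp: sqlim_def L2_iff)
  have "sqnorm ?M (\<lambda>x. v x - \<phi> m x) + (\<Sum>k\<in>UNIV. sqnorm ?M (\<lambda>x. g k x - partial k (\<phi> m) x)) \<le>
    (2 * sqnorm ?M (\<lambda>x. \<psi> n x - v x) + 2 * sqnorm ?M (\<lambda>x. \<phi> m x - \<psi> n x)) +
    (\<Sum>k\<in>UNIV. 2 * sqnorm ?M (\<lambda>x. G n k x - g k x) + 2 * sqnorm ?M (\<lambda>x. partial k (\<phi> m) x - G n k x))"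
    by (intro add_mono sum_mono tri i)
  also have "\<dots> = 2 * (sqnorm ?M (\<lambda>x. \<psi> n x - v x) + (\<Sum>k\<in>UNIV. sqnorm ?M (\<lambda>x. G n k x - g k x)))
    + 2 * (sqnorm ?M (\<lambda>x. \<phi> m x - \<psi> n x) + (\<Sum>k\<in>UNIV. sqnorm ?M (\<lambda>x. partial k (\<phi> m) x - G n k x)))"
    by (simp add: sum.distrib sum_distrib_left)
  also have "\<dots> < \<delta>"
  proof -
    have "A < \<delta> / 4 \<Longrightarrow> B < \<delta> / 4 \<Longrightarrow> 2 * A + 2 * B < \<delta>" for A B using \<delta> by linarith
    then show ?thesis using n m by simp
  qed
  finally show "\<exists>\<phi>\<in>test_functions \<Omega>. sqnorm ?M (\<lambda>x. v x - \<phi> x) + (\<Sum>k\<in>UNIV. sqnorm ?M (\<lambda>x. g k x - partial k \<phi> x)) < \<delta>"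
    using \<phi>(4) by blast
qed

lemma H1_weak_partial:
  fixes u :: "real ^ 'n \<Rightarrow> complex"
  assumes \<Omega>: "open \<Omega>" and u: "u \<in> H1 \<Omega>"
  shows "is_weak_partial \<Omega> k u (weak_partial \<Omega> k u)" "weak_partial \<Omega> k u \<in> L2 \<Omega>"
proof -
  obtain g where g: "g \<in> L2 \<Omega>" "is_weak_partial \<Omega> k u g" using u by (auto simp: H1_def)
  show w: "is_weak_partial \<Omega> k u (weak_partial \<Omega> k u)" using g(2) by (rule is_weak_partial_weak_partial)
  have "AE x in lebesgue_on \<Omega>. g x = weak_partial \<Omega> k u x"
    using weak_partial_AE[OF \<Omega> g(2)] by eventually_elim simp
  moreover have "weak_partial \<Omega> k u \<in> borel_measurable (lebesgue_on \<Omega>)"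
    using w by (intro L1loc_measurable[OF \<Omega>]) (simp add: is_weak_partial_def)
  ultimately show "weak_partial \<Omega> k u \<in> L2 \<Omega>"
    using sqint_cong_AE[of "lebesgue_on \<Omega>" g] g(1) by (simp add: L2_iff)
qed

lemma polar_approximation:
  fixes Q :: "(real ^ 'n) set"
  assumes Q: "polar Q" and \<delta>: "0 < \<delta>" and \<Omega>: "open \<Omega>"
  shows "\<exists>\<eta> e U. (\<forall>x. 0 \<le> \<eta> x) \<and> (\<lambda>x. complex_of_real (\<eta> x)) \<in> L2 \<Omega> \<and> (\<forall>k. (\<lambda>x. complex_of_real (e k x)) \<in> L2 \<Omega>)
    \<and> (\<forall>k. is_weak_partial \<Omega> k (\<lambda>x. complex_of_real (\<eta> x)) (\<lambda>x. complex_of_real (e k x)))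
    \<and> sqnorm (lebesgue_on \<Omega>) (\<lambda>x. complex_of_real (\<eta> x)) + (\<Sum>k\<in>UNIV. sqnorm (lebesgue_on \<Omega>) (\<lambda>x. complex_of_real (e k x))) < \<delta>
    \<and> open U \<and> Q \<subseteq> U \<and> (AE x in lebesgue_on U. 1 \<le> \<eta> x)"
proof -
  let ?c = complex_of_real and ?M = "lebesgue_on (UNIV :: (real ^ 'n) set)"
  have "cap Q < ereal \<delta>" using Q \<delta> by (simp add: polar_def)
  then obtain w :: "real ^ 'n \<Rightarrow> real" and U where w: "(\<lambda>x. ?c (w x)) \<in> H1 UNIV"
    and U: "open U" "Q \<subseteq> U" "AE x in lebesgue_on U. 1 \<le> w x" and small: "(H1_norm UNIV (\<lambda>x. ?c (w x)))\<^sup>2 < \<delta>"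
    unfolding cap_def Inf_less_iff by auto
  define gw where "gw k x = Re (weak_partial UNIV k (\<lambda>x. ?c (w x)) x)" for k x
  note W = H1_weak_partial[OF open_UNIV w]
  have wi: "sqint ?M (\<lambda>x. ?c (w x))" using w by (simp add: H1_def L2_iff)
  have gi: "sqint ?M (\<lambda>x. ?c (gw k x))" for k unfolding gw_def using W(2) by (intro sqint_Re) (simp add: L2_iff)
  have ww: "is_weak_partial UNIV k (\<lambda>x. ?c (w x)) (\<lambda>x. ?c (gw k x))" for k
    unfolding gw_def using is_weak_partial_Re[OF open_UNIV W(1)] by simp
  have L: "(\<lambda>x. ?c (w x)) \<in> L2loc UNIV" "(\<lambda>x. ?c (gw k x)) \<in> L2loc UNIV" for k
    using wi gi by (auto intro: L2_L2loc simp: L2_iff)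
  have N: "(H1_norm UNIV (\<lambda>x. ?c (w x)))\<^sup>2 = sqnorm ?M (\<lambda>x. ?c (w x)) + (\<Sum>k\<in>UNIV. sqnorm ?M (\<lambda>x. ?c (gw k x)))"
    unfolding H1_norm_eq[OF open_UNIV ww] by (intro real_sqrt_pow2 add_nonneg_nonneg sum_nonneg sqnorm_nonneg)
  define \<eta> where "\<eta> x = max (w x) 0" for x
  define e where "e k x = (if 0 < w x then gw k x else 0)" for k x
  note pp = is_weak_partial_pos_part[OF open_UNIV L ww, folded \<eta>_def e_def]
  have m: "(\<lambda>x. ?c (\<eta> x)) \<in> borel_measurable ?M" "(\<lambda>x. ?c (e k x)) \<in> borel_measurable ?M" for k
    by (intro L1loc_measurable open_UNIV L2loc_L1loc pp)+
  have \<eta>i: "sqint ?M (\<lambda>x. ?c (\<eta> x))"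
    by (rule sqint_bound[OF m(1), where g = "\<lambda>x. (norm (?c (w x)))\<^sup>2"])
       (use wi in \<open>auto simp: sqint_def \<eta>_def max_def\<close>)
  have ei: "sqint ?M (\<lambda>x. ?c (e k x))" for k
    by (rule sqint_bound[OF m(2), where g = "\<lambda>x. (norm (?c (gw k x)))\<^sup>2"])
       (use gi[of k] in \<open>auto simp: sqint_def e_def\<close>)
  have le: "sqnorm ?M (\<lambda>x. ?c (\<eta> x)) \<le> sqnorm ?M (\<lambda>x. ?c (w x))" "sqnorm ?M (\<lambda>x. ?c (e k x)) \<le> sqnorm ?M (\<lambda>x. ?c (gw k x))" for k
    unfolding sqnorm_def
    by (rule integral_mono; use wi gi[of k] \<eta>i ei[of k] in \<open>auto simp: sqint_def \<eta>_def e_def max_def\<close>)+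
  have sub: "\<Omega> \<in> sets lebesgue" "UNIV \<in> sets (lebesgue :: (real ^ 'n) measure)" "\<Omega> \<subseteq> UNIV" using \<Omega> by (auto simp: open_lebesgue)
  have "sqnorm (lebesgue_on \<Omega>) (\<lambda>x. ?c (\<eta> x)) + (\<Sum>k\<in>UNIV. sqnorm (lebesgue_on \<Omega>) (\<lambda>x. ?c (e k x)))
     \<le> sqnorm ?M (\<lambda>x. ?c (w x)) + (\<Sum>k\<in>UNIV. sqnorm ?M (\<lambda>x. ?c (gw k x)))"
    by (intro add_mono sum_mono order_trans[OF sqnorm_subset[OF sub \<eta>i] le(1)] order_trans[OF sqnorm_subset[OF sub ei] le(2)])
  then have "sqnorm (lebesgue_on \<Omega>) (\<lambda>x. ?c (\<eta> x)) + (\<Sum>k\<in>UNIV. sqnorm (lebesgue_on \<Omega>) (\<lambda>x. ?c (e k x))) < \<delta>"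
    using small N by simp
  moreover have "AE x in lebesgue_on U. 1 \<le> \<eta> x" using U(3) by eventually_elim (simp add: \<eta>_def)
  moreover have "(\<lambda>x. ?c (\<eta> x)) \<in> L2 \<Omega>" "\<forall>k. (\<lambda>x. ?c (e k x)) \<in> L2 \<Omega>"
    using sqint_subset[OF sub \<eta>i] sqint_subset[OF sub ei] by (auto simp: L2_iff)
  moreover have "\<forall>k. is_weak_partial \<Omega> k (\<lambda>x. ?c (\<eta> x)) (\<lambda>x. ?c (e k x))"
    by (intro allI is_weak_partial_subset[OF open_UNIV \<Omega> subset_UNIV pp(1)])
  moreover have "\<forall>x. 0 \<le> \<eta> x" by (simp add: \<eta>_def)
  ultimately show ?thesis using U(1,2) by (intro exI[of _ \<eta>] exI[of _ e] exI[of _ U] conjI)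
qed

lemma compact_off_boundary:
  fixes \<Omega> :: "(real ^ 'n) set" and w :: "real ^ 'n \<Rightarrow> real"
  assumes \<Omega>: "open \<Omega>" "bounded \<Omega>" and \<epsilon>: "0 < \<epsilon>" and U: "open U" "Q \<subseteq> U"
    and l: "\<And>z. z \<in> frontier \<Omega> - Q \<Longrightarrow> Limsup (at z within \<Omega>) (\<lambda>x. ereal (w x)) \<le> 0"
  shows "\<exists>K. compact K \<and> K \<subseteq> \<Omega> \<and> (\<forall>x\<in>\<Omega>. x \<notin> K \<longrightarrow> x \<in> U \<or> w x < \<epsilon>)"
proof -
  define W where "W = \<Union>{S. open S \<and> (\<forall>x\<in>S \<inter> \<Omega>. w x < \<epsilon>)}"
  have W: "open W" unfolding W_def by (intro open_Union) auto
  have fr: "frontier \<Omega> \<subseteq> U \<union> W"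
  proof
    fix z assume z: "z \<in> frontier \<Omega>"
    show "z \<in> U \<union> W"
    proof (cases "z \<in> Q")
      case True
      then show ?thesis using U(2) by auto
    next
      case False
      then have "Limsup (at z within \<Omega>) (\<lambda>x. ereal (w x)) \<le> 0" using z by (intro l) simp
      also have "(0 :: ereal) < ereal \<epsilon>" using \<epsilon> by simp
      finally have "eventually (\<lambda>x. ereal (w x) < ereal \<epsilon>) (at z within \<Omega>)" by (rule Limsup_lessD)
      then obtain S where S: "open S" "z \<in> S" "\<And>x. x \<in> S \<Longrightarrow> x \<noteq> z \<Longrightarrow> x \<in> \<Omega> \<Longrightarrow> w x < \<epsilon>"
        unfolding eventually_at_topological by auto
      have "z \<notin> \<Omega>" using z \<Omega>(1) by (simp add: frontier_def interior_open)
      then have "S \<in> {S. open S \<and> (\<forall>x\<in>S \<inter> \<Omega>. w x < \<epsilon>)}" using S(1,3) by auto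
      then have "z \<in> W" unfolding W_def using S(2) by (rule UnionI)
      then show ?thesis by simp
    qed
  qed
  define K where "K = closure \<Omega> - (U \<union> W)"
  have "compact (closure \<Omega>)" using \<Omega>(2) by (simp add: compact_closure)
  moreover have "K = closure \<Omega> \<inter> (- (U \<union> W))" by (auto simp: K_def)
  moreover have "closed (- (U \<union> W))" using U(1) W by (intro closed_Compl open_Un)
  ultimately have "compact K" by (simp add: compact_Int_closed)
  moreover have "K \<subseteq> \<Omega>"
  proof
    fix x assume x: "x \<in> K"
    then have "x \<notin> frontier \<Omega>" using fr by (auto simp: K_def)
    with x have "x \<in> interior \<Omega>" by (simp add: K_def frontier_def)
    then show "x \<in> \<Omega>" using \<Omega>(1) by (simp add: interior_open)
  qed
  moreover have "\<forall>x\<in>\<Omega>. x \<notin> K \<longrightarrow> x \<in> U \<or> w x < \<epsilon>"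
  proof (intro ballI impI)
    fix x assume x: "x \<in> \<Omega>" "x \<notin> K"
    then have "x \<in> U \<or> x \<in> W" using subsetD[OF closure_subset x(1)] by (simp add: K_def)
    then show "x \<in> U \<or> w x < \<epsilon>"
    proof
      assume "x \<in> W"
      then obtain S where "x \<in> S" "\<forall>x\<in>S \<inter> \<Omega>. w x < \<epsilon>" unfolding W_def by auto
      with x(1) show ?thesis by auto
    qed simp
  qed
  ultimately show ?thesis by (intro exI[of _ K] conjI)
qed

theorem theorem3p9:
  fixes \<Omega> :: "(real ^ 'n) set"
    and a :: "'n \<Rightarrow> 'n \<Rightarrow> real ^ 'n \<Rightarrow> real"
    and b :: "'n \<Rightarrow> real ^ 'n \<Rightarrow> complex"
    and c :: "'n \<Rightarrow> real ^ 'n \<Rightarrow> real"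
    and c0 :: "real ^ 'n \<Rightarrow> complex"
    and \<mu> :: real
    and u :: "real ^ 'n \<Rightarrow> complex"
    and chi :: "real ^ 'n \<Rightarrow> real"
  assumes dim: "2 \<le> CARD('n)"
    and "open \<Omega>" and "bounded \<Omega>"
    and "\<And>k l. bdd_measurable \<Omega> (a k l)"
    and "\<And>k. bdd_measurable \<Omega> (b k)"
    and "\<And>k. bdd_measurable \<Omega> (c k)"
    and "bdd_measurable \<Omega> c0"
    and "0 < \<mu>" and "\<mu> \<le> 1"
    and ellipticity: "\<And>x (\<xi> :: complex ^ 'n). x \<in> \<Omega> \<Longrightarrow>
      Re (\<Sum>k\<in>UNIV. \<Sum>l\<in>UNIV. complex_of_real (a k l x) * \<xi> $ k * cnj (\<xi> $ l)) \<ge> \<mu> * (norm \<xi>)\<^sup>2"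
    and not_dirichlet_eigenvalue: "\<And>w. w \<in> H10 \<Omega> \<Longrightarrow>
      (\<forall>v\<in>test_functions \<Omega>. elliptic_op \<Omega> a b c c0 w v = 0) \<Longrightarrow> (AE x in lebesgue_on \<Omega>. w x = 0)"
    and "u \<in> Cb \<Omega> \<inter> H1loc \<Omega>"
    and "(\<lambda>x. complex_of_real (chi x)) \<in> Cb \<Omega> \<inter> H1 \<Omega>"
    and "\<And>x. x \<in> \<Omega> \<Longrightarrow> 0 \<le> chi x \<and> chi x \<le> 1"
    and "elliptic_op \<Omega> a b c c0 u \<in> Hminus1 \<Omega>"
    and "quasi_everywhere (frontier \<Omega>)
      (\<lambda>z. Limsup (at z within \<Omega>) (\<lambda>x. ereal (chi x * Re (u x))) \<le> 0)"
  shows "(\<lambda>x. complex_of_real (max (chi x * Re (u x)) 0)) \<in> H10 \<Omega>"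
proof -
  let ?c = complex_of_real and ?M = "lebesgue_on \<Omega>"
  note \<Omega> = \<open>open \<Omega>\<close> \<open>bounded \<Omega>\<close> and chi01 = assms(14)
  have lm: "\<Omega> \<in> lmeasurable" using \<Omega>(2,1) by (rule lmeasurable_open)
  have u: "u \<in> H1loc \<Omega>" and "bounded (u ` \<Omega>)" using assms(12) by (auto simp: Cb_def)
  then obtain M where M: "0 < M" "\<And>x. x \<in> \<Omega> \<Longrightarrow> norm (u x) \<le> M"
    unfolding bounded_pos by auto
  have chiH: "(\<lambda>x. ?c (chi x)) \<in> H1 \<Omega>" using assms(13) by simp
  then have chi2: "(\<lambda>x. ?c (chi x)) \<in> L2 \<Omega>" by (simp add: H1_def)
  obtain C where C: "\<And>v. v \<in> test_functions \<Omega> \<Longrightarrow> norm (elliptic_op \<Omega> a b c c0 u v) \<le> C * H1_norm \<Omega> v"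
    using assms(15) by (auto simp: Hminus1_def)
  obtain Q where Q: "Q \<subseteq> frontier \<Omega>" "polar Q"
    "\<And>z. z \<in> frontier \<Omega> - Q \<Longrightarrow> Limsup (at z within \<Omega>) (\<lambda>x. ereal (chi x * Re (u x))) \<le> 0"
    using assms(16) unfolding quasi_everywhere_def by auto
  have el: "\<mu> * (\<Sum>k\<in>UNIV. (\<xi> k)\<^sup>2) \<le> (\<Sum>k\<in>UNIV. \<Sum>l\<in>UNIV. a k l x * \<xi> k * \<xi> l)" if "x \<in> \<Omega>" for x and \<xi> :: "'n \<Rightarrow> real"
  proof -
    have "(norm (\<chi> k. ?c (\<xi> k)))\<^sup>2 = (\<Sum>k\<in>UNIV. (\<xi> k)\<^sup>2)"
      by (simp add: norm_vec_def L2_set_def sum_nonneg)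
    then show ?thesis using ellipticity[OF that, of "\<chi> k. ?c (\<xi> k)"] by (simp add: Re_sum)
  qed
  define d where "d k x = Re (weak_partial \<Omega> k (\<lambda>x. ?c (chi x)) x)" for k x
  note Wchi = H1_weak_partial[OF \<Omega>(1) chiH]
  have d2: "(\<lambda>x. ?c (d k x)) \<in> L2 \<Omega>" for k
    unfolding d_def L2_iff by (rule sqint_Re) (use Wchi(2) in \<open>simp add: L2_iff\<close>)
  have wchi: "is_weak_partial \<Omega> k (\<lambda>x. ?c (chi x)) (\<lambda>x. ?c (d k x))" for k
    unfolding d_def using is_weak_partial_Re[OF \<Omega>(1) Wchi(1)] by simp
  define p where "p k x = Re (weak_partial \<Omega> k u x)" for k x
  define u1 where "u1 x = Re (u x)" for x
  note gu = H1loc_weak_partial[OF \<Omega>(1) u]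
  have u1L: "(\<lambda>x. ?c (u1 x)) \<in> L2loc \<Omega>"
    unfolding u1_def by (rule L2loc_Re) (use u in \<open>simp add: H1loc_def\<close>)
  have pL: "(\<lambda>x. ?c (p k x)) \<in> L2loc \<Omega>" for k unfolding p_def by (rule L2loc_Re[OF gu(2)])
  have wu: "is_weak_partial \<Omega> k (\<lambda>x. ?c (u1 x)) (\<lambda>x. ?c (p k x))" for k
    unfolding p_def u1_def by (rule is_weak_partial_Re[OF \<Omega>(1) gu(1)])
  have u1M: "\<bar>u1 x\<bar> \<le> M" if "x \<in> \<Omega>" for x
    using M(2)[OF that] abs_Re_le_cmod[of "u x"] by (simp add: u1_def)
  note chiL = L2_L2loc[OF \<Omega>(1) chi2] and dL = L2_L2loc[OF \<Omega>(1) d2]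
  have chi1: "\<bar>chi x\<bar> \<le> 1" if "x \<in> \<Omega>" for x using chi01[OF that] by simp
  from energy_estimate[OF \<Omega> assms(4-7) \<open>0 < \<mu>\<close> el u C M chi01 chi2 d2 wchi]
  obtain E where E: "\<forall>\<epsilon> \<eta> e K f P k. 0 < \<epsilon> \<longrightarrow> (\<forall>x. 0 \<le> \<eta> x) \<longrightarrow> (\<lambda>x. ?c (\<eta> x)) \<in> L2 \<Omega> \<longrightarrow>
      (\<forall>k. (\<lambda>x. ?c (e k x)) \<in> L2 \<Omega>) \<longrightarrow>
      (\<forall>k. is_weak_partial \<Omega> k (\<lambda>x. ?c (\<eta> x)) (\<lambda>x. ?c (e k x))) \<longrightarrow>
      (\<Sum>k\<in>UNIV. sqnorm ?M (\<lambda>x. ?c (e k x))) \<le> 1 \<longrightarrow>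
      compact K \<longrightarrow> K \<subseteq> \<Omega> \<longrightarrow> f = (\<lambda>x. chi x * Re (u x) - \<epsilon> - M * \<eta> x) \<longrightarrow>
      (AE x in ?M. x \<notin> K \<longrightarrow> f x \<le> 0) \<longrightarrow>
      P = (\<lambda>k x. ?c (if 0 < f x then chi x * Re (weak_partial \<Omega> k u x) else 0)) \<longrightarrow>
      sqint ?M (P k) \<and> sqnorm ?M (P k) \<le> E"
    by (rule exE)
  define \<epsilon> where "\<epsilon> n = inverse (real (Suc n))" for n
  have \<epsilon>: "0 < \<epsilon> n" "\<epsilon> n \<le> 1" for n by (auto simp: \<epsilon>_def field_simps)
  have \<epsilon>0: "\<epsilon> \<longlonglongrightarrow> 0" unfolding \<epsilon>_def[abs_def] by (rule LIMSEQ_inverse_real_of_nat)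
  define R where "R n \<eta> e U \<longleftrightarrow> (\<forall>x. 0 \<le> \<eta> x) \<and> (\<lambda>x. ?c (\<eta> x)) \<in> L2 \<Omega> \<and> (\<forall>k. (\<lambda>x. ?c (e k x)) \<in> L2 \<Omega>)
    \<and> (\<forall>k. is_weak_partial \<Omega> k (\<lambda>x. ?c (\<eta> x)) (\<lambda>x. ?c (e k x)))
    \<and> sqnorm ?M (\<lambda>x. ?c (\<eta> x)) + (\<Sum>k\<in>UNIV. sqnorm ?M (\<lambda>x. ?c (e k x))) < \<epsilon> n
    \<and> open U \<and> Q \<subseteq> U \<and> (AE x in lebesgue_on U. 1 \<le> \<eta> x)" for n \<eta> e U
  have "\<exists>\<eta> e U. R n \<eta> e U" for n
    unfolding R_def by (rule polar_approximation[OF Q(2) \<epsilon>(1) \<Omega>(1)])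
  then obtain \<eta> e U where R: "\<And>n. R n (\<eta> n) (e n) (U n)" by metis
  have \<eta>: "\<And>n x. 0 \<le> \<eta> n x" "\<And>n. (\<lambda>x. ?c (\<eta> n x)) \<in> L2 \<Omega>" and e: "\<And>n k. (\<lambda>x. ?c (e n k x)) \<in> L2 \<Omega>"
    and w\<eta>: "\<And>n k. is_weak_partial \<Omega> k (\<lambda>x. ?c (\<eta> n x)) (\<lambda>x. ?c (e n k x))"
    and small: "\<And>n. sqnorm ?M (\<lambda>x. ?c (\<eta> n x)) + (\<Sum>k\<in>UNIV. sqnorm ?M (\<lambda>x. ?c (e n k x))) < \<epsilon> n"
    and U: "\<And>n. open (U n)" "\<And>n. Q \<subseteq> U n" "\<And>n. AE x in lebesgue_on (U n). 1 \<le> \<eta> n x"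
    using R unfolding R_def by simp_all
  have e_le: "sqnorm ?M (\<lambda>x. ?c (e n k x)) \<le> (\<Sum>k\<in>UNIV. sqnorm ?M (\<lambda>x. ?c (e n k x)))" for n k
    by (rule member_le_sum[of k UNIV "\<lambda>k. sqnorm ?M (\<lambda>x. ?c (e n k x))"]) (auto simp: sqnorm_nonneg)
  have small1: "sqnorm ?M (\<lambda>x. ?c (\<eta> n x)) \<le> \<epsilon> n" "(\<Sum>k\<in>UNIV. sqnorm ?M (\<lambda>x. ?c (e n k x))) \<le> 1" "sqnorm ?M (\<lambda>x. ?c (e n k x)) \<le> \<epsilon> n" for n k
    using small[of n] \<epsilon>(2)[of n] e_le[of n k] sqnorm_nonneg[of ?M "\<lambda>x. ?c (\<eta> n x)"]
      order_trans[OF sqnorm_nonneg e_le[of n k]] by linarith+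
  define f where "f n x = chi x * u1 x - \<epsilon> n - M * \<eta> n x" for n x
  define F where "F n k x = chi x * p k x + u1 x * d k x - M * e n k x" for n k x
  define w where "w x = chi x * u1 x" for x
  define wF where "wF k x = chi x * p k x + u1 x * d k x" for k x
  note cut = cutoff_difference[OF \<Omega>(1) chiL chi1 dL wchi u1L u1M pL wu L2_L2loc[OF \<Omega>(1) \<eta>(2)] L2_L2loc[OF \<Omega>(1) e] w\<eta>]
  have fF: "(\<lambda>x. ?c (f n x)) \<in> L2loc \<Omega>" "(\<lambda>x. ?c (F n k x)) \<in> L2loc \<Omega>"
    "is_weak_partial \<Omega> k (\<lambda>x. ?c (f n x)) (\<lambda>x. ?c (F n k x))" for n k
    unfolding f_def F_def by (rule cut; assumption)+
  have zero: "(\<lambda>x. ?c 0) \<in> L2loc \<Omega>" "is_weak_partial \<Omega> k (\<lambda>x. ?c 0) (\<lambda>x. ?c 0)" for k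
    using L2loc_const[of "?c 0"] is_weak_partial_const[OF \<Omega>(1), of k "?c 0"] by simp_all
  note cut0 = cutoff_difference[OF \<Omega>(1) chiL chi1 dL wchi u1L u1M pL wu zero(1) zero(1) zero(2)]
  have wwF: "(\<lambda>x. ?c (w x)) \<in> L2loc \<Omega>" "(\<lambda>x. ?c (wF k x)) \<in> L2loc \<Omega>"
    "is_weak_partial \<Omega> k (\<lambda>x. ?c (w x)) (\<lambda>x. ?c (wF k x))" for k
    using cut0(1)[where \<epsilon> = 0] cut0(2)[of k] cut0(3)[where \<epsilon> = 0 and k = k]
    unfolding w_def wF_def by (simp_all only: mult_zero_right diff_zero)
  define \<psi> where "\<psi> n x = max (f n x) 0" for n x
  define G where "G n k x = (if 0 < f n x then F n k x else 0)" for n k x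
  define g where "g k x = (if 0 < w x then wF k x else 0)" for k x
  note ppf = is_weak_partial_pos_part[OF \<Omega>(1) fF, folded \<psi>_def G_def]
  note ppw = is_weak_partial_pos_part[OF \<Omega>(1) wwF, folded g_def]
  have wM: "w x \<le> M" if "x \<in> \<Omega>" for x
  proof -
    have "w x \<le> \<bar>chi x\<bar> * \<bar>u1 x\<bar>" unfolding w_def abs_mult[symmetric] by simp
    also have "\<dots> \<le> 1 * M" by (intro mult_mono chi1 u1M that) auto
    finally show ?thesis by simp
  qed
  have fw: "f n x \<le> w x - \<epsilon> n" for n x using M(1) \<eta>(1)[of n x] by (simp add: f_def w_def)
  have "\<forall>n. \<exists>K. compact K \<and> K \<subseteq> \<Omega> \<and> (\<forall>x\<in>\<Omega>. x \<notin> K \<longrightarrow> x \<in> U n \<or> w x < \<epsilon> n)"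
    unfolding w_def u1_def by (intro allI compact_off_boundary[OF \<Omega> \<epsilon>(1) U(1) U(2) Q(3)])
  then obtain K where K: "\<And>n. compact (K n)" "\<And>n. K n \<subseteq> \<Omega>" "\<And>n x. x \<in> \<Omega> \<Longrightarrow> x \<notin> K n \<Longrightarrow> x \<in> U n \<or> w x < \<epsilon> n"
    by metis
  have f0: "AE x in ?M. x \<notin> K n \<longrightarrow> f n x \<le> 0" for n
  proof -
    have "AE x in lebesgue. x \<in> U n \<longrightarrow> 1 \<le> \<eta> n x" using U(3) by (simp add: AE_lebesgue_on open_lebesgue U(1))
    then have "AE x in lebesgue. x \<in> \<Omega> \<longrightarrow> x \<notin> K n \<longrightarrow> f n x \<le> 0"
    proof eventually_elim
      case (elim x)
      show ?case
      proof (intro impI)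
        assume x: "x \<in> \<Omega>" "x \<notin> K n"
        show "f n x \<le> 0"
        proof (cases "x \<in> U n")
          case True
          then have "M * 1 \<le> M * \<eta> n x" using elim M(1) by (intro mult_left_mono) auto
          then show ?thesis using wM[OF x(1)] \<epsilon>(1)[of n] by (simp add: f_def w_def)
        next
          case False
          then show ?thesis using K(3)[OF x] fw[of n x] by simp
        qed
      qed
    qed
    then show ?thesis by (simp add: AE_lebesgue_on open_lebesgue \<Omega>)
  qed
  define P where "P n k x = ?c (if 0 < f n x then chi x * p k x else 0)" for n k x
  have PE: "sqint ?M (P n k)" "sqnorm ?M (P n k) \<le> E" for n k
  proof -
    have "sqint ?M (P n k) \<and> sqnorm ?M (P n k) \<le> E"
    proof (rule E[rule_format])
      show "f n = (\<lambda>x. chi x * Re (u x) - \<epsilon> n - M * \<eta> n x)" unfolding f_def[abs_def] u1_def ..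
      show "P n = (\<lambda>k x. ?c (if 0 < f n x then chi x * Re (weak_partial \<Omega> k u x) else 0))"
        unfolding P_def[abs_def] p_def ..
    qed (fact \<epsilon>(1) \<eta> e w\<eta> small1(2) K(1) K(2) f0)+
    then show "sqint ?M (P n k)" "sqnorm ?M (P n k) \<le> E" by auto
  qed
  have lim\<eta>: "sqlim ?M (\<lambda>n x. ?c (\<eta> n x)) (\<lambda>x. 0)"
    unfolding sqlim_def
  proof (intro conjI allI)
    show "(\<lambda>n. sqnorm ?M (\<lambda>x. ?c (\<eta> n x) - 0)) \<longlonglongrightarrow> 0"
      by (rule Lim_null_comparison[OF _ \<epsilon>0]) (intro always_eventually allI, simp add: sqnorm_nonneg small1)
  qed (use \<eta>(2) sqint_const[OF lm, of 0] in \<open>auto simp: L2_iff\<close>)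
  obtain r :: "nat \<Rightarrow> nat" where r: "strict_mono r" "AE x in ?M. (\<lambda>n. ?c (\<eta> (r n) x)) \<longlonglongrightarrow> 0"
    using sqlim_AE_subseq[OF lim\<eta>] by auto
  have \<epsilon>r: "(\<lambda>n. \<epsilon> (r n)) \<longlonglongrightarrow> 0" using LIMSEQ_subseq_LIMSEQ[OF \<epsilon>0 r(1)] by (simp add: o_def)
  have fr: "AE x in ?M. (\<lambda>n. f (r n) x) \<longlonglongrightarrow> w x"
    using r(2)
  proof eventually_elim
    case (elim x)
    from tendsto_Re[OF this] have "(\<lambda>n. \<eta> (r n) x) \<longlonglongrightarrow> 0" by simp
    then have "(\<lambda>n. w x - \<epsilon> (r n) - M * \<eta> (r n) x) \<longlonglongrightarrow> w x - 0 - M * 0"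
      by (intro tendsto_intros \<epsilon>r)
    then show ?case by (simp add: f_def w_def)
  qed
  have switch: "AE x in ?M. \<forall>A. (\<lambda>n. if 0 < f (r n) x then A else (0 :: complex)) \<longlonglongrightarrow> (if 0 < w x then A else 0)"
    using fr
  proof eventually_elim
    case (elim x)
    show ?case
    proof (intro allI)
      fix A :: complex
      show "(\<lambda>n. if 0 < f (r n) x then A else 0) \<longlonglongrightarrow> (if 0 < w x then A else 0)"
      proof (cases "0 < w x")
        case True
        have "eventually (\<lambda>n. 0 < f (r n) x) sequentially" by (rule order_tendstoD(1)[OF elim True])
        then have "eventually (\<lambda>n. (if 0 < f (r n) x then A else 0) = A) sequentially" by eventually_elim simp
        with True show ?thesis by (simp add: tendsto_eventually)
      next
        case False
        have "\<not> 0 < f (r n) x" for n using fw[of "r n" x] \<epsilon>(1)[of "r n"] False by linarith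
        with False show ?thesis by simp
      qed
    qed
  qed
  note Lm = L1loc_measurable[OF \<Omega>(1) L2loc_L1loc]
  have meas [measurable]: "w \<in> borel_measurable ?M" "chi \<in> borel_measurable ?M" "u1 \<in> borel_measurable ?M"
    "p k \<in> borel_measurable ?M" "d k \<in> borel_measurable ?M" "f n \<in> borel_measurable ?M" "e n k \<in> borel_measurable ?M" for n k
    by (rule borel_measurable_of_realD, rule Lm, fact wwF(1) chiL u1L pL dL fF(1) L2_L2loc[OF \<Omega>(1) e])+
  have Pw: "sqint ?M (\<lambda>x. ?c (if 0 < w x then chi x * p k x else 0))" for k
  proof (rule sqint_Fatou[of _ "\<lambda>n. P (r n) k" E])
    show "AE x in ?M. (\<lambda>n. P (r n) k x) \<longlonglongrightarrow> ?c (if 0 < w x then chi x * p k x else 0)"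
      using switch
    proof eventually_elim
      case (elim x)
      have if_c: "?c (if B then y else 0) = (if B then ?c y else 0)" for B y by simp
      show ?case unfolding P_def if_c by (rule elim[rule_format])
    qed
  qed (use PE in \<open>auto\<close>)
  have g2: "(\<lambda>x. ?c (g k x)) \<in> L2 \<Omega>" for k
  proof -
    have "sqint ?M (\<lambda>x. ?c (if 0 < w x then u1 x else 0) * ?c (d k x))"
    proof (rule sqint_bmult[where B = M])
      show "sqint ?M (\<lambda>x. ?c (d k x))" using d2 by (simp add: L2_iff)
      show "AE x in ?M. norm (?c (if 0 < w x then u1 x else 0)) \<le> M"
        by (rule AE_I2) (use u1M M(1) in auto)
    qed measurable
    from sqint_add[OF Pw this] have "sqint ?M (\<lambda>x. ?c (if 0 < w x then chi x * p k x else 0) + ?c (if 0 < w x then u1 x else 0) * ?c (d k x))" .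
    moreover have "(\<lambda>x. ?c (if 0 < w x then chi x * p k x else 0) + ?c (if 0 < w x then u1 x else 0) * ?c (d k x)) = (\<lambda>x. ?c (g k x))"
      by (auto simp: g_def wF_def)
    ultimately show ?thesis by (simp add: L2_iff)
  qed
  have limG: "sqlim ?M (\<lambda>n x. ?c (G (r n) k x)) (\<lambda>x. ?c (g k x))" for k
  proof -
    have gi: "sqint ?M (\<lambda>x. ?c (g k x))" using g2 by (simp add: L2_iff)
    have 1: "sqlim ?M (\<lambda>n x. if 0 < f (r n) x then ?c (g k x) else 0) (\<lambda>x. ?c (g k x))"
    proof (rule sqlim_dominated[where g = "\<lambda>x. (norm (?c (g k x)))\<^sup>2"])
      show "AE x in ?M. (\<lambda>n. if 0 < f (r n) x then ?c (g k x) else 0) \<longlonglongrightarrow> ?c (g k x)"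
        using switch
      proof eventually_elim
        case (elim x)
        show ?case using elim[rule_format, of "?c (g k x)"] by (simp add: g_def split: if_splits)
      qed
      show [measurable]: "(\<lambda>x. ?c (g k x)) \<in> borel_measurable ?M" using gi by (simp add: sqint_def)
      show "(\<lambda>x. if 0 < f (r n) x then ?c (g k x) else 0) \<in> borel_measurable ?M" for n
        by measurable
    qed (use gi in \<open>auto simp: sqint_def\<close>)
    have 2: "sqlim ?M (\<lambda>n x. ?c (if 0 < f (r n) x then - M else 0) * ?c (e (r n) k x)) (\<lambda>x. 0)"
      unfolding sqlim_def
    proof (intro conjI allI)
      have ei: "sqint ?M (\<lambda>x. ?c (e n k x))" for n using e by (simp add: L2_iff)
      have B: "AE x in ?M. norm (?c (if 0 < f (r n) x then - M else 0)) \<le> M" for n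
        by (rule AE_I2) (use M(1) in auto)
      have m: "(\<lambda>x. ?c (if 0 < f (r n) x then - M else 0)) \<in> borel_measurable ?M" for n by measurable
      show "sqint ?M (\<lambda>x. ?c (if 0 < f (r n) x then - M else 0) * ?c (e (r n) k x))" for n
        by (rule sqint_bmult[OF ei m B])
      show "(\<lambda>n. sqnorm ?M (\<lambda>x. ?c (if 0 < f (r n) x then - M else 0) * ?c (e (r n) k x) - 0)) \<longlonglongrightarrow> 0"
      proof (rule Lim_null_comparison)
        show "(\<lambda>n. M\<^sup>2 * \<epsilon> (r n)) \<longlonglongrightarrow> 0" using tendsto_mult_right_zero[OF \<epsilon>r] .
        show "\<forall>\<^sub>F n in sequentially. norm (sqnorm ?M (\<lambda>x. ?c (if 0 < f (r n) x then - M else 0) * ?c (e (r n) k x) - 0)) \<le> M\<^sup>2 * \<epsilon> (r n)"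
        proof (intro always_eventually allI)
          fix n
          have "sqnorm ?M (\<lambda>x. ?c (if 0 < f (r n) x then - M else 0) * ?c (e (r n) k x)) \<le> M\<^sup>2 * sqnorm ?M (\<lambda>x. ?c (e (r n) k x))"
            by (rule sqnorm_bmult_le[OF ei m B])
          also have "\<dots> \<le> M\<^sup>2 * \<epsilon> (r n)" by (intro mult_left_mono small1) simp
          finally show "norm (sqnorm ?M (\<lambda>x. ?c (if 0 < f (r n) x then - M else 0) * ?c (e (r n) k x) - 0)) \<le> M\<^sup>2 * \<epsilon> (r n)"
            by (simp only: diff_zero real_norm_def abs_of_nonneg[OF sqnorm_nonneg])
        qed
      qed
    qed (use sqint_const[OF lm, of 0] in simp)
    show ?thesis
    proof (rule sqlim_cong[OF sqlim_add[OF 1 2]])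
      fix n x
      show "(if 0 < f (r n) x then ?c (g k x) else 0) + ?c (if 0 < f (r n) x then - M else 0) * ?c (e (r n) k x) = ?c (G (r n) k x)"
      proof (cases "0 < f (r n) x")
        case True
        then have "0 < w x" using fw[of "r n" x] \<epsilon>(1)[of "r n"] by linarith
        with True show ?thesis by (simp add: G_def g_def F_def wF_def)
      qed (simp add: G_def)
    qed simp
  qed
  have lim\<psi>: "sqlim ?M (\<lambda>n x. ?c (\<psi> (r n) x)) (\<lambda>x. ?c (max (w x) 0))"
  proof (rule sqlim_dominated[where g = "\<lambda>x. M\<^sup>2"])
    show "integrable ?M (\<lambda>x. M\<^sup>2)" using finite_measure.integrable_const[OF finite_measure_lebesgue_on[OF lm]] .
    show "(\<lambda>x. ?c (\<psi> (r n) x)) \<in> borel_measurable ?M" for n by (rule Lm[OF ppf(2)])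
    show "(\<lambda>x. ?c (max (w x) 0)) \<in> borel_measurable ?M" by (rule Lm[OF ppw(2)])
    show "AE x in ?M. (norm (?c (\<psi> (r n) x)))\<^sup>2 \<le> M\<^sup>2" for n
    proof (rule AE_I2)
      fix x assume "x \<in> space ?M"
      then have "\<psi> (r n) x \<le> M" using wM[of x] fw[of "r n" x] \<epsilon>(1)[of "r n"] M(1) by (simp add: \<psi>_def)
      then show "(norm (?c (\<psi> (r n) x)))\<^sup>2 \<le> M\<^sup>2" by (intro power_mono) (auto simp: \<psi>_def)
    qed
    show "AE x in ?M. (\<lambda>n. ?c (\<psi> (r n) x)) \<longlonglongrightarrow> ?c (max (w x) 0)"
      using fr by eventually_elim (unfold \<psi>_def, intro tendsto_intros)
  qed
  have "(\<lambda>x. ?c (max (w x) 0)) \<in> H10 \<Omega>"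
  proof (rule H10_limit[OF \<Omega>(1) _ g2 ppw(1) K(1) K(2) ppf(2) ppf(3) ppf(1) _ _ lim\<psi> limG])
    show "(\<lambda>x. ?c (max (w x) 0)) \<in> L2 \<Omega>" using lim\<psi> by (simp add: sqlim_def L2_iff)
    show "AE x in ?M. x \<notin> K (r n) \<longrightarrow> ?c (\<psi> (r n) x) = 0" for n
      using f0[of "r n"] by eventually_elim (simp add: \<psi>_def)
    show "AE x in ?M. x \<notin> K (r n) \<longrightarrow> ?c (G (r n) k x) = 0" for n k
      using f0[of "r n"] by eventually_elim (auto simp: G_def)
  qed
  then show ?thesis by (simp add: w_def u1_def)
qed

end
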